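(* Let $S$ be a countable set and let $X=(X_i)_{i\ge 0}$ be a transient partially exchangeable process taking values in $S$ whose initial state $X_0$ is non-random. Let $M=(M(u,v))_{u,v\in S}$ be the transition numbers of $X$, $M(u,v)=\#\{i\ge 0:(X_i,X_{i+1})=(u,v)\}$. Then the partially exchangeable $\sigma$-algebra of $X$ is generated up to null sets by $M$; that is, the $\sigma$-algebras $\{\{X\in A\}:A\in\mathcal{P}(S)\}$ and $\sigma(M)$ coincide up to null sets (they have the same completion).
   Context: For finite sequences $x=(x_0,\dots,x_n)$ and $y=(y_0,\dots,y_n)$ in $S$, write $x\simeq y$ if $x_0=y_0$ and $\#\{0\le i\le n-1:(x_i,x_{i+1})=(u,v)\}=\#\{0\le i\le n-1:(y_i,y_{i+1})=(u,v)\}$ for all $u,v\in S$. A random sequence $X=(X_0,X_1,\dots)$ in $S$ is partially exchangeable if $\mathbb{P}((X_0,\dots,X_n)=(x_0,\dots,x_n))=\mathbb{P}((X_0,\dots,X_n)=(x'_0,\dots,x'_n))$ for every $n\ge 0$ and all finite sequences with $(x_0,\dots,x_n)\simeq(x'_0,\dots,x'_n)$. It is transient if almost surely it visits each state of $S$ at most finitely many times. For infinite sequences $x,x'\in S^{\mathbb{N}}$ (with $\mathbb{N}=\{0,1,2,\dots\}$), write $x\simeq x'$ if there exists $N<\infty$ such that $x_n=x'_n$ for all $n\ge N$ and $(x_0,\dots,x_N)\simeq(x'_0,\dots,x'_N)$. A set $A\subseteq S^{\mathbb{N}}$ is partially exchangeable if $x\in A$ implies $x'\in A$ for all $x'\simeq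 x$. The partially exchangeable $\sigma$-algebra $\mathcal{P}(S)$ is the $\sigma$-algebra of partially exchangeable Borel subsets of $S^{\mathbb{N}}$ ($S$ discrete, product topology). The partially exchangeable $\sigma$-algebra of $X$ is the pull-back $\{\{X\in A\}:A\in\mathcal{P}(S)\}$. *)

theory Defs
  imports "HOL-Probability.Probability" "HOL-Library.Extended_Nat"
begin

(* A finite sequence (x_0, ..., x_n) is given by a function on nat together with n;
   only the values at indices <= n matter. *)
definition fin_equiv :: "'a set \<Rightarrow> nat \<Rightarrow> (nat \<Rightarrow> 'a) \<Rightarrow> (nat \<Rightarrow> 'a) \<Rightarrow> bool" where
  "fin_equiv S n x y \<longleftrightarrow>
     x 0 = y 0 \<and>
     (\<forall>u\<in>S. \<forall>v\<in>S. card {i. i < n \<and> (x i, x (Suc i)) = (u, v)}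
                 = card {i. i < n \<and> (y i, y (Suc i)) = (u, v)})"

definition inf_equiv :: "'a set \<Rightarrow> (nat \<Rightarrow> 'a) \<Rightarrow> (nat \<Rightarrow> 'a) \<Rightarrow> bool" where
  "inf_equiv S x y \<longleftrightarrow> (\<exists>N. (\<forall>n\<ge>N. x n = y n) \<and> fin_equiv S N x y)"

definition partially_exchangeable_process ::
  "'w measure \<Rightarrow> 'a set \<Rightarrow> (nat \<Rightarrow> 'w \<Rightarrow> 'a) \<Rightarrow> bool" where
  "partially_exchangeable_process P S X \<longleftrightarrow>
     (\<forall>n x x'. (\<forall>i\<le>n. x i \<in> S) \<longrightarrow> (\<forall>i\<le>n. x' i \<in> S) \<longrightarrow> fin_equiv S n x x' \<longrightarrow>
        measure P {w \<in> space P. \<forall>i\<le>n. X i w = x i}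
      = measure P {w \<in> space P. \<forall>i\<le>n. X i w = x' i})"

definition transient_process ::
  "'w measure \<Rightarrow> 'a set \<Rightarrow> (nat \<Rightarrow> 'w \<Rightarrow> 'a) \<Rightarrow> bool" where
  "transient_process P S X \<longleftrightarrow> (AE w in P. \<forall>s\<in>S. finite {n. X n w = s})"

definition path_topology :: "'a set \<Rightarrow> (nat \<Rightarrow> 'a) topology" where
  "path_topology S = product_topology (\<lambda>_. discrete_topology S) UNIV"

definition borel_path_sets :: "'a set \<Rightarrow> (nat \<Rightarrow> 'a) set set" where
  "borel_path_sets S = sigma_sets (topspace (path_topology S)) {U. openin (path_topology S) U}"

definition partially_exchangeable_set :: "'a set \<Rightarrow> (nat \<Rightarrow> 'a) set \<Rightarrow> bool" where
  "partially_exchangeable_set S A \<longleftrightarrow>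
     A \<subseteq> (UNIV \<rightarrow> S) \<and>
     (\<forall>x\<in>A. \<forall>x'\<in>UNIV \<rightarrow> S. inf_equiv S x x' \<longrightarrow> x' \<in> A)"

definition partially_exchangeable_path_sets :: "'a set \<Rightarrow> (nat \<Rightarrow> 'a) set set" where
  "partially_exchangeable_path_sets S =
     {A \<in> borel_path_sets S. partially_exchangeable_set S A}"

definition partially_exchangeable_events ::
  "'w measure \<Rightarrow> 'a set \<Rightarrow> (nat \<Rightarrow> 'w \<Rightarrow> 'a) \<Rightarrow> 'w set set" where
  "partially_exchangeable_events P S X =
     {{w \<in> space P. (\<lambda>n. X n w) \<in> A} | A. A \<in> partially_exchangeable_path_sets S}"

(* The number of elements, with value infinity (and not 0, as for card) on infinite sets. *)
definition enat_card :: "'b set \<Rightarrow> enat" where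
  "enat_card A = (if finite A then enat (card A) else \<infinity>)"

definition transition_number :: "(nat \<Rightarrow> 'w \<Rightarrow> 'a) \<Rightarrow> 'w \<Rightarrow> 'a \<Rightarrow> 'a \<Rightarrow> enat" where
  "transition_number X w u v = enat_card {i. (X i w, X (Suc i) w) = (u, v)}"

definition transition_events ::
  "'w measure \<Rightarrow> 'a set \<Rightarrow> (nat \<Rightarrow> 'w \<Rightarrow> 'a) \<Rightarrow> 'w set set" where
  "transition_events P S X =
     sets (vimage_algebra (space P)
       (\<lambda>w. \<lambda>(u, v)\<in>S \<times> S. transition_number X w u v)
       (\<Pi>\<^sub>M uv\<in>S \<times> S. count_space UNIV))"

(* Null sets are those of the ambient measure P. Completing instead with respect to the
   restriction of P to the sub-sigma-algebra G may give a smaller sigma-algebra. *)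
definition completed_by_null_sets :: "'w measure \<Rightarrow> 'w set set \<Rightarrow> 'w set set" where
  "completed_by_null_sets P G = sigma_sets (space P) (G \<union> null_sets (completion P))"

end

theory Submission
  imports Defs
begin

text \<open>
  For a transient path with transition numbers M let d(u) be the sum of the M(u, v) over v, that
  is, the number of visits to u. Transition numbers are invariant under the equivalence of paths,
  so they generate partially exchangeable events. The substance is the converse: every partially
  exchangeable event A is almost surely determined by M.

  It suffices to find a function \<phi> with P(X_1 = v, X \<in> A) = E[\<phi>(s, M, v); X \<in> A] for all
  invariant A, where s is the initial state. Restricting to an invariant event and deleting the first
  step both preserve exchangeability (\<open>exch_measure_density\<close>, \<open>exch_measure_shift\<close>), so an induction
  on the length of a word w turns this into P(X starts with w, X \<in> A) = E[\<phi>_w(M); X \<in> A]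
  (\<open>emeasure_word\<close>). With g = P(A | M), the measures with densities g and 1_A then agree on
  all cylinders; hence g = 1_A almost surely (\<open>invariant_set_AE_transition_algebra\<close>).

  To find \<phi>, cut the path at time n. Given its transitions T before n and its future, the initial
  part is a uniformly chosen Eulerian trail of T from s to X_n. By the BEST theorem the last
  exits of such a trail form a random tree directed to X_n, of weight the product of the T(u, l(u)),
  and the other exits are ordered uniformly (\<open>card_trails_with\<close>). So the first step is governed
  by the last exit from s. The obstacle is that T and X_n are not functions of M; states that
  will be visited again enter with incomplete counts. Call a state dead if it is not visited at or
  after time n, and let the core D be the largest set of dead states that no last exit from a state
  outside D enters. The tree outside D determines D, and given that part the tree inside D is a
  weighted forest in which every state has a path out of D, with the final weights M(u, v). For such
  forests the last exit from s is w with probability proportional to M(s, w) (1 - f(w)), where f(w)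
  is the probability that the Markov chain with kernel M/d started at w hits s before leaving D
  (\<open>lead_sum_harmonic\<close>, \<open>forest_step_weight\<close>).

  Along a last exit the time of the last visit increases, so in the last exit tree a state has only
  finitely many descendants and the cores exhaust the visited states (\<open>eventually_in_path_core\<close>).
  Therefore f(w) converges to the probability that the chain ever hits s from w, and this depends on
  M only. The normalising constants are at least 1 because the path carries one unit of flow from s
  to infinity (\<open>escape_flow\<close>).
\<close>

section \<open>Following a map until it leaves a set\<close>

text \<open>
  \<open>leads l U Z u\<close>: iterating \<open>l\<close> from \<open>u\<close>, through points of \<open>U\<close> only, reaches \<open>Z\<close>. With
  \<open>Z = - U\<close> it says that the orbit leaves \<open>U\<close>; if it holds for all \<open>u\<close> then \<open>l\<close> has no
  cycle inside \<open>U\<close>.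
\<close>

inductive leads :: "('a \<Rightarrow> 'a) \<Rightarrow> 'a set \<Rightarrow> 'a set \<Rightarrow> 'a \<Rightarrow> bool"
  for l :: "'a \<Rightarrow> 'a" and U Z :: "'a set" where
  leads_here: "u \<in> Z \<Longrightarrow> leads l U Z u"
| leads_step: "u \<in> U \<Longrightarrow> leads l U Z (l u) \<Longrightarrow> leads l U Z u"

lemma leads_exit_mono:
  assumes "leads l U (- U) u" "U' \<subseteq> U"
  shows "leads l U' (- U') u"
  using assms(1)
proof induction
  case (leads_here u)
  then show ?case using assms(2) by (auto intro: leads.leads_here)
next
  case (leads_step u)
  then show ?case by (cases "u \<in> U'") (auto intro: leads.intros)
qed

lemma leads_out_iff: "u \<notin> U \<Longrightarrow> leads l U Z u \<longleftrightarrow> u \<in> Z"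
  by (auto elim: leads.cases intro: leads.intros)

lemma leads_step_iff: "u \<in> U \<Longrightarrow> u \<notin> Z \<Longrightarrow> leads l U Z u \<longleftrightarrow> leads l U Z (l u)"
  by (auto elim: leads.cases intro: leads.intros)

lemma leads_mono: "leads l U Z u \<Longrightarrow> U \<subseteq> U' \<Longrightarrow> Z \<subseteq> Z' \<Longrightarrow> leads l U' Z' u"
  by (induction rule: leads.induct) (auto intro: leads.intros)

lemma leads_cong_imp:
  "leads l U Z u \<Longrightarrow> (\<And>w. w \<in> U \<Longrightarrow> l w = l' w) \<Longrightarrow> leads l' U Z u"
  by (induction rule: leads.induct) (auto intro: leads.intros)

lemma leads_cong: "(\<And>w. w \<in> U \<Longrightarrow> l w = l' w) \<Longrightarrow> leads l U Z u \<longleftrightarrow> leads l' U Z u"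
  using leads_cong_imp[of l U Z u l'] leads_cong_imp[of l' U Z u l] by auto

lemma leads_disjoint:
  assumes "leads l U Z u" "leads l U Z' u" "Z \<inter> U = {}" "Z' \<inter> U = {}"
  shows "Z \<inter> Z' \<noteq> {}"
  using assms
proof (induction rule: leads.induct)
  case (leads_here u)
  then show ?case by (metis disjoint_iff leads_out_iff)
next
  case (leads_step u)
  then show ?case by (metis disjoint_iff leads_step_iff)
qed

lemma leads_Un: "leads l U (Z \<union> Z') u \<longleftrightarrow> leads l U Z u \<or> leads l U Z' u"
proof
  show "leads l U Z u \<or> leads l U Z' u" if "leads l U (Z \<union> Z') u"
    using that by (induction rule: leads.induct) (auto intro: leads.intros)
qed (auto elim: leads_mono)

text \<open>
  Redirecting a point \<open>u\<close> outside \<open>E\<close> to \<open>a\<close> lets exactly those orbits continue that had stopped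
  at \<open>u\<close>; they then share the fate of \<open>a\<close>. The hypothesis on \<open>a\<close> excludes the new cycle through \<open>u\<close>.
\<close>

lemma leads_upd_iff:
  assumes u: "u \<notin> E" and Z: "Z \<inter> insert u E = {}" and a: "leads l E (- insert u E) a"
  shows "leads (l(u := a)) (insert u E) Z v \<longleftrightarrow> leads l E Z v \<or> (leads l E {u} v \<and> leads l E Z a)"
proof -
  let ?l = "l(u := a)" and ?D = "insert u E"
  have 1: "leads ?l ?D Z w" if "leads l E Z w" for w
  proof -
    have "leads ?l E Z w" by (rule leads_cong_imp[OF that]) (use u in auto)
    then show ?thesis by (rule leads_mono) auto
  qed
  have 2: "leads ?l ?D Z w" if "leads l E {u} w" "leads ?l ?D Z a" for w
    using that
  proof (induction rule: leads.induct)
    case (leads_here w)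
    then show ?case using Z by (simp add: leads_step_iff)
  next
    case (leads_step w)
    then have "w \<noteq> u" using u by auto
    moreover have "leads ?l ?D Z (l w)" using leads_step by blast
    ultimately have "leads ?l ?D Z (?l w)" by simp
    moreover have "w \<in> ?D" using leads_step by blast
    ultimately show ?case by (rule leads.leads_step[rotated])
  qed
  have 3: "leads l E Z w \<or> (leads l E {u} w \<and> leads l E Z a)" if "leads ?l ?D Z w" for w
    using that
  proof (induction rule: leads.induct)
    case (leads_here w)
    then show ?case by (auto intro: leads.leads_here)
  next
    case (leads_step w)
    show ?case
    proof (cases "w = u")
      case True
      have "\<not> leads l E {u} a"
        using leads_disjoint[OF a, of "{u}"] u by auto
      then show ?thesis using leads_step True leads.leads_here[of u "{u}" l E] by simp
    next
      case False
      then show ?thesis using leads_step leads.leads_step[of w E l] by auto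
    qed
  qed
  show ?thesis using 1 2 3 by blast
qed

section \<open>Eulerian trails with prescribed last exits\<close>

text \<open>
  A trail starting at \<open>s\<close> is represented by the list of its later vertices, so that trails of a given
  transition multiset can be counted by recursion on the first step.
\<close>

primrec trans_mset :: "'a \<Rightarrow> 'a list \<Rightarrow> ('a \<times> 'a) multiset" where
  "trans_mset s [] = {#}"
| "trans_mset s (v # ys) = add_mset (s, v) (trans_mset v ys)"

definition trails :: "('a \<times> 'a) multiset \<Rightarrow> 'a \<Rightarrow> 'a \<Rightarrow> 'a list set" where
  "trails T s z = {ys. trans_mset s ys = T \<and> last (s # ys) = z}"

definition sources :: "('a \<times> 'a) multiset \<Rightarrow> 'a set" where
  "sources T = fst ` set_mset T"

definition out_degree :: "('a \<times> 'a) multiset \<Rightarrow> 'a \<Rightarrow> nat" where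
  "out_degree T u = size {#e \<in># T. fst e = u#}"

definition in_degree :: "('a \<times> 'a) multiset \<Rightarrow> 'a \<Rightarrow> nat" where
  "in_degree T u = size {#e \<in># T. snd e = u#}"

definition balanced :: "('a \<times> 'a) multiset \<Rightarrow> 'a \<Rightarrow> 'a \<Rightarrow> bool" where
  "balanced T s z \<longleftrightarrow>
     (\<forall>u. out_degree T u + (if u = z then 1 else 0) = in_degree T u + (if u = s then 1 else 0))"

text \<open>
  The end point of a trail has a last exit too if the trail has passed through it before. Vertices
  that are never left get \<open>undefined\<close>.
\<close>

primrec last_exit :: "'a \<Rightarrow> 'a list \<Rightarrow> 'a \<Rightarrow> 'a" where
  "last_exit s [] = (\<lambda>_. undefined)"
| "last_exit s (v # ys) =
     (if s \<in> sources (trans_mset v ys) then last_exit v ys else (last_exit v ys)(s := v))"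

lemma finite_sources [simp]: "finite (sources T)"
  by (simp add: sources_def)

lemma size_trans_mset [simp]: "size (trans_mset s ys) = length ys"
  by (induction ys arbitrary: s) auto

lemma snd_trans_mset: "snd ` set_mset (trans_mset s ys) = set ys"
  by (induction ys arbitrary: s) auto

lemma sources_trans_mset: "sources (trans_mset s ys) = set (butlast (s # ys))"
  by (induction ys arbitrary: s) (auto simp: sources_def)

lemma finite_trails: "finite (trails T s z)"
proof (rule finite_subset)
  show "trails T s z \<subseteq> {ys. set ys \<subseteq> snd ` set_mset T \<and> length ys = size T}"
    by (force simp: trails_def snd_trans_mset simp del: last.simps)
  show "finite {ys. set ys \<subseteq> snd ` set_mset T \<and> length ys = size T}"
    by (rule finite_lists_length_eq) auto
qed

lemma filter_mset_empty_iff: "filter_mset P T = {#} \<longleftrightarrow> (\<forall>e\<in>#T. \<not> P e)"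
  by (induction T) auto

lemma out_degree_pos: "0 < out_degree T u \<longleftrightarrow> u \<in> sources T"
  by (force simp: out_degree_def sources_def nonempty_has_size[symmetric] filter_mset_empty_iff)

lemma in_degree_pos: "0 < in_degree T u \<longleftrightarrow> u \<in> snd ` set_mset T"
  by (force simp: in_degree_def nonempty_has_size[symmetric] filter_mset_empty_iff)

lemma out_degree_eq_sum:
  assumes "finite V" "snd ` set_mset T \<subseteq> V"
  shows "out_degree T u = (\<Sum>v\<in>V. count T (u, v))"
  using assms(2)
proof (induction T)
  case (add e T)
  obtain a b where e: "e = (a, b)" by (cases e)
  have "(\<Sum>v\<in>V. count (add_mset e T) (u, v)) =
      (\<Sum>v\<in>V. count T (u, v) + (if v = b then if a = u then 1 else 0 else 0))"
    by (rule sum.cong) (auto simp: e)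
  also have "\<dots> = (\<Sum>v\<in>V. count T (u, v)) + (if a = u then 1 else 0)"
    using assms(1) add.prems by (simp add: sum.distrib e)
  finally show ?case using add by (simp add: out_degree_def e)
qed (auto simp: out_degree_def)

lemma balanced_trans_mset: "balanced (trans_mset s ys) s (last (s # ys))"
proof (induction ys arbitrary: s)
  case (Cons v ys)
  have "out_degree (add_mset (s, v) T) u = out_degree T u + (if u = s then 1 else 0)"
    "in_degree (add_mset (s, v) T) u = in_degree T u + (if u = v then 1 else 0)" for T u
    by (simp_all add: out_degree_def in_degree_def)
  then show ?case
    using Cons[of v] unfolding balanced_def trans_mset.simps by simp
qed (simp add: balanced_def out_degree_def in_degree_def)

lemma balanced_step:
  assumes "balanced T s z" "(s, v) \<in># T"
  shows "balanced (T - {#(s, v)#}) v z"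
proof -
  obtain T' where T: "T = add_mset (s, v) T'" using assms(2) by (metis insert_DiffM)
  show ?thesis unfolding balanced_def
  proof
    fix u
    show "out_degree (T - {#(s, v)#}) u + (if u = z then 1 else 0)
        = in_degree (T - {#(s, v)#}) u + (if u = v then 1 else 0)"
      using assms(1)[unfolded balanced_def, rule_format, of u]
      by (auto simp: T out_degree_def in_degree_def split: if_splits)
  qed
qed

definition trails_with :: "('a \<times> 'a) multiset \<Rightarrow> 'a \<Rightarrow> 'a \<Rightarrow> ('a \<Rightarrow> 'a) \<Rightarrow> 'a list set" where
  "trails_with T s z l = {ys \<in> trails T s z. \<forall>u\<in>sources T - {z}. last_exit s ys u = l u}"

lemma finite_trails_with: "finite (trails_with T s z l)"
  by (simp add: trails_with_def finite_trails)

text \<open>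
  Removing the first step leaves the last exits alone, unless this step was the only exit from \<open>s\<close>;
  then it is itself the last exit and must be the prescribed one. The end point \<open>z\<close> carries no
  prescription.
\<close>

lemma trails_with_Cons:
  assumes "(s, v) \<in># T"
  shows "{ys \<in> trails_with T s z l. ys \<noteq> [] \<and> hd ys = v} =
    (if s = z \<or> s \<in> sources (T - {#(s, v)#}) \<or> l s = v
     then Cons v ` trails_with (T - {#(s, v)#}) v z l else {})"
proof -
  obtain T' where T: "T = add_mset (s, v) T'" using assms by (metis insert_DiffM)
  have src: "sources T = insert s (sources T')" by (auto simp: T sources_def)
  have *: "v # zs \<in> trails_with T s z l \<longleftrightarrow>
     (s = z \<or> s \<in> sources T' \<or> l s = v) \<and> zs \<in> trails_with T' v z l" for zs
    unfolding trails_with_def trails_def src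
    by (auto simp: T)
  have T': "T - {#(s, v)#} = T'" by (simp add: T)
  have "{ys \<in> trails_with T s z l. ys \<noteq> [] \<and> hd ys = v} = Cons v ` {zs. v # zs \<in> trails_with T s z l}"
    by (auto simp: neq_Nil_conv image_iff)
  then show ?thesis unfolding T' by (simp add: *)
qed

definition mult_fact :: "('a \<times> 'a) multiset \<Rightarrow> nat" where
  "mult_fact T = (\<Prod>e\<in>set_mset T. fact (count T e))"

lemma mult_fact_pos: "mult_fact T > 0"
  by (simp add: mult_fact_def prod_pos)

text \<open>
  The number of orderings of the exits from \<open>u\<close>, as labelled edges, that end with a prescribed last
  exit. The root \<open>z\<close> of the tree may order its exits freely.
\<close>

definition trail_weight :: "('a \<times> 'a) multiset \<Rightarrow> 'a \<Rightarrow> ('a \<Rightarrow> 'a) \<Rightarrow> 'a \<Rightarrow> nat" where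
  "trail_weight T z l u =
    (if u = z then fact (out_degree T u) else fact (out_degree T u - 1) * count T (u, l u))"

lemma mult_fact_step:
  assumes "e \<in># T"
  shows "mult_fact T = count T e * mult_fact (T - {#e#})"
proof -
  define T' where "T' = T - {#e#}"
  have T: "T = add_mset e T'" using assms by (simp add: T'_def)
  have "(\<Prod>x\<in>set_mset T. fact (count T x) :: nat) =
     fact (count T e) * (\<Prod>x\<in>set_mset T - {e}. fact (count T x))"
    using assms by (subst prod.remove[of _ e]) auto
  also have "(\<Prod>x\<in>set_mset T - {e}. fact (count T x) :: nat) =
      (\<Prod>x\<in>set_mset T - {e}. fact (count T' x))"
    by (rule prod.cong) (auto simp: T)
  also have "fact (count T e) = count T e * (fact (count T' e) :: nat)"
    by (simp add: T)
  also have "count T e * fact (count T' e) * (\<Prod>x\<in>set_mset T - {e}. fact (count T' x)) =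
      count T e * (\<Prod>x\<in>set_mset T. fact (count T' x))"
    using assms by (subst prod.remove[of "set_mset T" e]) auto
  also have "(\<Prod>x\<in>set_mset T. fact (count T' x)) = (\<Prod>x\<in>set_mset T'. fact (count T' x) :: nat)"
    by (rule prod.mono_neutral_right) (auto simp: T not_in_iff)
  finally show ?thesis unfolding mult_fact_def T'_def[symmetric] .
qed

text \<open>
  The induction step of the BEST theorem, kept separate because it also yields the law of the first
  step: removing the edge from \<open>s\<close> to \<open>v\<close> changes only the factor of \<open>s\<close> in the product.
\<close>

lemma card_trails_with_first_step:
  fixes T :: "('a \<times> 'a) multiset"
  assumes T: "(s, v) \<in># T"
    and IH: "card (trails_with (T - {#(s, v)#}) v z l) *
        mult_fact (T - {#(s, v)#}) =
        (\<Prod>u\<in>sources (T - {#(s, v)#}). trail_weight (T - {#(s, v)#}) z l u)"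
  shows "card {ys \<in> trails_with T s z l. ys \<noteq> [] \<and> hd ys = v} * mult_fact T =
      (\<Prod>u\<in>sources T - {s}. trail_weight T z l u) * count T (s, v) *
      (if s = z then fact (out_degree T s - 1)
       else if out_degree T s = 1 then (if l s = v then 1 else 0)
       else fact (out_degree T s - 2) * (count T (s, l s) - (if l s = v then 1 else 0)))"
proof -
  define T' where "T' = T - {#(s, v)#}"
  have TT: "T = add_mset (s, v) T'" using T by (simp add: T'_def)
  define ok where "ok \<longleftrightarrow> s = z \<or> s \<in> sources T' \<or> l s = v"
  have "card {ys \<in> trails_with T s z l. ys \<noteq> [] \<and> hd ys = v} =
      (if ok then card (trails_with T' v z l) else 0)"
    unfolding trails_with_Cons[OF T] ok_def T'_def by (auto simp: card_image)
  then have 1: "card {ys \<in> trails_with T s z l. ys \<noteq> [] \<and> hd ys = v} * mult_fact T =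
     (if ok then count T (s, v) * (\<Prod>u\<in>sources T'. trail_weight T' z l u) else 0)"
    using IH mult_fact_step[OF T] unfolding T'_def by (simp add: mult_ac)
  have od: "out_degree T s = Suc (out_degree T' s)" by (simp add: TT out_degree_def)
  have src: "s \<in> sources T' \<longleftrightarrow> out_degree T' s > 0" by (simp add: out_degree_pos)
  have rest: "(\<Prod>u\<in>sources T' - {s}. trail_weight T' z l u) = (\<Prod>u\<in>sources T - {s}. trail_weight T z l u)"
    by (rule prod.cong) (auto simp: TT sources_def trail_weight_def out_degree_def)
  have prod: "(\<Prod>u\<in>sources T'. trail_weight T' z l u) =
     (if s \<in> sources T' then trail_weight T' z l s else 1) * (\<Prod>u\<in>sources T - {s}. trail_weight T z l u)"
    using rest prod.remove[of "sources T'" s "trail_weight T' z l"] by auto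
  have cnt: "count T (s, l s) - (if l s = v then 1 else 0) = count T' (s, l s)"
    by (simp add: TT)
  have od': "out_degree T s - 1 = out_degree T' s" "out_degree T s - 2 = out_degree T' s - 1"
    "out_degree T s = 1 \<longleftrightarrow> out_degree T' s = 0"
    by (simp_all add: od)
  show ?thesis unfolding 1 prod cnt od' using src
    by (auto simp: ok_def trail_weight_def)
qed

lemma trails_eq_UN:
  assumes "T \<noteq> {#}"
  shows "trails_with T s z l =
    (\<Union>v\<in>{v. (s, v) \<in># T}. {ys \<in> trails_with T s z l. ys \<noteq> [] \<and> hd ys = v})"
proof -
  have "ys \<noteq> [] \<and> (s, hd ys) \<in># T" if "ys \<in> trails_with T s z l" for ys
    using that assms by (cases ys) (auto simp: trails_with_def trails_def)
  then show ?thesis by blast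
qed

lemma card_trails_with_eq_sum:
  assumes "T \<noteq> {#}"
  shows "card (trails_with T s z l) =
    (\<Sum>v\<in>{v. (s, v) \<in># T}. card {ys \<in> trails_with T s z l. ys \<noteq> [] \<and> hd ys = v})"
proof -
  have fin: "finite {v. (s, v) \<in># T}"
    by (rule finite_subset[of _ "snd ` set_mset T"]) force+
  show ?thesis
    by (subst trails_eq_UN[OF assms], subst card_UN_disjoint)
       (auto simp: fin finite_trails_with)
qed

text \<open>
  The BEST theorem for trails with a prescribed tree of last exits. Counting by the first step, the
  factor of the start \<open>s\<close> satisfies the required recursion because the counts of the edges leaving
  \<open>s\<close> sum to its out-degree. That \<open>l\<close> has no cycles enters at the end only: if the walk is stuck at
  \<open>z\<close> with edges left over, some edge of \<open>l\<close> has to be missing from them.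
\<close>

theorem card_trails_with:
  assumes "balanced T s z"
    and "\<And>u. leads l (sources T - {z}) (- (sources T - {z})) u"
  shows "card (trails_with T s z l) * mult_fact T =
         (\<Prod>u\<in>sources T. trail_weight T z l u)"
  using assms
proof (induction "size T" arbitrary: T s)
  case 0
  then have [simp]: "T = {#}" by simp
  have "s = z"
    using 0(2)[unfolded balanced_def, rule_format, of s]
    by (auto simp: out_degree_def in_degree_def split: if_splits)
  moreover have "trails_with T s z l = (if s = z then {[]} else {})"
  proof -
    have "trans_mset s ys = {#} \<longleftrightarrow> ys = []" for ys by (cases ys) auto
    then show ?thesis by (auto simp: trails_with_def trails_def sources_def)
  qed
  ultimately show ?case by (simp add: sources_def mult_fact_def)
next
  case (Suc n T s)
  have T0: "T \<noteq> {#}" using Suc.hyps(2) by auto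
  define V where "V = {v. (s, v) \<in># T}"
  have finV: "finite V" unfolding V_def
    by (rule finite_subset[of _ "snd ` set_mset T"]) force+
  have IH: "card (trails_with (T - {#(s, v)#}) v z l) *
        mult_fact (T - {#(s, v)#}) =
        (\<Prod>u\<in>sources (T - {#(s, v)#}). trail_weight (T - {#(s, v)#}) z l u)" if "v \<in> V" for v
  proof (rule Suc.hyps(1))
    show "n = size (T - {#(s, v)#})" using Suc.hyps(2) that by (simp add: V_def size_Diff_singleton)
    show "balanced (T - {#(s, v)#}) v z" using Suc.prems(1) that by (simp add: V_def balanced_step)
    show "leads l (sources (T - {#(s, v)#}) - {z}) (- (sources (T - {#(s, v)#}) - {z})) u" for u
      by (rule leads_exit_mono[OF Suc.prems(2)]) (auto simp: sources_def dest: in_diffD)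
  qed
  define d where "d = out_degree T s"
  define k where "k = count T (s, l s)"
  define c where "c = (\<Prod>u\<in>sources T - {s}. trail_weight T z l u)"
  have sumV: "(\<Sum>v\<in>V. count T (s, v)) = d"
  proof -
    have "d = (\<Sum>v\<in>snd ` set_mset T. count T (s, v))"
      unfolding d_def by (rule out_degree_eq_sum) auto
    also have "\<dots> = (\<Sum>v\<in>V. count T (s, v))"
      by (rule sum.mono_neutral_right) (force simp: V_def count_eq_zero_iff)+
    finally show ?thesis by simp
  qed
  have first: "card (trails_with T s z l) * mult_fact T =
    (\<Sum>v\<in>V. c * count T (s, v) *
      (if s = z then fact (d - 1)
       else if d = 1 then (if l s = v then 1 else 0)
       else fact (d - 2) * (k - (if l s = v then 1 else 0))))"
    unfolding card_trails_with_eq_sum[OF T0] sum_distrib_right V_def[symmetric]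
  proof (rule sum.cong[OF refl])
    fix v assume v: "v \<in> V"
    then have "(s, v) \<in># T" by (simp add: V_def)
    from card_trails_with_first_step[OF this IH[OF v]]
    show "card {ys \<in> trails_with T s z l. ys \<noteq> [] \<and> hd ys = v} * mult_fact T =
      c * count T (s, v) * (if s = z then fact (d - 1)
       else if d = 1 then (if l s = v then 1 else 0)
       else fact (d - 2) * (k - (if l s = v then 1 else 0)))"
      by (simp only: c_def d_def k_def)
  qed
  show ?case
  proof (cases "s \<in> sources T")
    case True
    then have d: "d > 0" by (simp add: d_def out_degree_pos)
    have R: "(\<Prod>u\<in>sources T. trail_weight T z l u) = trail_weight T z l s * c"
      using prod.remove[of "sources T" s "trail_weight T z l"] True by (simp add: c_def)
    have kV: "k = (if l s \<in> V then count T (s, l s) else 0)"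
      by (auto simp: k_def V_def not_in_iff)
    consider "s = z" | "s \<noteq> z" "d = 1" | "s \<noteq> z" "d \<ge> 2" using d by linarith
    then show ?thesis
    proof cases
      case 1
      have "(\<Sum>v\<in>V. c * count T (s, v) * fact (d - 1)) = c * (\<Sum>v\<in>V. count T (s, v)) * fact (d - 1)"
        by (simp add: sum_distrib_left sum_distrib_right)
      also have "\<dots> = c * fact d" using d unfolding sumV by (cases d) (auto simp: algebra_simps)
      finally show ?thesis unfolding first R using 1 by (simp add: trail_weight_def d_def)
    next
      case 2
      have "(\<Sum>v\<in>V. c * count T (s, v) * (if l s = v then 1 else 0)) = c * k"
        using finV by (auto simp: kV sum.delta if_distrib cong: if_cong)
      then show ?thesis unfolding first R using 2 by (simp add: trail_weight_def d_def k_def)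
    next
      case 3
      have "(\<Sum>v\<in>V. count T (s, v) * (k - (if l s = v then 1 else 0))) = (d - 1) * k"
      proof (cases "k = 0")
        case False
        then have lV: "l s \<in> V" by (auto simp: kV split: if_splits)
        have "(\<Sum>v\<in>V. count T (s, v) * (k - (if l s = v then 1 else 0))) + k =
              (\<Sum>v\<in>V. count T (s, v) * (k - (if l s = v then 1 else 0)) + (if l s = v then count T (s, v) else 0))"
          using lV finV by (simp add: sum.distrib k_def)
        also have "\<dots> = (\<Sum>v\<in>V. count T (s, v) * k)"
          using False by (intro sum.cong) (auto simp: algebra_simps diff_mult_distrib2 k_def)
        also have "\<dots> = d * k" using sumV by (simp flip: sum_distrib_right)
        finally show ?thesis by (simp add: diff_mult_distrib)
      qed simp
      moreover have "(\<Sum>v\<in>V. c * count T (s, v) * (fact (d - 2) * (k - (if l s = v then 1 else 0)))) =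
         c * fact (d - 2) * (\<Sum>v\<in>V. count T (s, v) * (k - (if l s = v then 1 else 0)))"
        by (simp add: sum_distrib_left mult_ac)
      moreover have "fact (d - 1) = (d - 1) * (fact (d - 2) :: nat)"
        using 3 fact_reduce[of "d - 1", where 'a = nat] by (simp add: numeral_2_eq_2)
      ultimately show ?thesis unfolding first R using 3
        by (simp add: trail_weight_def d_def k_def)
    qed
  next
    case False
    then have d0: "out_degree T s = 0" using out_degree_pos[of T s] by simp
    have V0: "V = {}" using False by (force simp: V_def sources_def)
    have sz: "s = z"
      using Suc.prems(1)[unfolded balanced_def, rule_format, of s] d0 by (auto split: if_splits)
    have inz: "in_degree T z = 0"
      using Suc.prems(1)[unfolded balanced_def, rule_format, of z] d0 sz by (auto split: if_splits)
    \<comment> \<open>The walk is stuck at z although edges remain. If they contained all edges of l, following l would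
       never leave the remaining sources: it could only leave them through z, which has no edge into it.\<close>
    have "\<exists>u\<in>sources T - {z}. count T (u, l u) = 0"
    proof (rule ccontr)
      assume "\<not> ?thesis"
      then have pos: "count T (u, l u) > 0" if "u \<in> sources T - {z}" for u using that by auto
      have step: "l u \<in> sources T - {z}" if "u \<in> sources T - {z}" for u
      proof -
        have "(u, l u) \<in># T" using pos[OF that] by simp
        then have i: "in_degree T (l u) > 0" by (force simp: in_degree_pos)
        then have "l u \<noteq> z" using inz by auto
        moreover have "out_degree T (l u) > 0"
          using Suc.prems(1)[unfolded balanced_def, rule_format, of "l u"] i \<open>l u \<noteq> z\<close> by auto
        ultimately show ?thesis by (simp add: out_degree_pos)
      qed
      have "u \<notin> sources T - {z}" if "leads l (sources T - {z}) (- (sources T - {z})) u" for u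
        using that by induction (use step in auto)
      then have "sources T - {z} = {}" using Suc.prems(2) by blast
      moreover have "sources T \<noteq> {}" using T0 by (auto simp: sources_def)
      ultimately show False using False sz by auto
    qed
    then obtain u where "u \<in> sources T - {z}" "count T (u, l u) = 0" by blast
    then have "u \<in> sources T" "trail_weight T z l u = 0" by (auto simp: trail_weight_def)
    then have "(\<Prod>u\<in>sources T. trail_weight T z l u) = 0" by (auto intro!: prod_zero)
    then show ?thesis unfolding first V0 by simp
  qed
qed

text \<open>
  Apart from the last one, the exits from \<open>s\<close> are in uniform order. So given the last exits, the
  first step is uniform on the exits from \<open>s\<close> minus the last.
\<close>

corollary card_trails_with_first_step_ratio:
  assumes "balanced T s z" "s \<noteq> z"
    and "\<And>u. leads l (sources T - {z}) (- (sources T - {z})) u"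
  shows "(real (out_degree T s) - 1) * real (card {ys \<in> trails_with T s z l. ys \<noteq> [] \<and> hd ys = v}) =
     real (card (trails_with T s z l)) * (real (count T (s, v)) - (if l s = v then 1 else 0))"
    (is "?A = ?B")
proof -
  let ?F = "mult_fact T"
  have F0: "?F > 0" by (rule mult_fact_pos)
  define d where "d = out_degree T s"
  define k where "k = count T (s, l s)"
  define c where "c = (\<Prod>u\<in>sources T - {s}. trail_weight T z l u)"
  have d0: "d > 0"
    using assms(1)[unfolded balanced_def, rule_format, of s] assms(2) by (auto simp: d_def)
  then have s: "s \<in> sources T" by (simp add: d_def out_degree_pos)
  have tot: "card (trails_with T s z l) * ?F = fact (d - 1) * k * c"
    using card_trails_with[OF assms(1,3)] prod.remove[of "sources T" s "trail_weight T z l"] s assms(2)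
    by (simp add: c_def trail_weight_def d_def k_def)
  show ?thesis
  proof (cases "(s, v) \<in># T")
    case False
    have "\<not> (ys \<in> trails_with T s z l \<and> ys \<noteq> [] \<and> hd ys = v)" for ys
      using False by (cases ys) (auto simp: trails_with_def trails_def)
    then have 1: "{ys \<in> trails_with T s z l. ys \<noteq> [] \<and> hd ys = v} = {}" by blast
    have "?B = 0"
    proof (cases "l s = v")
      case True
      then have "k = 0" using False by (simp add: k_def not_in_iff)
      then show ?thesis using tot F0 by auto
    qed (use False in \<open>simp add: not_in_iff\<close>)
    then show ?thesis by (simp only: 1) simp
  next
    case True
    have IH: "card (trails_with (T - {#(s, v)#}) v z l) *
        mult_fact (T - {#(s, v)#}) =
        (\<Prod>u\<in>sources (T - {#(s, v)#}). trail_weight (T - {#(s, v)#}) z l u)"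
    proof (rule card_trails_with)
      show "balanced (T - {#(s, v)#}) v z" using assms(1) True by (rule balanced_step)
      show "leads l (sources (T - {#(s, v)#}) - {z}) (- (sources (T - {#(s, v)#}) - {z})) u" for u
        by (rule leads_exit_mono[OF assms(3)]) (auto simp: sources_def dest: in_diffD)
    qed
    note fs = card_trails_with_first_step[OF True IH, folded d_def k_def c_def]
    let ?n = "card {ys \<in> trails_with T s z l. ys \<noteq> [] \<and> hd ys = v}"
    have "?A * real ?F = ?B * real ?F"
    proof (cases "d = 1")
      case d1: True
      have cnt: "count T (s, v) = 1"
      proof -
        have "d = (\<Sum>w\<in>snd ` set_mset T. count T (s, w))"
          unfolding d_def by (rule out_degree_eq_sum) auto
        also have "\<dots> \<ge> count T (s, v)"
          using True by (intro member_le_sum) force+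
        finally have "count T (s, v) \<le> d" .
        moreover have "count T (s, v) > 0" using True by simp
        ultimately show ?thesis using d1 by linarith
      qed
      have "k = 0" if "l s \<noteq> v"
      proof (rule ccontr)
        assume "k \<noteq> 0"
        then have "(s, l s) \<in># T" by (simp add: k_def count_greater_zero_iff[symmetric] del: count_greater_zero_iff)
        then have "(\<Sum>w\<in>{v, l s}. count T (s, w)) \<ge> 2" using that True
          by (simp add: Suc_leI numeral_2_eq_2 count_greater_zero_iff[symmetric] del: count_greater_zero_iff)
        moreover have "(\<Sum>w\<in>{v, l s}. count T (s, w)) \<le> (\<Sum>w\<in>snd ` set_mset T. count T (s, w))"
          using True \<open>(s, l s) \<in># T\<close> by (intro sum_mono2) force+
        moreover have "\<dots> = d" unfolding d_def by (rule out_degree_eq_sum[symmetric]) auto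
        ultimately show False using d1 by simp
      qed
      then have "l s \<noteq> v \<Longrightarrow> card (trails_with T s z l) = 0" using tot F0 by auto
      then show ?thesis using d1 cnt by (auto simp: d_def)
    next
      case False
      have "real ?n * real ?F = real (?n * ?F)" by simp
      also have "\<dots> = real c * count T (s, v) * fact (d - 2) * real (k - (if l s = v then 1 else 0))"
        unfolding fs using assms(2) False by simp
      finally have n: "real ?n * real ?F = real c * count T (s, v) * fact (d - 2) * real (k - (if l s = v then 1 else 0))" .
      have t: "real (card (trails_with T s z l)) * real ?F = fact (d - 1) * real k * real c"
        using arg_cong[OF tot, of real] by (simp only: of_nat_mult of_nat_fact)
      have f: "fact (d - 1) = (real d - 1) * (fact (d - 2) :: real)"
        using False d0 fact_reduce[of "d - 1", where 'a = real] by (simp add: numeral_2_eq_2 of_nat_diff eval_nat_numeral)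
      have k: "real (count T (s, v)) * real (k - (if l s = v then 1 else 0)) =
        real k * (real (count T (s, v)) - (if l s = v then 1 else 0))"
        using True by (auto simp: k_def of_nat_diff Suc_leI count_greater_zero_iff[symmetric] algebra_simps simp del: count_greater_zero_iff)
      have "?A * real ?F = (real d - 1) * (real ?n * real ?F)" by (simp add: d_def)
      also have "\<dots> = (real d - 1) * fact (d - 2) * real c * (real (count T (s, v)) * real (k - (if l s = v then 1 else 0)))"
        unfolding n by simp
      also have "\<dots> = (fact (d - 1) * real k * real c) * (real (count T (s, v)) - (if l s = v then 1 else 0))"
        by (simp only: k f mult_ac)
      also have "\<dots> = ?B * real ?F" unfolding t[symmetric] by simp
      finally show ?thesis .
    qed
    then show ?thesis using F0 by simp
  qed
qed

section \<open>Weighted forests on a finite set\<close>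

text \<open>
  Every vertex of \<open>D\<close> chooses a successor in \<open>V\<close> such that all orbits leave \<open>D\<close>: these are the
  spanning forests of \<open>D\<close> directed to the vertices outside \<open>D\<close>.
\<close>

definition forests :: "'a set \<Rightarrow> 'a set \<Rightarrow> ('a \<Rightarrow> 'a) set" where
  "forests D V = {l \<in> D \<rightarrow>\<^sub>E V. \<forall>u. leads l D (- D) u}"

definition forest_weight :: "('a \<Rightarrow> 'a \<Rightarrow> real) \<Rightarrow> 'a set \<Rightarrow> ('a \<Rightarrow> 'a) \<Rightarrow> real" where
  "forest_weight m D l = (\<Prod>u\<in>D. m u (l u))"

lemma finite_forests: "finite D \<Longrightarrow> finite V \<Longrightarrow> finite (forests D V)"
  by (rule finite_subset[OF _ finite_PiE[of D "\<lambda>_. V"]]) (auto simp: forests_def)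

text \<open>
  A forest on \<open>insert u E\<close> is a forest on \<open>E\<close>, in which \<open>u\<close> is a root, together with a successor
  of \<open>u\<close> that does not lead back to \<open>u\<close>.
\<close>

lemma forests_insert:
  assumes u: "u \<notin> E" and l: "l \<in> E \<rightarrow>\<^sub>E V"
  shows "l(u := a) \<in> forests (insert u E) V \<longleftrightarrow>
     l \<in> forests E V \<and> a \<in> V \<and> leads l E (- insert u E) a"
proof
  assume L: "l(u := a) \<in> forests (insert u E) V"
  then have a: "a \<in> V" by (auto simp: forests_def PiE_def Pi_def)
  have ex: "leads (l(u := a)) (insert u E) (- insert u E) w" for w
    using L by (simp add: forests_def)
  have lE: "leads l E (- E) w" for w
    using leads_exit_mono[OF ex, of E w] u
    by (subst leads_cong[of E l "l(u := a)"]) auto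
  have "leads l E ({u} \<union> - insert u E) a"
    using lE[of a] by (rule leads_mono) auto
  moreover have False if au: "leads l E {u} a"
  proof -
    have "\<not> leads l E {u} w" if "leads (l(u := a)) (insert u E) (- insert u E) w" for w
      using that
    proof (induction rule: leads.induct)
      case (leads_here w)
      then show ?case by (auto simp: leads_out_iff)
    next
      case (leads_step w)
      then show ?case using au u by (cases "w = u") (auto simp: leads_step_iff)
    qed
    then show False using ex au by blast
  qed
  ultimately have "leads l E (- insert u E) a" unfolding leads_Un by auto
  then show "l \<in> forests E V \<and> a \<in> V \<and> leads l E (- insert u E) a"
    using a lE l by (auto simp: forests_def)
next
  assume R: "l \<in> forests E V \<and> a \<in> V \<and> leads l E (- insert u E) a"
  then have a: "leads l E (- insert u E) a" and lE: "\<And>w. leads l E (- E) w"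
    by (auto simp: forests_def)
  have "leads (l(u := a)) (insert u E) (- insert u E) w" for w
  proof -
    have "leads l E ({u} \<union> - insert u E) w"
      using lE[of w] by (rule leads_mono) auto
    then show ?thesis
      using a unfolding leads_Un by (subst leads_upd_iff[OF u _ a]) auto
  qed
  moreover have "l(u := a) \<in> insert u E \<rightarrow>\<^sub>E V"
    using l R by (auto simp: PiE_def Pi_def extensional_def)
  ultimately show "l(u := a) \<in> forests (insert u E) V" unfolding forests_def by blast
qed

lemma sum_forests_insert:
  fixes F :: "('a \<Rightarrow> 'a) \<Rightarrow> 'b::comm_monoid_add"
  assumes fin: "finite E" "finite V" and u: "u \<notin> E"
  shows "(\<Sum>l\<in>forests (insert u E) V. F l) =
    (\<Sum>l\<in>forests E V. \<Sum>a\<in>{a\<in>V. leads l E (- insert u E) a}. F (l(u := a)))"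
proof -
  have PE: "l \<in> E \<rightarrow>\<^sub>E V" if "l \<in> forests E V" for l using that by (simp add: forests_def)
  have ext: "(l(u := undefined))(u := l u) = l" for l :: "'a \<Rightarrow> 'a" by auto
  have PE': "l(u := undefined) \<in> E \<rightarrow>\<^sub>E V" if "l \<in> forests (insert u E) V" for l
    using that u by (auto simp: forests_def PiE_def Pi_def extensional_def)
  have und: "l u = undefined" if "l \<in> forests E V" for l
    using PE[OF that] u by (auto simp: PiE_def extensional_def)
  have "(\<Sum>l\<in>forests E V. \<Sum>a\<in>{a\<in>V. leads l E (- insert u E) a}. F (l(u := a))) =
     (\<Sum>(l, a)\<in>(SIGMA l:forests E V. {a\<in>V. leads l E (- insert u E) a}). F (l(u := a)))"
    using fin by (intro sum.Sigma) (auto simp: finite_forests)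
  also have "\<dots> = (\<Sum>l\<in>forests (insert u E) V. F l)"
  proof (rule sum.reindex_bij_witness[where i = "\<lambda>l. (l(u := undefined), l u)" and j = "\<lambda>(l, a). l(u := a)"])
    show "(case x of (l, a) \<Rightarrow> l(u := a)) \<in> forests (insert u E) V"
      if "x \<in> (SIGMA l:forests E V. {a\<in>V. leads l E (- insert u E) a})" for x
      using that by (auto simp: forests_insert[OF u PE])
    show "(l(u := undefined), l u) \<in> (SIGMA l:forests E V. {a\<in>V. leads l E (- insert u E) a})"
      if "l \<in> forests (insert u E) V" for l
      using that forests_insert[OF u PE'[OF that], of "l u"] unfolding ext by auto
  qed (auto simp: und fun_upd_idem)
  finally show ?thesis ..
qed

definition lead_sum :: "('a \<Rightarrow> 'a \<Rightarrow> real) \<Rightarrow> 'a set \<Rightarrow> 'a set \<Rightarrow> 'a set \<Rightarrow> 'a \<Rightarrow> real" where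
  "lead_sum m D V Z v = (\<Sum>l\<in>forests D V. of_bool (leads l D Z v) * forest_weight m D l)"

lemma forest_weight_upd:
  assumes "finite E" "u \<notin> E"
  shows "forest_weight m (insert u E) (l(u := a)) = m u a * forest_weight m E l"
proof -
  have "(\<Prod>w\<in>E. m w ((l(u := a)) w)) = (\<Prod>w\<in>E. m w (l w))"
    using assms by (intro prod.cong) auto
  then show ?thesis using assms by (simp add: forest_weight_def)
qed

text \<open>
  Part of the Markov chain tree theorem: the total weight of the forests that lead \<open>v\<close> to \<open>Z\<close> is a
  harmonic function of \<open>v\<close>. Delete the edge at \<open>u\<close>. In the remaining forest every vertex leads
  either to \<open>u\<close> or out of \<open>D\<close>, and with \<open>a\<close> the new successor of \<open>u\<close> the identity is, for each such
  forest, an exchange of the names \<open>a\<close> and \<open>v\<close> in a double sum.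
\<close>

lemma lead_sum_harmonic:
  assumes fin: "finite D" "finite V" and u: "u \<in> D" and Z: "Z \<inter> D = {}"
  shows "(\<Sum>v\<in>V. m u v * lead_sum m D V Z v) = (\<Sum>v\<in>V. m u v) * lead_sum m D V Z u"
proof -
  define E where "E = D - {u}"
  have D: "D = insert u E" and uE: "u \<notin> E" and finE: "finite E" using u fin by (auto simp: E_def)
  \<comment> \<open>A: the vertex leads out of D; Q: it leads to Z; U: it leads to u.\<close>
  define A where "A l a \<longleftrightarrow> leads l E (- insert u E) a" for l a
  define Q where "Q l a \<longleftrightarrow> leads l E Z a" for l a
  define U where "U l a \<longleftrightarrow> leads l E {u} a" for l a
  define w where "w = forest_weight m E"
  have expand: "lead_sum m D V Z v = (\<Sum>l\<in>forests E V. \<Sum>a\<in>V.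
      of_bool (A l a) * of_bool (Q l v \<or> (U l v \<and> Q l a)) * m u a * w l)" for v
  proof -
    have "lead_sum m D V Z v = (\<Sum>l\<in>forests E V. \<Sum>a\<in>{a\<in>V. A l a}.
       of_bool (leads (l(u := a)) D Z v) * forest_weight m D (l(u := a)))"
      unfolding lead_sum_def D A_def by (rule sum_forests_insert[OF finE fin(2) uE])
    also have "\<dots> = (\<Sum>l\<in>forests E V. \<Sum>a\<in>{a\<in>V. A l a}.
       of_bool (Q l v \<or> (U l v \<and> Q l a)) * m u a * w l)"
    proof (intro sum.cong refl)
      fix l a assume "a \<in> {a\<in>V. A l a}"
      then have a: "leads l E (- insert u E) a" by (simp add: A_def)
      have Z': "Z \<inter> insert u E = {}" using Z D by simp
      show "of_bool (leads (l(u := a)) D Z v) * forest_weight m D (l(u := a)) =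
          of_bool (Q l v \<or> (U l v \<and> Q l a)) * m u a * w l"
        unfolding D forest_weight_upd[OF finE uE] leads_upd_iff[OF uE Z' a] Q_def U_def w_def by simp
    qed
    also have "\<dots> = (\<Sum>l\<in>forests E V. \<Sum>a\<in>V.
      of_bool (A l a) * of_bool (Q l v \<or> (U l v \<and> Q l a)) * m u a * w l)"
      by (intro sum.cong refl sum.mono_neutral_cong_left) (auto simp: fin)
    finally show ?thesis .
  qed
  have OA: "A l a" if "Q l a" for l a
    using that unfolding Q_def A_def by (rule leads_mono) (use Z D in auto)
  have Ou: "\<not> Q l u" "U l u" for l
    using Z D uE by (auto simp: Q_def U_def leads_out_iff)
  have UO: "\<not> (U l v \<and> A l v)" for l v
    using leads_disjoint[of l E "{u}" v "- insert u E"] uE by (auto simp: U_def A_def)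
  have UA: "U l v \<or> A l v" if "l \<in> forests E V" for l v
  proof -
    have "leads l E (- E) v" using that by (simp add: forests_def)
    then have "leads l E ({u} \<union> - insert u E) v" by (rule leads_mono) auto
    then show ?thesis unfolding leads_Un U_def A_def .
  qed
  have "(\<Sum>v\<in>V. m u v * lead_sum m D V Z v) = (\<Sum>l\<in>forests E V. w l *
      (\<Sum>v\<in>V. \<Sum>a\<in>V. of_bool (A l a) * of_bool (Q l v \<or> (U l v \<and> Q l a)) * m u a * m u v))"
    unfolding expand sum_distrib_left by (subst sum.swap) (simp add: mult_ac)
  also have "\<dots> = (\<Sum>l\<in>forests E V. w l * ((\<Sum>v\<in>V. m u v) * (\<Sum>a\<in>V. of_bool (Q l a) * m u a)))"
  proof (intro sum.cong refl arg_cong2[where f = "(*)"])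
    fix l assume l: "l \<in> forests E V"
    have "(\<Sum>v\<in>V. \<Sum>a\<in>V. of_bool (A l a) * of_bool (Q l v \<or> (U l v \<and> Q l a)) * m u a * m u v) =
      (\<Sum>v\<in>V. \<Sum>a\<in>V. of_bool (A l a) * of_bool (Q l v) * m u a * m u v) +
      (\<Sum>v\<in>V. \<Sum>a\<in>V. of_bool (U l v) * of_bool (Q l a) * m u a * m u v)"
      unfolding sum.distrib[symmetric] using OA UO by (intro sum.cong refl) (auto simp: of_bool_def)
    \<comment> \<open>The exchange of a and v.\<close>
    also have "(\<Sum>v\<in>V. \<Sum>a\<in>V. of_bool (A l a) * of_bool (Q l v) * m u a * m u v) =
      (\<Sum>v\<in>V. \<Sum>a\<in>V. of_bool (A l v) * of_bool (Q l a) * m u a * m u v)"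
      by (subst sum.swap) (simp add: mult_ac)
    also have "\<dots> + (\<Sum>v\<in>V. \<Sum>a\<in>V. of_bool (U l v) * of_bool (Q l a) * m u a * m u v) =
      (\<Sum>v\<in>V. \<Sum>a\<in>V. m u v * (of_bool (Q l a) * m u a))"
      unfolding sum.distrib[symmetric] using UA[OF l] UO by (intro sum.cong refl) (auto simp: of_bool_def)
    also have "\<dots> = (\<Sum>v\<in>V. m u v) * (\<Sum>a\<in>V. of_bool (Q l a) * m u a)"
      by (simp add: sum_product)
    finally show "(\<Sum>v\<in>V. \<Sum>a\<in>V. of_bool (A l a) * of_bool (Q l v \<or> (U l v \<and> Q l a)) * m u a * m u v) =
       (\<Sum>v\<in>V. m u v) * (\<Sum>a\<in>V. of_bool (Q l a) * m u a)" .
  qed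
  also have "\<dots> = (\<Sum>v\<in>V. m u v) * lead_sum m D V Z u"
    unfolding expand sum_distrib_left using OA Ou
    by (intro sum.cong refl) (auto simp: of_bool_def)
  finally show ?thesis .
qed

definition forest_total :: "('a \<Rightarrow> 'a \<Rightarrow> real) \<Rightarrow> 'a set \<Rightarrow> 'a set \<Rightarrow> real" where
  "forest_total m D V = (\<Sum>l\<in>forests D V. forest_weight m D l)"

text \<open>
  This is the probability that the Markov chain with weights \<open>m\<close>, started at \<open>u\<close>, hits \<open>s\<close> before it
  leaves \<open>D\<close>. If some forest has positive weight, the lemmas below give the boundary values and the
  harmonicity that characterise this probability.
\<close>

definition hit_prob :: "('a \<Rightarrow> 'a \<Rightarrow> real) \<Rightarrow> 'a set \<Rightarrow> 'a set \<Rightarrow> 'a \<Rightarrow> 'a \<Rightarrow> real" where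
  "hit_prob m D V s u = lead_sum m (D - {s}) V {s} u / forest_total m (D - {s}) V"

lemma forest_weight_nonneg: "(\<And>u v. 0 \<le> m u v) \<Longrightarrow> 0 \<le> forest_weight m D l"
  by (auto simp: forest_weight_def intro: prod_nonneg)

lemma sum_forests_step_eq:
  assumes fin: "finite D" "finite V" and s: "s \<in> D" and w: "w \<in> V"
  shows "(\<Sum>l\<in>forests D V. of_bool (l s = w) * forest_weight m D l) =
     m s w * (forest_total m (D - {s}) V - lead_sum m (D - {s}) V {s} w)"
proof -
  define E where "E = D - {s}"
  have D: "D = insert s E" and uE: "s \<notin> E" and finE: "finite E" using s fin by (auto simp: E_def)
  have "(\<Sum>l\<in>forests D V. of_bool (l s = w) * forest_weight m D l) =
     (\<Sum>l\<in>forests E V. \<Sum>a\<in>{a\<in>V. leads l E (- D) a}. of_bool (a = w) * (m s a * forest_weight m E l))"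
    unfolding D sum_forests_insert[OF finE fin(2) uE] forest_weight_upd[OF finE uE] by simp
  also have "\<dots> = (\<Sum>l\<in>forests E V. m s w * (forest_weight m E l - of_bool (leads l E {s} w) * forest_weight m E l))"
  proof (intro sum.cong refl)
    fix l assume l: "l \<in> forests E V"
    have "leads l E (- E) w" using l by (simp add: forests_def)
    then have "leads l E ({s} \<union> - D) w" by (rule leads_mono) (auto simp: D)
    moreover have "\<not> (leads l E {s} w \<and> leads l E (- D) w)"
      using leads_disjoint[of l E "{s}" w "- D"] uE by (auto simp: D)
    ultimately have *: "leads l E (- D) w \<longleftrightarrow> \<not> leads l E {s} w" unfolding leads_Un by auto
    have "(\<Sum>a\<in>{a\<in>V. leads l E (- D) a}. of_bool (a = w) * (m s a * forest_weight m E l)) =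
       (\<Sum>a\<in>V. if a = w then of_bool (leads l E (- D) w) * (m s w * forest_weight m E l) else 0)"
      by (intro sum.mono_neutral_cong_left) (auto simp: fin)
    also have "\<dots> = m s w * (forest_weight m E l - of_bool (leads l E {s} w) * forest_weight m E l)"
      using w fin by (simp add: *)
    finally show "(\<Sum>a\<in>{a\<in>V. leads l E (- D) a}. of_bool (a = w) * (m s a * forest_weight m E l)) =
       m s w * (forest_weight m E l - of_bool (leads l E {s} w) * forest_weight m E l)" .
  qed
  finally show ?thesis
    by (simp add: E_def forest_total_def lead_sum_def sum_distrib_left sum_subtractf right_diff_distrib)
qed

context
  fixes m :: "'a \<Rightarrow> 'a \<Rightarrow> real" and D V :: "'a set" and s :: 'a
  assumes fin: "finite D" "finite V" and m_nonneg: "\<And>u v. 0 \<le> m u v"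
    and tot: "forest_total m (D - {s}) V \<noteq> 0"
begin

lemma forest_total_pos: "forest_total m (D - {s}) V > 0"
proof -
  have "forest_total m (D - {s}) V \<ge> 0" unfolding forest_total_def
    by (intro sum_nonneg forest_weight_nonneg m_nonneg)
  with tot show ?thesis by simp
qed

lemma hit_prob_range: "0 \<le> hit_prob m D V s u" "hit_prob m D V s u \<le> 1"
proof -
  have "0 \<le> lead_sum m (D - {s}) V {s} u"
    by (auto simp: lead_sum_def intro!: sum_nonneg forest_weight_nonneg m_nonneg)
  moreover have "lead_sum m (D - {s}) V {s} u \<le> forest_total m (D - {s}) V"
    unfolding lead_sum_def forest_total_def
    by (intro sum_mono) (auto simp: of_bool_def intro!: forest_weight_nonneg m_nonneg)
  ultimately show "0 \<le> hit_prob m D V s u" "hit_prob m D V s u \<le> 1"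
    using forest_total_pos by (auto simp: hit_prob_def)
qed

lemma hit_prob_self: "hit_prob m D V s s = 1"
  using tot by (simp add: hit_prob_def lead_sum_def forest_total_def leads_out_iff)

lemma hit_prob_outside: "u \<notin> D \<Longrightarrow> u \<noteq> s \<Longrightarrow> hit_prob m D V s u = 0"
  by (simp add: hit_prob_def lead_sum_def leads_out_iff)

lemma hit_prob_harmonic:
  "u \<in> D \<Longrightarrow> u \<noteq> s \<Longrightarrow> (\<Sum>v\<in>V. m u v * hit_prob m D V s v) = (\<Sum>v\<in>V. m u v) * hit_prob m D V s u"
  using lead_sum_harmonic[of "D - {s}" V u "{s}" m] fin
  by (simp add: hit_prob_def flip: sum_divide_distrib)

text \<open>
  In a forest on \<open>D\<close> the successor \<open>w\<close> of \<open>s\<close> must escape from \<open>D\<close> without returning to \<open>s\<close>. So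
  the successor of \<open>s\<close> is \<open>w\<close> with probability proportional to the weight of the edge times the
  escape probability of \<open>w\<close>.
\<close>

lemma forest_step_weight:
  assumes s: "s \<in> D" and w: "w \<in> V"
  shows "(\<Sum>l\<in>forests D V. of_bool (l s = w) * forest_weight m D l) =
     forest_total m (D - {s}) V * (m s w * (1 - hit_prob m D V s w))"
  unfolding sum_forests_step_eq[OF fin s w] using tot by (simp add: hit_prob_def field_simps)

lemma forest_total_eq:
  assumes s: "s \<in> D"
  shows "forest_total m D V =
     forest_total m (D - {s}) V * (\<Sum>w\<in>V. m s w * (1 - hit_prob m D V s w))"
proof -
  have "forest_total m D V = (\<Sum>l\<in>forests D V. \<Sum>w\<in>V. of_bool (l s = w) * forest_weight m D l)"
    unfolding forest_total_def
  proof (intro sum.cong refl)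
    fix l assume "l \<in> forests D V"
    then have "l s \<in> V" using s by (auto simp: forests_def)
    then show "forest_weight m D l = (\<Sum>w\<in>V. of_bool (l s = w) * forest_weight m D l)"
      using fin by (simp add: of_bool_def if_distrib[of "\<lambda>x. x * _"] cong: if_cong)
  qed
  also have "\<dots> = (\<Sum>w\<in>V. forest_total m (D - {s}) V * (m s w * (1 - hit_prob m D V s w)))"
    by (subst sum.swap) (simp add: forest_step_weight[OF s])
  finally show ?thesis by (simp add: sum_distrib_left)
qed

end

section \<open>The first step of a uniform trail\<close>

lemma last_exit_in_set: "u \<in> sources (trans_mset s ys) \<Longrightarrow> last_exit s ys u \<in> set ys"
  by (induction ys arbitrary: s) (auto simp: sources_def)

text \<open>
  The last exits of a trail have no cycle, as they lead to vertices with a later last occurrence. In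
  terms of the first step: if \<open>s\<close> is not left again, it does not occur in the rest of the trail,
  unless it is the end point, so no orbit can return to it.
\<close>

lemma last_exit_leads:
  fixes ys :: "'a list"
  defines "U \<equiv> \<lambda>s ys. sources (trans_mset s ys) - {last (s # ys)}"
  shows "leads (last_exit s ys) (U s ys) (- U s ys) u"
proof (induction ys arbitrary: s u)
  case Nil
  then show ?case by (auto simp: U_def sources_def intro: leads.leads_here)
next
  case (Cons v ys s u)
  define T' where "T' = trans_mset v ys"
  define l' where "l' = last_exit v ys"
  define z where "z = last (v # ys)"
  have src: "sources (trans_mset s (v # ys)) = insert s (sources T')"
    by (auto simp: T'_def sources_def)
  have z: "last (s # v # ys) = z" by (simp add: z_def)
  have U': "U v ys = sources T' - {z}" by (simp add: U_def T'_def z_def)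
  have IH: "leads l' (U v ys) (- U v ys) w" for w using Cons by (simp add: l'_def)
  consider "s \<in> sources T'" | "s \<notin> sources T'" "s = z" | "s \<notin> sources T'" "s \<noteq> z" by blast
  then show ?case
  proof cases
    case 1
    then have "U s (v # ys) = U v ys"
      unfolding U_def src z T'_def[symmetric] z_def[symmetric] by auto
    then show ?thesis using 1 IH by (simp add: T'_def l'_def)
  next
    case 2
    then have U: "U s (v # ys) = U v ys"
      unfolding U_def src z T'_def[symmetric] z_def[symmetric] by auto
    have "leads l' (U v ys) (- U v ys) u \<longleftrightarrow> leads (l'(s := v)) (U v ys) (- U v ys) u"
      using 2 by (intro leads_cong) (auto simp: U')
    moreover have "last_exit s (v # ys) = l'(s := v)" using 2 by (simp add: T'_def l'_def)
    ultimately show ?thesis unfolding U using IH[of u] by metis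
  next
    case 3
    have U: "U s (v # ys) = insert s (U v ys)"
      unfolding U_def src z T'_def[symmetric] z_def[symmetric] using 3 by auto
    have sU: "s \<notin> U v ys" using 3 by (simp add: U')
    have s: "s \<notin> set (v # ys)"
    proof -
      have "set (v # ys) = set (butlast (v # ys)) \<union> {z}"
        unfolding z_def by (metis Un_insert_right append_butlast_last_id list.set(2) list.simps(15) list.simps(3) set_append sup_bot_right list.set(1))
      then show ?thesis using 3 by (simp add: T'_def sources_trans_mset)
    qed
    have ex: "leads l' (U v ys) (- insert s (U v ys)) w"
      if "leads l' (U v ys) (- U v ys) w" "w \<in> set (v # ys)" for w
      using that
    proof (induction rule: leads.induct)
      case (leads_here w)
      then show ?case using s by (intro leads.leads_here) auto
    next
      case (leads_step w)
      have "l' w \<in> set (v # ys)"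
        using last_exit_in_set[of w v ys] leads_step by (auto simp: l'_def U' T'_def)
      then show ?case using leads_step by (intro leads.leads_step[of w]) auto
    qed
    have a: "leads l' (U v ys) (- insert s (U v ys)) v" by (rule ex[OF IH]) simp
    have "leads l' (U v ys) ({s} \<union> - insert s (U v ys)) u"
      using IH[of u] by (rule leads_mono) auto
    then have "leads (l'(s := v)) (insert s (U v ys)) (- insert s (U v ys)) u"
      using a unfolding leads_Un by (subst leads_upd_iff[OF sU _ a]) auto
    moreover have "last_exit s (v # ys) = l'(s := v)" using 3 by (simp add: T'_def l'_def)
    ultimately show ?thesis unfolding U by metis
  qed
qed

definition tree_vertices :: "('a \<times> 'a) multiset \<Rightarrow> 'a \<Rightarrow> 'a set" where
  "tree_vertices T z = sources T - {z}"

definition last_exit_tree :: "('a \<times> 'a) multiset \<Rightarrow> 'a \<Rightarrow> 'a \<Rightarrow> 'a list \<Rightarrow> 'a \<Rightarrow> 'a" where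
  "last_exit_tree T s z ys = restrict (last_exit s ys) (tree_vertices T z)"

lemma finite_tree_vertices [simp]: "finite (tree_vertices T z)"
  by (simp add: tree_vertices_def)

lemma last_exit_tree_in_forests:
  assumes "ys \<in> trails T s z"
  shows "last_exit_tree T s z ys \<in> forests (tree_vertices T z) (snd ` set_mset T)"
proof -
  have T: "T = trans_mset s ys" "z = last (s # ys)" using assms by (auto simp: trails_def)
  have "leads (last_exit_tree T s z ys) (tree_vertices T z) (- tree_vertices T z) u" for u
    using last_exit_leads[of s ys u]
    by (subst leads_cong[where l' = "last_exit s ys"]) (auto simp: last_exit_tree_def tree_vertices_def T)
  moreover have "last_exit_tree T s z ys \<in> tree_vertices T z \<rightarrow>\<^sub>E snd ` set_mset T"
    using last_exit_in_set[of _ s ys]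
    by (auto simp: last_exit_tree_def tree_vertices_def T snd_trans_mset)
  ultimately show ?thesis unfolding forests_def by blast
qed

lemma trails_with_eq:
  assumes "l \<in> forests (tree_vertices T z) V"
  shows "{ys \<in> trails T s z. last_exit_tree T s z ys = l} = trails_with T s z l"
proof -
  have "l \<in> extensional (tree_vertices T z)" using assms by (auto simp: forests_def PiE_def)
  then show ?thesis
    by (auto simp: trails_with_def last_exit_tree_def tree_vertices_def fun_eq_iff extensional_def)
qed

lemma sum_trails_by_tree:
  fixes F :: "('a \<Rightarrow> 'a) \<Rightarrow> real"
  shows "(\<Sum>ys\<in>{ys\<in>trails T s z. P ys}. F (last_exit_tree T s z ys)) =
    (\<Sum>l\<in>forests (tree_vertices T z) (snd ` set_mset T). real (card {ys \<in> trails_with T s z l. P ys}) * F l)"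
proof -
  let ?L = "forests (tree_vertices T z) (snd ` set_mset T)"
  have "(\<Sum>ys\<in>{ys\<in>trails T s z. P ys}. F (last_exit_tree T s z ys)) =
    (\<Sum>l\<in>?L. \<Sum>ys\<in>{ys\<in>{ys\<in>trails T s z. P ys}. last_exit_tree T s z ys = l}. F (last_exit_tree T s z ys))"
    by (rule sum.group[symmetric])
       (auto simp: finite_trails last_exit_tree_in_forests finite_forests)
  also have "\<dots> = (\<Sum>l\<in>?L. real (card {ys \<in> trails_with T s z l. P ys}) * F l)"
  proof (rule sum.cong[OF refl])
    fix l assume l: "l \<in> ?L"
    have "{ys\<in>{ys\<in>trails T s z. P ys}. last_exit_tree T s z ys = l} = {ys \<in> trails_with T s z l. P ys}"
      using trails_with_eq[OF l, of s] by blast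
    moreover have "(\<Sum>ys\<in>{ys\<in>{ys\<in>trails T s z. P ys}. last_exit_tree T s z ys = l}. F (last_exit_tree T s z ys)) =
       (\<Sum>ys\<in>{ys\<in>{ys\<in>trails T s z. P ys}. last_exit_tree T s z ys = l}. F l)"
      by (rule sum.cong) auto
    ultimately show "(\<Sum>ys\<in>{ys\<in>{ys\<in>trails T s z. P ys}. last_exit_tree T s z ys = l}. F (last_exit_tree T s z ys)) =
       real (card {ys \<in> trails_with T s z l. P ys}) * F l" by simp
  qed
  finally show ?thesis .
qed

text \<open>
  The greatest subset of \<open>B\<close> into which no vertex of \<open>U\<close> outside of it is mapped; a union of
  such subsets is again one of them. In a tree \<open>l\<close> it consists of the vertices of \<open>B\<close> all of whose
  descendants lie in \<open>B\<close>.
\<close>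

definition core :: "'a set \<Rightarrow> 'a set \<Rightarrow> ('a \<Rightarrow> 'a) \<Rightarrow> 'a set" where
  "core U B l = \<Union>{D. D \<subseteq> B \<and> (\<forall>v\<in>U - D. l v \<notin> D)}"

lemma core_subset: "core U B l \<subseteq> B"
  by (auto simp: core_def)

lemma core_closed: "v \<in> U \<Longrightarrow> v \<notin> core U B l \<Longrightarrow> l v \<notin> core U B l"
  by (auto simp: core_def)

lemma core_greatest: "D \<subseteq> B \<Longrightarrow> (\<And>v. v \<in> U \<Longrightarrow> v \<notin> D \<Longrightarrow> l v \<notin> D) \<Longrightarrow> D \<subseteq> core U B l"
  unfolding core_def by blast

text \<open>
  The core is determined by the map outside the core. This is what makes it possible to
  resample the tree inside the core without changing the core.
\<close>

lemma core_cong: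
  assumes "\<And>v. v \<in> U \<Longrightarrow> v \<notin> core U B l \<Longrightarrow> l' v = l v"
  shows "core U B l' = core U B l"
proof
  show 1: "core U B l \<subseteq> core U B l'"
  proof (rule core_greatest[OF core_subset])
    fix v assume "v \<in> U" "v \<notin> core U B l"
    then show "l' v \<notin> core U B l" using assms[of v] core_closed[of v U B l] by simp
  qed
  show "core U B l' \<subseteq> core U B l"
  proof (rule core_greatest[OF core_subset])
    fix v assume v: "v \<in> U" "v \<notin> core U B l'"
    then have "l' v = l v" using 1 assms[of v] by auto
    then show "l v \<notin> core U B l'" using v core_closed[of v U B l'] by simp
  qed
qed

text \<open>
  The law of the successor of \<open>s\<close> in a random forest on \<open>D\<close> with weights \<open>m\<close>.
\<close>

definition exit_law :: "('a \<Rightarrow> 'a \<Rightarrow> real) \<Rightarrow> 'a set \<Rightarrow> 'a set \<Rightarrow> 'a \<Rightarrow> 'a \<Rightarrow> real" where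
  "exit_law m D V s w =
     (\<Sum>l\<in>forests D V. of_bool (l s = w) * forest_weight m D l) / forest_total m D V"

lemma sum_exit_law:
  assumes "finite D" "finite V" "\<And>u v. 0 \<le> m u v"
  shows "(\<Sum>l\<in>forests D V. forest_weight m D l * (of_bool (l s = w) - exit_law m D V s w)) = 0"
proof (cases "forest_total m D V = 0")
  case True
  then have "\<forall>l\<in>forests D V. forest_weight m D l = 0"
    unfolding forest_total_def using assms
    by (subst (asm) sum_nonneg_eq_0_iff) (auto simp: finite_forests forest_weight_nonneg)
  then show ?thesis by simp
next
  case False
  have "(\<Sum>l\<in>forests D V. forest_weight m D l * (of_bool (l s = w) - exit_law m D V s w)) =
      (\<Sum>l\<in>forests D V. of_bool (l s = w) * forest_weight m D l) -
      forest_total m D V * exit_law m D V s w"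
    by (simp only: right_diff_distrib sum_subtractf forest_total_def sum_distrib_right mult.commute[of "of_bool _"])
  also have "\<dots> = 0" using False by (simp add: exit_law_def)
  finally show ?thesis .
qed

text \<open>
  Group the forests on \<open>U\<close> by their core \<open>D\<close> and their values outside \<open>D\<close>. A group is in
  bijection with the forests on \<open>D\<close>: orbits starting outside \<open>D\<close> never enter \<open>D\<close>, so pasting in any
  forest on \<open>D\<close> creates no cycle. Within a group the successor of \<open>s\<close> follows \<open>exit_law\<close>.
\<close>

lemma sum_forests_core:
  fixes m :: "'a \<Rightarrow> 'a \<Rightarrow> real"
  assumes fin: "finite U" "finite V" and B: "B \<subseteq> U" and m: "\<And>u v. 0 \<le> m u v"
  shows "(\<Sum>l\<in>forests U V. of_bool (s \<in> core U B l) * forest_weight m U l *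
     (of_bool (l s = w) - exit_law m (core U B l) V s w)) = 0"
proof -
  define key where "key l = (core U B l, restrict l (U - core U B l))" for l
  define F where "F l = of_bool (s \<in> core U B l) * forest_weight m U l *
     (of_bool (l s = w) - exit_law m (core U B l) V s w)" for l
  have zero: "(\<Sum>l\<in>{l\<in>forests U V. key l = key l0}. F l) = 0" if l0: "l0 \<in> forests U V" for l0
  proof -
    define D where "D = core U B l0"
    have DU: "D \<subseteq> U" using core_subset[of U B l0] B by (auto simp: D_def)
    have finD: "finite D" using DU fin finite_subset by blast
    define mrg where "mrg h = (\<lambda>u. if u \<in> D then h u else l0 u)" for h :: "'a \<Rightarrow> 'a"
    have l0PE: "l0 \<in> U \<rightarrow>\<^sub>E V" and l0L: "\<And>u. leads l0 U (- U) u" using l0 by (auto simp: forests_def)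
    have key_iff: "key l = key l0 \<longleftrightarrow> (\<forall>u\<in>U - D. l u = l0 u)" for l
    proof
      assume "key l = key l0"
      then have "restrict l (U - D) = restrict l0 (U - D)" by (auto simp: key_def D_def)
      then show "\<forall>u\<in>U - D. l u = l0 u" by (metis restrict_apply')
    next
      assume *: "\<forall>u\<in>U - D. l u = l0 u"
      then have "core U B l = core U B l0" by (intro core_cong) (auto simp: D_def)
      then show "key l = key l0" using * by (auto simp: key_def D_def restrict_def fun_eq_iff)
    qed
    have avoid: "leads l0 (U - D) (- U) u" if "leads l0 U (- U) u" "u \<notin> D" for u
      using that
    proof (induction rule: leads.induct)
      case (leads_here u)
      then show ?case by (auto intro: leads.leads_here)
    next
      case (leads_step u)
      then show ?case using core_closed[of u U B l0] leads.leads_step[of u "U - D" l0 "- U"]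
        by (auto simp: D_def)
    qed
    have mrg_leads: "leads (mrg h) U (- U) u" if h: "h \<in> forests D V" for h u
    proof -
      have out: "leads (mrg h) U (- U) w" if "w \<notin> D" for w
      proof -
        have "leads (mrg h) (U - D) (- U) w"
          by (rule leads_cong_imp[OF avoid[OF l0L that]]) (auto simp: mrg_def)
        then show ?thesis by (rule leads_mono) auto
      qed
      have "leads h D (- D) u" using h by (simp add: forests_def)
      then show ?thesis
      proof (induction rule: leads.induct)
        case (leads_here u)
        then show ?case by (intro out) auto
      next
        case (leads_step u)
        then show ?case using DU leads.leads_step[of u U "mrg h" "- U"] by (auto simp: mrg_def)
      qed
    qed
    have in1: "mrg h \<in> {l\<in>forests U V. key l = key l0}" if h: "h \<in> forests D V" for h
    proof -
      have "mrg h \<in> U \<rightarrow>\<^sub>E V" using l0PE h DU by (auto simp: mrg_def forests_def PiE_def Pi_def extensional_def)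
      then show ?thesis using mrg_leads[OF h] unfolding key_iff forests_def by (auto simp: mrg_def)
    qed
    have in2: "restrict l D \<in> forests D V" if l: "l \<in> forests U V" for l
    proof -
      have "leads (restrict l D) D (- D) u" for u
      proof -
        have "leads l U (- U) u" using l by (simp add: forests_def)
        then have "leads l D (- D) u" using DU by (rule leads_exit_mono)
        then show ?thesis by (rule leads_cong_imp) auto
      qed
      moreover have "restrict l D \<in> D \<rightarrow>\<^sub>E V" using l DU by (auto simp: forests_def PiE_def Pi_def)
      ultimately show ?thesis unfolding forests_def by blast
    qed
    define c where "c = of_bool (s \<in> D) * (\<Prod>u\<in>U - D. m u (l0 u))"
    have Fm: "F (mrg h) = c * (forest_weight m D h * (of_bool (h s = w) - exit_law m D V s w))"
      if h: "h \<in> forests D V" for h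
    proof -
      have core: "core U B (mrg h) = D" using in1[OF h] by (auto simp: key_def D_def)
      have "forest_weight m U (mrg h) = (\<Prod>u\<in>D. m u (mrg h u)) * (\<Prod>u\<in>U - D. m u (mrg h u))"
        unfolding forest_weight_def using prod.subset_diff[OF DU fin(1), of "\<lambda>u. m u (mrg h u)"]
        by (simp add: mult.commute)
      also have "\<dots> = forest_weight m D h * (\<Prod>u\<in>U - D. m u (l0 u))"
        unfolding forest_weight_def by (intro arg_cong2[where f = "(*)"] prod.cong) (auto simp: mrg_def)
      finally show ?thesis unfolding F_def core c_def by (auto simp: mrg_def)
    qed
    have "(\<Sum>l\<in>{l\<in>forests U V. key l = key l0}. F l) = (\<Sum>h\<in>forests D V. F (mrg h))"
    proof (rule sum.reindex_bij_witness[where i = mrg and j = "\<lambda>l. restrict l D"])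
      fix l assume "l \<in> {l\<in>forests U V. key l = key l0}"
      then have l: "l \<in> forests U V" "\<forall>u\<in>U - D. l u = l0 u" by (auto simp: key_iff)
      show e: "mrg (restrict l D) = l"
      proof
        fix u
        have "l u = undefined" "l0 u = undefined" if "u \<notin> U"
          using l(1) l0PE that by (auto simp: forests_def PiE_def extensional_def)
        then show "mrg (restrict l D) u = l u"
          using l(2) by (cases "u \<in> U") (auto simp: mrg_def)
      qed
      show "restrict l D \<in> forests D V" by (rule in2[OF l(1)])
      show "F (mrg (restrict l D)) = F l" by (simp add: e)
    next
      fix h assume h: "h \<in> forests D V"
      then show "mrg h \<in> {l\<in>forests U V. key l = key l0}" by (rule in1)
      show "restrict (mrg h) D = h"
        using h by (auto simp: mrg_def fun_eq_iff forests_def PiE_def extensional_def)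
    qed
    also have "\<dots> = c * (\<Sum>h\<in>forests D V. forest_weight m D h * (of_bool (h s = w) - exit_law m D V s w))"
      by (simp add: Fm sum_distrib_left)
    also have "\<dots> = 0" by (simp add: sum_exit_law finD fin m)
    finally show ?thesis .
  qed
  have "(\<Sum>l\<in>forests U V. F l) =
      (\<Sum>k\<in>key ` forests U V. \<Sum>l\<in>{l\<in>forests U V. key l = k}. F l)"
    by (rule sum.image_gen) (simp add: finite_forests fin)
  also have "\<dots> = 0" by (rule sum.neutral) (use zero in auto)
  finally show ?thesis by (simp add: F_def)
qed

text \<open>
  Among the trails with transitions \<open>T\<close> whose core contains \<open>s\<close>, the first step has on average the
  law obtained from the exit law of the core. The identity is multiplied by the out-degree of \<open>s\<close>
  minus one and so says nothing about the first step when \<open>s\<close> is left only once.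
\<close>

theorem sum_trails_first_step:
  fixes T :: "('a \<times> 'a) multiset" and s z v :: 'a and B :: "'a set"
  defines "U \<equiv> tree_vertices T z" and "V \<equiv> snd ` set_mset T" and "m \<equiv> \<lambda>u v. real (count T (u, v))"
  assumes B: "B \<subseteq> U"
  shows "(\<Sum>ys\<in>trails T s z. of_bool (s \<in> core U B (last_exit_tree T s z ys)) *
      ((real (out_degree T s) - 1) * of_bool (ys \<noteq> [] \<and> hd ys = v)
       - (m s v - exit_law m (core U B (last_exit_tree T s z ys)) V s v))) = 0"
proof (cases "trails T s z = {} \<or> s \<notin> U")
  case True
  moreover have "s \<notin> core U B l" if "s \<notin> U" for l using that core_subset[of U B l] B by auto
  ultimately show ?thesis by auto
next
  case False
  then obtain y0 where "y0 \<in> trails T s z" by auto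
  then have bal: "balanced T s z" using balanced_trans_mset[of s y0] by (auto simp: trails_def)
  have sz: "s \<noteq> z" using False by (auto simp: U_def tree_vertices_def)
  have fin: "finite U" "finite V" by (auto simp: U_def V_def)
  define d where "d = real (out_degree T s)"
  define K where "K l = (of_bool (s \<in> core U B l) :: real)" for l
  define q where "q l = exit_law m (core U B l) V s v" for l
  define lx where "lx = last_exit_tree T s z"
  define c where "c = (\<Prod>u\<in>sources T. if u = z then fact (out_degree T u) else fact (out_degree T u - 1)) / real (mult_fact T)"
  have lead: "leads l (sources T - {z}) (- (sources T - {z})) u" if "l \<in> forests U V" for l u
    using that by (simp add: forests_def U_def tree_vertices_def)
  have card: "real (card (trails_with T s z l)) = c * forest_weight m U l" if "l \<in> forests U V" for l
  proof -
    have "real (card (trails_with T s z l)) * real (mult_fact T) = (\<Prod>u\<in>sources T. real (trail_weight T z l u))"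
      using arg_cong[OF card_trails_with[OF bal lead[OF that], folded mult_fact_def], of real] by simp
    also have "\<dots> = (\<Prod>u\<in>sources T. (if u = z then fact (out_degree T u) else fact (out_degree T u - 1)) *
        (if u \<in> {z} then 1 else m u (l u)))"
      by (intro prod.cong) (auto simp: trail_weight_def m_def)
    also have "\<dots> = (\<Prod>u\<in>sources T. if u = z then fact (out_degree T u) else fact (out_degree T u - 1)) *
        (\<Prod>u\<in>sources T. if u \<in> {z} then 1 else m u (l u))"
      by (rule prod.distrib)
    also have "(\<Prod>u\<in>sources T. if u \<in> {z} then 1 else m u (l u)) = forest_weight m U l"
      unfolding forest_weight_def U_def tree_vertices_def
      by (intro prod.mono_neutral_cong_right) auto
    finally show ?thesis using mult_fact_pos[of T] by (simp add: c_def field_simps)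
  qed
  have 1: "(\<Sum>ys\<in>trails T s z. of_bool (ys \<noteq> [] \<and> hd ys = v) * K (lx ys)) =
      (\<Sum>l\<in>forests U V. real (card {ys \<in> trails_with T s z l. ys \<noteq> [] \<and> hd ys = v}) * K l)"
  proof -
    have "(\<Sum>ys\<in>trails T s z. of_bool (ys \<noteq> [] \<and> hd ys = v) * K (lx ys)) =
      (\<Sum>ys\<in>{ys\<in>trails T s z. ys \<noteq> [] \<and> hd ys = v}. K (lx ys))"
      by (intro sum.mono_neutral_cong_right) (auto simp: finite_trails)
    then show ?thesis
      using sum_trails_by_tree[where P = "\<lambda>ys. ys \<noteq> [] \<and> hd ys = v" and T = T and s = s and z = z and F = K]
      by (simp add: lx_def U_def V_def)
  qed
  have 2: "(\<Sum>ys\<in>trails T s z. K (lx ys) * (m s v - q (lx ys))) =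
      (\<Sum>l\<in>forests U V. real (card (trails_with T s z l)) * (K l * (m s v - q l)))"
    using sum_trails_by_tree[where P = "\<lambda>_. True" and T = T and s = s and z = z and F = "\<lambda>l. K l * (m s v - q l)"]
    by (simp add: lx_def U_def V_def)
  have "(\<Sum>ys\<in>trails T s z. K (lx ys) * ((d - 1) * of_bool (ys \<noteq> [] \<and> hd ys = v) - (m s v - q (lx ys)))) =
      (d - 1) * (\<Sum>ys\<in>trails T s z. of_bool (ys \<noteq> [] \<and> hd ys = v) * K (lx ys)) -
      (\<Sum>ys\<in>trails T s z. K (lx ys) * (m s v - q (lx ys)))"
    by (simp add: sum_distrib_left sum_subtractf[symmetric] algebra_simps)
  also have "(d - 1) * (\<Sum>ys\<in>trails T s z. of_bool (ys \<noteq> [] \<and> hd ys = v) * K (lx ys)) =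
      (\<Sum>l\<in>forests U V. (d - 1) * real (card {ys \<in> trails_with T s z l. ys \<noteq> [] \<and> hd ys = v}) * K l)"
    unfolding 1 by (simp add: sum_distrib_left mult.assoc)
  also have "\<dots> = (\<Sum>l\<in>forests U V. c * (K l * forest_weight m U l * (m s v - of_bool (l s = v))))"
  proof (rule sum.cong[OF refl])
    fix l assume l: "l \<in> forests U V"
    have "(d - 1) * real (card {ys \<in> trails_with T s z l. ys \<noteq> [] \<and> hd ys = v}) =
        c * forest_weight m U l * (m s v - of_bool (l s = v))"
      using card_trails_with_first_step_ratio[OF bal sz lead[OF l], of v]
      by (simp add: card[OF l] d_def m_def of_bool_def)
    then show "(d - 1) * real (card {ys \<in> trails_with T s z l. ys \<noteq> [] \<and> hd ys = v}) * K l =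
        c * (K l * forest_weight m U l * (m s v - of_bool (l s = v)))" by simp
  qed
  also have "\<dots> - (\<Sum>ys\<in>trails T s z. K (lx ys) * (m s v - q (lx ys))) =
     - c * (\<Sum>l\<in>forests U V. K l * forest_weight m U l * (of_bool (l s = v) - q l))"
    unfolding 2 by (simp add: sum_distrib_left sum_subtractf[symmetric] card algebra_simps sum_negf[symmetric])
  also have "\<dots> = 0"
    using sum_forests_core[OF fin B, of m s v] by (simp add: K_def q_def m_def)
  finally show ?thesis by (simp add: K_def q_def lx_def d_def)
qed

section \<open>Words of an infinite path\<close>

text \<open>
  The start of the path is omitted, in accordance with the representation of trails.
\<close>

definition word :: "nat \<Rightarrow> (nat \<Rightarrow> 'a) \<Rightarrow> 'a list" where
  "word n x = map x [1..<Suc n]"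

definition path_trans :: "nat \<Rightarrow> (nat \<Rightarrow> 'a) \<Rightarrow> ('a \<times> 'a) multiset" where
  "path_trans n x = trans_mset (x 0) (word n x)"

lemma trans_mset_append:
  "trans_mset s (ys @ zs) = trans_mset s ys + trans_mset (last (s # ys)) zs"
  by (induction ys arbitrary: s) auto

lemma length_word [simp]: "length (word n x) = n"
  by (simp add: word_def)

lemma word_0 [simp]: "word 0 x = []"
  by (simp add: word_def)

lemma word_Suc_right: "word (Suc n) x = word n x @ [x (Suc n)]"
  by (simp add: word_def)

lemma word_Suc_left: "word (Suc n) x = x 1 # word n (\<lambda>i. x (Suc i))"
proof -
  have "[1..<Suc (Suc n)] = 1 # map Suc [1..<Suc n]"
    by (metis One_nat_def Suc_less_eq map_Suc_upt upt_rec zero_less_Suc)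
  then show ?thesis by (simp add: word_def)
qed

lemma Cons_word: "x 0 # word n x = map x [0..<Suc n]"
  by (simp add: word_def upt_rec[of 0])

lemma last_word: "last (x 0 # word n x) = x n"
  by (simp add: Cons_word)

lemma path_trans_Suc: "path_trans (Suc n) x = add_mset (x n, x (Suc n)) (path_trans n x)"
  by (simp only: path_trans_def word_Suc_right trans_mset_append last_word trans_mset.simps) simp

lemma word_in_trails: "word n x \<in> trails (path_trans n x) (x 0) (x n)"
  by (simp add: trails_def path_trans_def last_word del: last.simps)

lemma count_path_trans: "count (path_trans n x) (u, v) = card {i. i < n \<and> x i = u \<and> x (Suc i) = v}"
proof (induction n)
  case (Suc n)
  have "{i. i < Suc n \<and> x i = u \<and> x (Suc i) = v} =
    (if x n = u \<and> x (Suc n) = v then insert n else id) {i. i < n \<and> x i = u \<and> x (Suc i) = v}"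
    by (auto simp: less_Suc_eq)
  then show ?case using Suc by (simp add: path_trans_Suc)
qed (simp add: path_trans_def)

lemma out_degree_path_trans: "out_degree (path_trans n x) u = card {i. i < n \<and> x i = u}"
proof (induction n)
  case (Suc n)
  have "{i. i < Suc n \<and> x i = u} =
    (if x n = u then insert n else id) {i. i < n \<and> x i = u}"
    by (auto simp: less_Suc_eq)
  then show ?case using Suc by (simp add: path_trans_Suc out_degree_def)
qed (simp add: path_trans_def out_degree_def)

lemma sources_path_trans: "sources (path_trans n x) = x ` {..<n}"
  unfolding path_trans_def sources_trans_mset Cons_word by (auto simp: atLeast0LessThan)

lemma snd_path_trans: "snd ` set_mset (path_trans n x) = x ` {1..n}"
  unfolding path_trans_def snd_trans_mset word_def by (auto simp: atLeastLessThanSuc_atLeastAtMost)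

lemma last_exit_path:
  assumes "i < n" "x i = u" "\<And>j. i < j \<Longrightarrow> j < n \<Longrightarrow> x j \<noteq> u"
  shows "last_exit (x 0) (word n x) u = x (Suc i)"
  using assms
proof (induction n arbitrary: x i)
  case (Suc n)
  have src: "sources (trans_mset (x 1) (word n (\<lambda>i. x (Suc i)))) = (\<lambda>i. x (Suc i)) ` {..<n}"
    using sources_path_trans[of n "\<lambda>i. x (Suc i)"] by (simp add: path_trans_def)
  show ?case
  proof (cases i)
    case 0
    then have "u \<notin> (\<lambda>i. x (Suc i)) ` {..<n}" using Suc.prems(3) by fastforce
    then have "x 0 \<notin> sources (trans_mset (x 1) (word n (\<lambda>i. x (Suc i))))"
      unfolding src using 0 Suc.prems(2) by simp
    then have "last_exit (x 0) (word (Suc n) x) = (last_exit (x 1) (word n (\<lambda>i. x (Suc i))))(x 0 := x 1)"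
      unfolding word_Suc_left last_exit.simps by (rule if_not_P)
    then show ?thesis using 0 Suc.prems(2) by simp
  next
    case (Suc k)
    then have k: "k < n" "x (Suc k) = u" using Suc.prems by auto
    have IH: "last_exit (x 1) (word n (\<lambda>i. x (Suc i))) u = x (Suc (Suc k))"
      using Suc.IH[of k "\<lambda>i. x (Suc i)"] k Suc.prems(3) Suc by auto
    have "u \<in> (\<lambda>i. x (Suc i)) ` {..<n}" using k by auto
    then have "last_exit (x 0) (word (Suc n) x) u = last_exit (x 1) (word n (\<lambda>i. x (Suc i))) u"
      unfolding word_Suc_left last_exit.simps src by (cases "u = x 0") simp_all
    then show ?thesis using IH Suc by simp
  qed
qed simp

lemma count_last_exit_pos:
  "u \<in> sources (trans_mset s ys) \<Longrightarrow> 0 < count (trans_mset s ys) (u, last_exit s ys u)"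
  by (induction ys arbitrary: s) (auto simp: sources_def)

definition num_trans :: "(nat \<Rightarrow> 'a) \<Rightarrow> 'a \<Rightarrow> 'a \<Rightarrow> nat" where
  "num_trans x u v = card {i. x i = u \<and> x (Suc i) = v}"

text \<open>
  States visited before time \<open>n\<close> and never from then on. Their exits before time \<open>n\<close> are all their exits.
\<close>

definition dead :: "nat \<Rightarrow> (nat \<Rightarrow> 'a) \<Rightarrow> 'a set" where
  "dead n x = {u \<in> x ` {..<n}. \<forall>k\<ge>n. x k \<noteq> u}"

definition path_core :: "nat \<Rightarrow> (nat \<Rightarrow> 'a) \<Rightarrow> 'a set" where
  "path_core n x = core (tree_vertices (path_trans n x) (x n)) (dead n x)
     (last_exit_tree (path_trans n x) (x 0) (x n) (word n x))"

lemma dead_subset: "dead n x \<subseteq> tree_vertices (path_trans n x) (x n)"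
  by (auto simp: dead_def tree_vertices_def sources_path_trans)

section \<open>Escape probabilities determined by the transition numbers\<close>

definition window :: "'a set \<Rightarrow> nat \<Rightarrow> 'a set" where
  "window S k = {v \<in> S. to_nat_on S v < k}"

definition total_deg :: "'a set \<Rightarrow> ('a \<Rightarrow> 'a \<Rightarrow> nat) \<Rightarrow> 'a \<Rightarrow> real" where
  "total_deg S m u = (\<integral>v. real (m u v) \<partial>count_space S)"

text \<open>
  Increasing approximations to the probability that the chain with kernel \<open>m u v / total_deg S m u\<close>
  hits \<open>s\<close> from \<open>u\<close>, by walks of bounded length in growing finite windows of \<open>S\<close>. As the windows are
  finite, only finitely many values of \<open>m\<close> enter besides the degrees.
\<close>

primrec hit_approx :: "'a set \<Rightarrow> 'a \<Rightarrow> ('a \<Rightarrow> 'a \<Rightarrow> nat) \<Rightarrow> nat \<Rightarrow> 'a \<Rightarrow> real" where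
  "hit_approx S s m 0 u = 0"
| "hit_approx S s m (Suc k) u =
     (if u \<notin> window S (Suc k) then 0 else if u = s then 1
      else \<Sum>v\<in>window S k. real (m u v) / total_deg S m u * hit_approx S s m k v)"

definition hit_lim :: "'a set \<Rightarrow> 'a \<Rightarrow> ('a \<Rightarrow> 'a \<Rightarrow> nat) \<Rightarrow> 'a \<Rightarrow> real" where
  "hit_lim S s m u = lim (\<lambda>k. hit_approx S s m k u)"

definition exit_prob :: "'a set \<Rightarrow> 'a \<Rightarrow> ('a \<Rightarrow> 'a \<Rightarrow> nat) \<Rightarrow> 'a \<Rightarrow> real" where
  "exit_prob S s m v = real (m s v) * (1 - hit_lim S s m v) /
     (\<integral>w. real (m s w) * (1 - hit_lim S s m w) \<partial>count_space S)"

text \<open>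
  The conditional probability of the first step \<open>v\<close> given the transition numbers \<open>m\<close>. The first
  exit from \<open>s\<close> is uniform among the exits other than the last one, and \<open>exit_prob\<close> is the law of the
  last one. For the transition numbers of a transient path from \<open>s\<close> the quotient lies in \<open>[0, 3]\<close>;
  truncating it everywhere provides bounds for arbitrary \<open>m\<close>.
\<close>

definition step_prob :: "'a set \<Rightarrow> 'a \<Rightarrow> ('a \<Rightarrow> 'a \<Rightarrow> nat) \<Rightarrow> 'a \<Rightarrow> real" where
  "step_prob S s m v = max 0 (min 3
     (if total_deg S m s = 1 then real (m s v)
      else (real (m s v) - exit_prob S s m v) / (total_deg S m s - 1)))"

lemma finite_window: "countable S \<Longrightarrow> finite (window S k)"
  unfolding window_def
  by (rule inj_on_finite[of "to_nat_on S" _ "{..<k}"])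
     (auto intro: inj_on_subset[OF inj_on_to_nat_on])

lemma window_mono: "j \<le> k \<Longrightarrow> window S j \<subseteq> window S k"
  by (auto simp: window_def)

lemma finite_subset_window:
  assumes "finite A" "A \<subseteq> S"
  shows "eventually (\<lambda>k. A \<subseteq> window S k) sequentially"
proof -
  have "eventually (\<lambda>k. v \<in> window S k) sequentially" if "v \<in> A" for v
    using eventually_gt_at_top[of "to_nat_on S v"] by eventually_elim (use that assms in \<open>auto simp: window_def\<close>)
  then have "eventually (\<lambda>k. \<forall>v\<in>A. v \<in> window S k) sequentially"
    using assms(1) by (intro eventually_ball_finite) auto
  then show ?thesis by eventually_elim auto
qed

locale transient_path =
  fixes S :: "'a set" and x :: "nat \<Rightarrow> 'a"
  assumes countable_S: "countable S"
    and path_in_S: "x i \<in> S"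
    and transient: "finite {i. x i = u}"
begin

abbreviation "m \<equiv> num_trans x"

definition visits :: "'a \<Rightarrow> nat" where "visits u = card {i. x i = u}"

definition last_visit :: "'a \<Rightarrow> nat" where "last_visit u = Max {i. x i = u}"

lemma last_visit:
  assumes "u \<in> range x"
  shows "x (last_visit u) = u" "x j = u \<Longrightarrow> j \<le> last_visit u"
proof -
  have ne: "{i. x i = u} \<noteq> {}" using assms by auto
  show "x (last_visit u) = u" using Max_in[OF transient ne] by (simp add: last_visit_def)
  show "j \<le> last_visit u" if "x j = u" unfolding last_visit_def using that by (intro Max_ge transient) auto
qed

lemma visits_pos: "u \<in> range x \<Longrightarrow> 0 < visits u"
  using transient by (auto simp: visits_def card_gt_0_iff)

lemma num_trans_pos: "x (Suc i) = v \<Longrightarrow> 0 < m (x i) v"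
  using finite_subset[of "{j. x j = x i \<and> x (Suc j) = v}" "{j. x j = x i}"] transient[of "x i"]
  by (auto simp: num_trans_def card_gt_0_iff)

lemma num_trans_eq_0: "(\<And>i. x i = u \<Longrightarrow> x (Suc i) \<noteq> v) \<Longrightarrow> m u v = 0"
  unfolding num_trans_def by (subst Collect_empty_eq[THEN iffD2]) auto

lemma sum_num_trans:
  assumes "finite V" "\<And>i. x i = u \<Longrightarrow> x (Suc i) \<in> V"
  shows "(\<Sum>v\<in>V. m u v) = visits u"
proof -
  have "visits u = card (\<Union>v\<in>V. {i. x i = u \<and> x (Suc i) = v})"
    unfolding visits_def using assms by (intro arg_cong[where f = card]) auto
  also have "\<dots> = (\<Sum>v\<in>V. card {i. x i = u \<and> x (Suc i) = v})"
    using assms(1) by (intro card_UN_disjoint) (auto intro: finite_subset[OF _ transient[of u]])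
  finally show ?thesis by (simp add: num_trans_def)
qed

lemma sum_num_trans_real:
  assumes "finite V" "\<And>i. x i = u \<Longrightarrow> x (Suc i) \<in> V"
  shows "(\<Sum>v\<in>V. real (m u v)) = visits u"
  using sum_num_trans[OF assms] by (simp flip: of_nat_sum)

definition successors :: "'a \<Rightarrow> 'a set" where "successors u = (\<lambda>i. x (Suc i)) ` {i. x i = u}"

lemma successors: "finite (successors u)" "successors u \<subseteq> S" "x i = u \<Longrightarrow> x (Suc i) \<in> successors u"
  "v \<notin> successors u \<Longrightarrow> m u v = 0"
  using transient path_in_S by (auto simp: successors_def num_trans_def)

lemma integral_num_trans:
  fixes g :: "'a \<Rightarrow> real"
  assumes "finite V" "successors u \<subseteq> V" "V \<subseteq> S"
  shows "(\<integral>v. real (m u v) * g v \<partial>count_space S) = (\<Sum>v\<in>V. real (m u v) * g v)"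
proof -
  have fin: "finite {v \<in> S. real (m u v) * g v \<noteq> 0}"
    by (rule finite_subset[OF _ successors(1)[of u]]) (use successors(4) in force)
  have "(\<integral>v. real (m u v) * g v \<partial>count_space S) = (\<Sum>v\<in>{v \<in> S. real (m u v) * g v \<noteq> 0}. real (m u v) * g v)"
    by (rule lebesgue_integral_count_space_finite_support[OF fin])
  also have "\<dots> = (\<Sum>v\<in>V. real (m u v) * g v)"
  proof (rule sum.mono_neutral_left[OF assms(1)])
    have "m u v = 0" if "v \<notin> V" for v using that assms(2) successors(4)[of v u] by blast
    then show "{v \<in> S. real (m u v) * g v \<noteq> 0} \<subseteq> V" by force
  qed (use assms in auto)
  finally show ?thesis .
qed

lemma total_deg_eq: "total_deg S m u = visits u"
  using integral_num_trans[of "successors u" u "\<lambda>_. 1"] successors(1-3)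
    sum_num_trans_real[of "successors u" u] by (simp add: total_deg_def)

lemma sum_num_trans_le: 
  assumes "finite V"
  shows "(\<Sum>v\<in>V. real (m u v)) \<le> visits u"
proof -
  have "(\<Sum>v\<in>V. real (m u v)) \<le> (\<Sum>v\<in>V \<union> successors u. real (m u v))"
    using assms successors(1) by (intro sum_mono2) auto
  also have "\<dots> = visits u"
    using assms successors by (intro sum_num_trans_real) auto
  finally show ?thesis .
qed

abbreviation "s \<equiv> x 0"

lemma hit_approx_nonneg: "0 \<le> hit_approx S s m k u"
  by (induction k arbitrary: u) (auto intro!: sum_nonneg divide_nonneg_nonneg mult_nonneg_nonneg simp: total_deg_eq)

lemma hit_approx_le_1: "hit_approx S s m k u \<le> 1"
proof (induction k arbitrary: u)
  case (Suc k)
  have "(\<Sum>v\<in>window S k. real (m u v) / total_deg S m u * hit_approx S s m k v) \<le>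
     (\<Sum>v\<in>window S k. real (m u v) / total_deg S m u * 1)"
    by (intro sum_mono mult_left_mono Suc) (simp add: total_deg_eq)
  also have "\<dots> = (\<Sum>v\<in>window S k. real (m u v)) / visits u"
    by (simp add: total_deg_eq sum_divide_distrib)
  also have "\<dots> \<le> 1"
    using sum_num_trans_le[OF finite_window[OF countable_S, of k], of u]
    by (cases "visits u = 0") (auto simp: divide_le_eq_1)
  finally show ?case by simp
qed simp

lemma hit_approx_mono_Suc: "hit_approx S s m k u \<le> hit_approx S s m (Suc k) u"
proof (induction k arbitrary: u)
  case (Suc k)
  have "(\<Sum>v\<in>window S k. real (m u v) / total_deg S m u * hit_approx S s m k v) \<le>
     (\<Sum>v\<in>window S k. real (m u v) / total_deg S m u * hit_approx S s m (Suc k) v)"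
    by (intro sum_mono mult_left_mono Suc) (simp add: total_deg_eq)
  also have "\<dots> \<le> (\<Sum>v\<in>window S (Suc k). real (m u v) / total_deg S m u * hit_approx S s m (Suc k) v)"
    by (intro sum_mono2 finite_window countable_S window_mono mult_nonneg_nonneg hit_approx_nonneg)
       (auto simp: total_deg_eq)
  finally show ?case
    using window_mono[of "Suc k" "Suc (Suc k)" S] hit_approx_nonneg[of "Suc (Suc k)" u]
    by (cases "u \<in> window S (Suc k)") auto
qed (simp add: hit_approx_nonneg del: hit_approx.simps(2))

lemma hit_approx_tendsto: "(\<lambda>k. hit_approx S s m k u) \<longlonglongrightarrow> hit_lim S s m u"
proof -
  have "incseq (\<lambda>k. hit_approx S s m k u)" by (intro incseq_SucI hit_approx_mono_Suc)
  then have "convergent (\<lambda>k. hit_approx S s m k u)"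
    by (rule incseq_convergent[where B = 1]) (auto simp: hit_approx_le_1 convergent_def)
  then show ?thesis by (simp add: convergent_LIMSEQ_iff hit_lim_def)
qed

lemma hit_approx_le_lim: "hit_approx S s m k u \<le> hit_lim S s m u"
  by (rule incseq_le[OF _ hit_approx_tendsto]) (intro incseq_SucI hit_approx_mono_Suc)

lemma hit_lim_range: "0 \<le> hit_lim S s m u" "hit_lim S s m u \<le> 1"
  using hit_approx_le_lim[of 0 u] LIMSEQ_le_const2[OF hit_approx_tendsto[of u], of 1] hit_approx_le_1
  by auto

lemma hit_lim_self: "hit_lim S s m s = 1"
proof -
  have "eventually (\<lambda>k. {s} \<subseteq> window S k) sequentially"
    using path_in_S by (intro finite_subset_window) auto
  then have "eventually (\<lambda>k. hit_approx S s m k s = 1) sequentially"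
    using eventually_gt_at_top[of 0] by eventually_elim (auto simp: gr0_conv_Suc)
  then have "(\<lambda>k. hit_approx S s m k s) \<longlonglongrightarrow> 1" by (rule tendsto_eventually)
  then show ?thesis using LIMSEQ_unique hit_approx_tendsto by blast
qed

text \<open>
  In the limit of the defining recursion only an inequality over finite sets \<open>D\<close> is recorded; it is
  all that the comparison of \<open>hit_lim\<close> with solutions on finite sets uses.
\<close>

lemma hit_lim_superharmonic:
  assumes "u \<in> S" "finite D" "D \<subseteq> S" "u \<noteq> s"
  shows "(\<Sum>v\<in>D. real (m u v) * hit_lim S s m v) \<le> visits u * hit_lim S s m u"
proof (rule LIMSEQ_le)
  show "(\<lambda>k. \<Sum>v\<in>D. real (m u v) * hit_approx S s m k v) \<longlonglongrightarrow> (\<Sum>v\<in>D. real (m u v) * hit_lim S s m v)"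
    by (intro tendsto_intros hit_approx_tendsto)
  show "(\<lambda>k. visits u * hit_approx S s m (Suc k) u) \<longlonglongrightarrow> visits u * hit_lim S s m u"
    by (intro tendsto_intros LIMSEQ_Suc[OF hit_approx_tendsto])
  have "eventually (\<lambda>k. {u} \<subseteq> window S k) sequentially"
    using assms by (intro finite_subset_window) auto
  with finite_subset_window[OF assms(2,3)]
  have "eventually (\<lambda>k. (\<Sum>v\<in>D. real (m u v) * hit_approx S s m k v) \<le> visits u * hit_approx S s m (Suc k) u) sequentially"
  proof eventually_elim
    case (elim k)
    have "u \<in> window S (Suc k)" using elim(2) window_mono[of k "Suc k" S] assms by auto
    then have "visits u * hit_approx S s m (Suc k) u =
      visits u * (\<Sum>v\<in>window S k. real (m u v) / visits u * hit_approx S s m k v)"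
      using assms by (simp add: total_deg_eq)
    also have "\<dots> = (\<Sum>v\<in>window S k. real (m u v) * hit_approx S s m k v)"
    proof (cases "visits u = 0")
      case True
      then have "m u v = 0" for v using sum_num_trans_le[of "{v}" u] by simp
      then show ?thesis using True by simp
    qed (simp add: sum_distrib_left)
    also have "\<dots> \<ge> (\<Sum>v\<in>D. real (m u v) * hit_approx S s m k v)"
      using elim by (intro sum_mono2 finite_window countable_S) (auto simp: hit_approx_nonneg)
    finally show ?case by simp
  qed
  then show "\<exists>N. \<forall>k\<ge>N. (\<Sum>v\<in>D. real (m u v) * hit_approx S s m k v) \<le> visits u * hit_approx S s m (Suc k) u"
    by (simp add: eventually_sequentially)
qed

text \<open>
  Let \<open>f\<close> solve the Dirichlet problem on a finite set \<open>D\<close> of visited states: \<open>f\<close> is 1 at \<open>s\<close>, 0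
  outside \<open>D\<close> and harmonic in between. It is bounded above by the hitting probability in the
  infinite graph and below by the approximations whose window has no visited state outside \<open>D\<close>. So such
  solutions converge to \<open>hit_lim\<close> along every sequence of sets that exhausts the visited states.
\<close>

context
  fixes D V :: "'a set" and f :: "'a \<Rightarrow> real"
  assumes finV: "finite V" and finD: "finite D" and D_sub: "D \<subseteq> range x" and sD: "s \<in> D"
    and succ_V: "\<And>u i. x i \<in> D \<Longrightarrow> x (Suc i) \<in> V"
    and f_range: "\<And>u. 0 \<le> f u" "\<And>u. f u \<le> 1"
    and f_s: "f s = 1" and f_out: "\<And>u. u \<notin> D \<Longrightarrow> f u = 0"
    and f_harm: "\<And>u. u \<in> D \<Longrightarrow> u \<noteq> s \<Longrightarrow> (\<Sum>v\<in>V. real (m u v) * f v) = visits u * f u"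
begin

lemma m_out_V: "u \<in> D \<Longrightarrow> v \<notin> V \<Longrightarrow> m u v = 0"
  using succ_V by (intro num_trans_eq_0) auto

text \<open>
  Maximum principle. Were the maximum of \<open>f - hit_lim\<close> positive, all successors of a maximiser would be
  maximisers in \<open>D\<close>. Choose the maximiser that the path visits last; the state visited right after
  that visit is visited later, a contradiction.
\<close>

lemma dirichlet_le_hit_lim: "f u \<le> hit_lim S s m u"
proof (rule ccontr)
  assume less: "\<not> f u \<le> hit_lim S s m u"
  define g where "g = hit_lim S s m"
  define h where "h v = (if v \<in> D then f v - g v else 0)" for v
  have uD: "u \<in> D" and hu: "h u > 0"
    using less f_out[of u] hit_lim_range(1)[of u] by (cases "u \<in> D"; simp add: h_def g_def)+
  define c where "c = Max (h ` D)"
  have hc: "h v \<le> c" if "v \<in> D" for v using that finD by (simp add: c_def)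
  have c0: "c > 0" using hc[OF uD] hu by simp
  have hc': "h v \<le> c" for v using hc c0 by (cases "v \<in> D") (auto simp: h_def)
  define A where "A = {v \<in> D. h v = c}"
  have "c \<in> h ` D" unfolding c_def using uD finD by (intro Max_in) auto
  then have A: "finite A" "A \<noteq> {}" using finD by (auto simp: A_def)
  have "Max (last_visit ` A) \<in> last_visit ` A" using A by (intro Max_in) auto
  then obtain a where aA: "a \<in> A" and a: "last_visit a = Max (last_visit ` A)" by auto
  have amax: "last_visit b \<le> last_visit a" if "b \<in> A" for b
    unfolding a using that A by (intro Max_ge) auto
  have aD: "a \<in> D" "h a = c" using aA by (auto simp: A_def)
  have as: "a \<noteq> s" using aD c0 f_s hit_lim_self by (auto simp: h_def g_def)
  have ax: "a \<in> range x" using aD D_sub by auto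
  have "a \<in> S" using ax path_in_S by auto
  define w where "w = x (Suc (last_visit a))"
  have maw: "m a w > 0" using num_trans_pos[of "last_visit a" w] last_visit(1)[OF ax] by (simp add: w_def)
  have wV: "w \<in> V" using succ_V[of "last_visit a"] aD last_visit(1)[OF ax] by (simp add: w_def)
  have tot: "(\<Sum>v\<in>V. real (m a v)) = visits a"
    using aD by (intro sum_num_trans_real finV) (use succ_V in auto)
  have "visits a * c = visits a * f a - visits a * g a" using aD by (simp add: h_def algebra_simps)
  also have "\<dots> \<le> (\<Sum>v\<in>V. real (m a v) * f v) - (\<Sum>v\<in>D. real (m a v) * g v)"
    using f_harm[OF aD(1) as] hit_lim_superharmonic[OF \<open>a \<in> S\<close> finD _ as] D_sub path_in_S
    by (auto simp: g_def)
  also have "(\<Sum>v\<in>D. real (m a v) * g v) = (\<Sum>v\<in>V. if v \<in> D then real (m a v) * g v else 0)"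
  proof -
    have "(\<Sum>v\<in>D. real (m a v) * g v) = (\<Sum>v\<in>V \<inter> D. real (m a v) * g v)"
      using finD m_out_V[OF aD(1)] by (intro sum.mono_neutral_right) force+
    also have "\<dots> = (\<Sum>v\<in>V. if v \<in> D then real (m a v) * g v else 0)"
      by (rule sum.inter_restrict[OF finV])
    finally show ?thesis .
  qed
  also have "(\<Sum>v\<in>V. real (m a v) * f v) - \<dots> = (\<Sum>v\<in>V. real (m a v) * h v)"
    unfolding sum_subtractf[symmetric] using f_out by (intro sum.cong) (auto simp: h_def algebra_simps)
  finally have le: "visits a * c \<le> (\<Sum>v\<in>V. real (m a v) * h v)" .
  have "h w = c"
  proof (rule ccontr)
    assume "h w \<noteq> c"
    then have "h w < c" using hc'[of w] by simp
    then have "(\<Sum>v\<in>V. real (m a v) * h v) < (\<Sum>v\<in>V. real (m a v) * c)"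
      using wV maw hc' by (intro sum_strict_mono_ex1 finV) (auto intro!: mult_left_mono bexI[of _ w])
    also have "\<dots> = visits a * c" using tot by (simp flip: sum_distrib_right)
    finally show False using le by simp
  qed
  then have "w \<in> A" using c0 by (cases "w \<in> D") (auto simp: A_def h_def)
  then have "last_visit w \<le> last_visit a" by (rule amax)
  moreover have "Suc (last_visit a) \<le> last_visit w"
    by (rule last_visit(2)) (auto simp: w_def)
  ultimately show False by simp
qed

lemma hit_approx_le_dirichlet:
  assumes "window S k \<inter> range x \<subseteq> D"
  shows "hit_approx S s m k u \<le> f u"
  using assms
proof (induction k arbitrary: u)
  case 0
  then show ?case by (simp add: f_range)
next
  case (Suc k)
  have IH: "hit_approx S s m k v \<le> f v" for v
    using Suc.IH[of v] Suc.prems window_mono[of k "Suc k" S] by auto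
  show ?case
  proof (cases "u \<in> window S (Suc k) \<and> u \<noteq> s")
    case False
    then show ?thesis using f_range f_s by auto
  next
    case True
    show ?thesis
    proof (cases "u \<in> range x")
      case False
      then have "{i. x i = u} = {}" by auto
      then have "visits u = 0" by (simp add: visits_def)
      then show ?thesis using True by (simp add: total_deg_eq f_range)
    next
      case uv: True
      then have uD: "u \<in> D" using True Suc.prems by auto
      have "hit_approx S s m (Suc k) u = (\<Sum>v\<in>window S k. real (m u v) * hit_approx S s m k v) / visits u"
        using True by (simp add: total_deg_eq sum_divide_distrib)
      also have "(\<Sum>v\<in>window S k. real (m u v) * hit_approx S s m k v) \<le>
         (\<Sum>v\<in>window S k. real (m u v) * f v)"
        by (intro sum_mono mult_left_mono IH) auto
      also have "\<dots> \<le> (\<Sum>v\<in>window S k \<union> V. real (m u v) * f v)"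
        using f_range finV by (intro sum_mono2) (auto simp: finite_window countable_S)
      also have "\<dots> = (\<Sum>v\<in>V. real (m u v) * f v)"
        using finV m_out_V[OF uD] by (intro sum.mono_neutral_right) (auto simp: finite_window countable_S)
      also have "\<dots> = visits u * f u" using True uD by (intro f_harm) auto
      finally show ?thesis using visits_pos[OF uv] by (simp add: divide_right_mono)
    qed
  qed
qed

text \<open>
  Sum the increments of \<open>1 - f\<close> along the path until it has left \<open>D\<close> for good; they telescope to 1.
  Grouped by the current state, the increments at a state of \<open>D\<close> other than \<open>s\<close> cancel by
  harmonicity, those at \<open>s\<close> form the sum in question, and those outside \<open>D\<close> are not positive.
\<close>

lemma escape_flow: "1 \<le> (\<Sum>w\<in>V. real (m s w) * (1 - f w))"
proof -
  define e where "e v = 1 - f v" for v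
  have "finite (\<Union>u\<in>D. {i. x i = u})" using finD transient by auto
  then obtain N where N: "\<And>i. x i \<in> D \<Longrightarrow> i < N"
    using finite_nat_set_iff_bounded by (metis (mono_tags, lifting) UN_iff mem_Collect_eq)
  have "x N \<notin> D" using N by blast
  then have "1 = e (x N) - e (x 0)" using f_s f_out by (simp add: e_def)
  also have "\<dots> = (\<Sum>i<N. e (x (Suc i)) - e (x i))" using sum_lessThan_telescope[of "\<lambda>i. e (x i)" N] by simp
  also have "\<dots> \<le> (\<Sum>i<N. if x i \<in> D then e (x (Suc i)) - e (x i) else 0)"
    by (intro sum_mono) (use f_out f_range in \<open>auto simp: e_def\<close>)
  also have "\<dots> = (\<Sum>i\<in>{i. x i \<in> D}. e (x (Suc i)) - e (x i))"
    using N by (intro sum.mono_neutral_cong_right) auto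
  also have "\<dots> = (\<Sum>u\<in>D. \<Sum>i\<in>{i\<in>{i. x i \<in> D}. x i = u}. e (x (Suc i)) - e (x i))"
    using N finD by (intro sum.group[symmetric]) (auto simp: finite_nat_set_iff_bounded)
  also have "\<dots> = (\<Sum>u\<in>D. if u = s then \<Sum>w\<in>V. real (m s w) * e w else 0)"
  proof (rule sum.cong[OF refl])
    fix u assume u: "u \<in> D"
    have "(\<Sum>i\<in>{i\<in>{i. x i \<in> D}. x i = u}. e (x (Suc i)) - e (x i)) = (\<Sum>i\<in>{i. x i = u}. e (x (Suc i)) - e u)"
      using u by (intro sum.cong) auto
    also have "\<dots> = (\<Sum>v\<in>V. \<Sum>i\<in>{i\<in>{i. x i = u}. x (Suc i) = v}. e (x (Suc i)) - e u)"
      using transient finV succ_V u by (intro sum.group[symmetric]) auto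
    also have "\<dots> = (\<Sum>v\<in>V. real (m u v) * (e v - e u))"
      by (intro sum.cong refl) (simp add: num_trans_def)
    also have "\<dots> = (\<Sum>v\<in>V. real (m u v) * e v) - visits u * e u"
      using sum_num_trans_real[OF finV, of u] succ_V u
      by (simp add: right_diff_distrib sum_subtractf flip: sum_distrib_right)
    also have "\<dots> = (if u = s then \<Sum>w\<in>V. real (m s w) * e w else 0)"
    proof (cases "u = s")
      case False
      have "(\<Sum>v\<in>V. real (m u v) * e v) = visits u - visits u * f u"
        using sum_num_trans_real[OF finV, of u] succ_V u f_harm[OF u False]
        by (simp add: e_def right_diff_distrib sum_subtractf)
      then show ?thesis using False by (simp add: e_def algebra_simps)
    qed (simp add: e_def f_s)
    finally show "(\<Sum>i\<in>{i\<in>{i. x i \<in> D}. x i = u}. e (x (Suc i)) - e (x i)) =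
      (if u = s then \<Sum>w\<in>V. real (m s w) * e w else 0)" .
  qed
  also have "\<dots> = (\<Sum>w\<in>V. real (m s w) * e w)" using finD sD by simp
  finally show ?thesis by (simp add: e_def)
qed

end

end

section \<open>Convergence of the first step law along a transient path\<close>

text \<open>
  The law of the first step of a random trail with transitions \<open>T\<close> and core \<open>D\<close>, the analogue of
  \<open>step_prob\<close> at a finite time.
\<close>

definition core_step_prob :: "('a \<times> 'a) multiset \<Rightarrow> 'a set \<Rightarrow> 'a \<Rightarrow> 'a \<Rightarrow> real" where
  "core_step_prob T D s v =
     (if out_degree T s = 1 then real (count T (s, v))
      else (real (count T (s, v)) - exit_law (\<lambda>u v. real (count T (u, v))) D (snd ` set_mset T) s v)
             / (real (out_degree T s) - 1))"

context transient_path
begin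

lemma dead_less: "u \<in> dead n x \<Longrightarrow> x i = u \<Longrightarrow> i < n"
  by (auto simp: dead_def not_less[symmetric])

lemma dead_count: "u \<in> dead n x \<Longrightarrow> count (path_trans n x) (u, v) = m u v"
  unfolding count_path_trans num_trans_def using dead_less by (intro arg_cong[where f = card]) blast

lemma dead_out_degree: "u \<in> dead n x \<Longrightarrow> out_degree (path_trans n x) u = visits u"
  unfolding out_degree_path_trans visits_def using dead_less by (intro arg_cong[where f = card]) blast

lemma path_core_dead: "path_core n x \<subseteq> dead n x"
  by (simp add: path_core_def core_subset)

text \<open>
  Let \<open>t\<close> be the time of the last visit to \<open>u\<close>. The states whose last visit is at time \<open>t\<close> or earlier form a
  set closed under passing to descendants, as last exits lead to later last visits, and all of them
  are dead once every state seen up to time \<open>t\<close> is.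
\<close>

lemma eventually_in_path_core:
  assumes u: "u \<in> range x"
  shows "eventually (\<lambda>n. u \<in> path_core n x) sequentially"
proof -
  define t where "t = last_visit u"
  define A where "A = x ` {..t}"
  have xt: "x t = u" using last_visit(1)[OF u] by (simp add: t_def)
  have "finite (\<Union>v\<in>A. {i. x i = v})" using transient by (auto simp: A_def)
  then obtain N where N: "\<And>k. x k \<in> A \<Longrightarrow> k < N"
    using finite_nat_set_iff_bounded by (metis (mono_tags, lifting) UN_iff mem_Collect_eq)
  have "t < N" using N[of t] by (auto simp: A_def)
  define C where "C = {v \<in> A. \<forall>k>t. x k \<noteq> v}"
  have "u \<in> path_core n x" if n: "n \<ge> N" for n
  proof -
    have "C \<subseteq> path_core n x" unfolding path_core_def
    proof (rule core_greatest)
      have late: "x k \<noteq> w" if "w \<in> A" "k \<ge> n" for w k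
        using N[of k] that n by auto
      then show "C \<subseteq> dead n x"
        using \<open>t < N\<close> n by (fastforce simp: C_def dead_def A_def)
      fix v assume v: "v \<in> tree_vertices (path_trans n x) (x n)" "v \<notin> C"
      define i where "i = Max {j. j < n \<and> x j = v}"
      have ne: "{j. j < n \<and> x j = v} \<noteq> {}"
        using v(1) by (auto simp: tree_vertices_def sources_path_trans)
      have i: "i < n" "x i = v" using Max_in[OF _ ne] by (auto simp: i_def)
      have imax: "j \<le> i" if "j < n" "x j = v" for j using that by (auto simp: i_def intro!: Max_ge)
      have "last_exit_tree (path_trans n x) s (x n) (word n x) v = x (Suc i)"
        using v(1) last_exit_path[of i n x v] i imax by (force simp: last_exit_tree_def)
      \<comment> \<open>If i is at least t, then x (Suc i) is visited after t. Otherwise v itself was seen before t and is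
         visited after t, not being in C. That visit is not before n by the choice of i, and not later,
         because by then all states seen up to time t are dead.\<close>
      moreover have "x (Suc i) \<notin> C"
      proof (cases "t \<le> i")
        case True
        then show ?thesis by (auto simp: C_def intro!: exI[of _ "Suc i"])
      next
        case False
        then have "v \<in> A" using i by (auto simp: A_def)
        then obtain k where k: "k > t" "x k = v" using v(2) by (auto simp: C_def)
        then have "\<not> k < n" using imax[of k] False by auto
        then show ?thesis using late[OF \<open>v \<in> A\<close>, of k] k by auto
      qed
      ultimately show "last_exit_tree (path_trans n x) s (x n) (word n x) v \<notin> C" by simp
    qed
    moreover have "u \<in> C"
    proof -
      have "x t \<in> A" by (simp add: A_def)
      moreover have "x k \<noteq> u" if "k > t" for k
        using last_visit(2)[OF u, of k] that by (auto simp: t_def)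
      ultimately show ?thesis using xt by (simp add: C_def)
    qed
    ultimately show ?thesis by blast
  qed
  then show ?thesis by (auto simp: eventually_sequentially)
qed

definition core_hit :: "nat \<Rightarrow> 'a \<Rightarrow> real" where
  "core_hit n = hit_prob (\<lambda>u v. real (count (path_trans n x) (u, v))) (path_core n x) (x ` {1..n}) s"

text \<open>
  The last exits of the path itself form a forest of positive weight.
\<close>

lemma forest_total_path_pos:
  assumes "E \<subseteq> tree_vertices (path_trans n x) (x n)"
  shows "forest_total (\<lambda>u v. real (count (path_trans n x) (u, v))) E (x ` {1..n}) > 0"
proof -
  let ?T = "path_trans n x"
  let ?M = "\<lambda>u v. real (count ?T (u, v))"
  let ?V = "x ` {1..n}"
  define l where "l = last_exit_tree ?T s (x n) (word n x)"
  have l: "l \<in> forests (tree_vertices ?T (x n)) ?V"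
    unfolding l_def snd_path_trans[symmetric] by (rule last_exit_tree_in_forests[OF word_in_trails])
  have finE: "finite E" by (rule finite_subset[OF assms finite_tree_vertices])
  have "leads (restrict l E) E (- E) u" for u
  proof -
    have "leads l (tree_vertices ?T (x n)) (- tree_vertices ?T (x n)) u" using l by (simp add: forests_def)
    then have "leads l E (- E) u" using assms by (rule leads_exit_mono)
    then show ?thesis by (rule leads_cong_imp) auto
  qed
  moreover have "restrict l E \<in> E \<rightarrow>\<^sub>E ?V" using l assms by (auto simp: forests_def PiE_def Pi_def)
  ultimately have mem: "restrict l E \<in> forests E ?V" unfolding forests_def by blast
  have "0 < forest_weight ?M E (restrict l E)"
    unfolding forest_weight_def
  proof (rule prod_pos)
    fix u assume u: "u \<in> E"
    then have "u \<in> tree_vertices ?T (x n)" using assms by auto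
    then show "0 < ?M u (restrict l E u)"
      using u count_last_exit_pos[of u s "word n x"]
      by (simp add: l_def last_exit_tree_def tree_vertices_def path_trans_def)
  qed
  also have "\<dots> \<le> forest_total ?M E ?V"
    unfolding forest_total_def
    by (rule member_le_sum[OF mem]) (auto simp: finite_forests forest_weight_nonneg finE)
  finally show ?thesis .
qed

context
  fixes n :: nat
  assumes s_core: "s \<in> path_core n x"
begin

lemma core_sub_tree: "path_core n x \<subseteq> tree_vertices (path_trans n x) (x n)"
  by (rule subset_trans[OF path_core_dead dead_subset])

lemma finite_path_core: "finite (path_core n x)"
  by (rule finite_subset[OF core_sub_tree finite_tree_vertices])

lemma core_total: "forest_total (\<lambda>u v. real (count (path_trans n x) (u, v))) (path_core n x - {s}) (x ` {1..n}) \<noteq> 0"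
proof -
  have "path_core n x - {s} \<subseteq> tree_vertices (path_trans n x) (x n)" using core_sub_tree by blast
  from forest_total_path_pos[OF this] show ?thesis by simp
qed

lemma core_succ: "x i \<in> path_core n x \<Longrightarrow> x (Suc i) \<in> x ` {1..n}"
  using dead_less[of "x i" n i] path_core_dead[of n] by (intro imageI) auto

lemmas core_hit_facts =
  hit_prob_range[OF finite_path_core _ _ core_total, folded core_hit_def]
  hit_prob_self[OF finite_path_core _ _ core_total, folded core_hit_def]
  hit_prob_outside[OF finite_path_core _ _ core_total, folded core_hit_def]

lemma core_hit_range: "0 \<le> core_hit n u" "core_hit n u \<le> 1"
  using core_hit_facts(1,2) by auto

lemma core_hit_self: "core_hit n s = 1"
  using core_hit_facts(3) by auto

lemma core_hit_out: "u \<notin> path_core n x \<Longrightarrow> core_hit n u = 0"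
  using core_hit_facts(4)[of u] s_core by auto

lemma core_hit_harmonic:
  assumes "u \<in> path_core n x" "u \<noteq> s"
  shows "(\<Sum>v\<in>x ` {1..n}. real (m u v) * core_hit n v) = visits u * core_hit n u"
proof -
  have c: "count (path_trans n x) (u, v) = m u v" for v
    by (rule dead_count[OF subsetD[OF path_core_dead assms(1)]])
  have "(\<Sum>v\<in>x ` {1..n}. real (m u v)) = visits u"
  proof (rule sum_num_trans_real)
    fix i assume "x i = u"
    then show "x (Suc i) \<in> x ` {1..n}" using core_succ[of i] assms(1) by simp
  qed simp
  then show ?thesis
    using hit_prob_harmonic[OF finite_path_core _ _ core_total assms, folded core_hit_def]
    by (simp add: c)
qed

lemma core_range: "path_core n x \<subseteq> range x"
  by (rule subset_trans[OF path_core_dead]) (auto simp: dead_def)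

lemmas core_dirichlet = finite_imageI[OF finite_atLeastAtMost] finite_path_core core_range s_core core_succ
  core_hit_range core_hit_self core_hit_out core_hit_harmonic

lemma core_hit_le: "core_hit n u \<le> hit_lim S s m u"
  by (rule dirichlet_le_hit_lim[OF core_dirichlet])

lemma core_hit_ge: "window S k \<inter> range x \<subseteq> path_core n x \<Longrightarrow> hit_approx S s m k u \<le> core_hit n u"
  by (rule hit_approx_le_dirichlet[OF core_dirichlet])

lemma core_exit_sum: "(\<Sum>w\<in>x ` {1..n}. real (m s w) * (1 - core_hit n w)) = (\<Sum>w\<in>successors s. real (m s w) * (1 - core_hit n w))"
proof (rule sum.mono_neutral_right)
  show "successors s \<subseteq> x ` {1..n}"
  proof
    fix w assume "w \<in> successors s"
    then obtain i where "x i = s" "w = x (Suc i)" by (auto simp: successors_def)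
    then show "w \<in> x ` {1..n}" using core_succ[of i] s_core by simp
  qed
qed (simp_all add: successors(4))

lemma core_escape: "1 \<le> (\<Sum>w\<in>successors s. real (m s w) * (1 - core_hit n w))"
  unfolding core_exit_sum[symmetric] by (rule escape_flow[OF core_dirichlet])

lemma core_exit_law:
  "exit_law (\<lambda>u v. real (count (path_trans n x) (u, v))) (path_core n x) (x ` {1..n}) s v =
    real (m s v) * (1 - core_hit n v) / (\<Sum>w\<in>successors s. real (m s w) * (1 - core_hit n w))"
proof -
  let ?M = "\<lambda>u v. real (count (path_trans n x) (u, v))"
  let ?V = "x ` {1..n}" and ?D = "path_core n x"
  have c: "count (path_trans n x) (s, v) = m s v" for v
    by (rule dead_count[OF subsetD[OF path_core_dead s_core]])
  have fin: "finite ?V" by simp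
  have tot: "forest_total ?M ?D ?V = forest_total ?M (?D - {s}) ?V * (\<Sum>w\<in>successors s. real (m s w) * (1 - core_hit n w))"
    using forest_total_eq[OF finite_path_core fin _ core_total s_core, folded core_hit_def]
    by (simp only: c core_exit_sum of_nat_0_le_iff)
  show ?thesis
  proof (cases "v \<in> ?V")
    case True
    then show ?thesis
      unfolding exit_law_def tot
      using forest_step_weight[OF finite_path_core fin _ core_total s_core True, folded core_hit_def] core_total
      by (simp add: c)
  next
    case False
    have "l s \<noteq> v" if "l \<in> forests ?D ?V" for l
    proof -
      have "l \<in> ?D \<rightarrow>\<^sub>E ?V" using that by (simp add: forests_def)
      then have "l s \<in> ?V" using s_core by (rule PiE_mem)
      then show ?thesis using False by blast
    qed
    then have "exit_law ?M ?D ?V s v = 0" by (auto simp: exit_law_def intro!: sum.neutral)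
    moreover have "m s v = 0" using False s_core by (intro num_trans_eq_0) (metis core_succ)
    ultimately show ?thesis by simp
  qed
qed

lemma core_step_prob_eq:
  "core_step_prob (path_trans n x) (path_core n x) s v =
    (if visits s = 1 then real (m s v)
     else (real (m s v) - real (m s v) * (1 - core_hit n v) / (\<Sum>w\<in>successors s. real (m s w) * (1 - core_hit n w)))
        / (real (visits s) - 1))"
  unfolding core_step_prob_def snd_path_trans core_exit_law
  by (simp add: dead_count[OF subsetD[OF path_core_dead s_core]] dead_out_degree[OF subsetD[OF path_core_dead s_core]])

lemma core_step_prob_range:
  "0 \<le> core_step_prob (path_trans n x) (path_core n x) s v"
  "core_step_prob (path_trans n x) (path_core n x) s v \<le> 3"
proof -
  define q where "q = real (m s v) * (1 - core_hit n v) / (\<Sum>w\<in>successors s. real (m s w) * (1 - core_hit n w))"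
  have q0: "0 \<le> q" using core_hit_range core_escape by (auto simp: q_def intro!: divide_nonneg_pos)
  have q1: "q \<le> 1 \<and> (m s v = 0 \<longrightarrow> q = 0)"
  proof (cases "v \<in> successors s")
    case True
    then have "real (m s v) * (1 - core_hit n v) \<le> (\<Sum>w\<in>successors s. real (m s w) * (1 - core_hit n w))"
      using core_hit_range successors(1) by (intro member_le_sum) auto
    then show ?thesis using core_escape by (auto simp: q_def divide_le_eq_1)
  qed (simp add: q_def successors(4))
  have mv: "real (m s v) \<le> visits s" using sum_num_trans_le[of "{v}" s] by simp
  have vs: "visits s \<ge> 1" using visits_pos[of s] by simp
  have mq: "0 \<le> real (m s v) - q" using q1 by (cases "m s v = 0") auto
  have eq: "core_step_prob (path_trans n x) (path_core n x) s v =
    (if visits s = 1 then real (m s v) else (real (m s v) - q) / (real (visits s) - 1))"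
    by (simp add: core_step_prob_eq q_def)
  show "0 \<le> core_step_prob (path_trans n x) (path_core n x) s v"
    unfolding eq using mq vs by auto
  have "real (m s v) - q \<le> 3 * (real (visits s) - 1)" if "visits s \<noteq> 1"
  proof -
    have "real (visits s) \<ge> 2" using that vs by simp
    moreover have "b - c \<le> 3 * (a - 1)" if "2 \<le> a" "b \<le> a" "0 \<le> c" for a b c :: real
    proof -
      have "b - c \<le> a" "a \<le> 3 * a - 3" using that by simp_all
      then have "b - c \<le> 3 * a - 3" by (rule order_trans)
      then show ?thesis by (simp add: right_diff_distrib)
    qed
    ultimately show ?thesis using mv q0 by blast
  qed
  then show "core_step_prob (path_trans n x) (path_core n x) s v \<le> 3"
    unfolding eq using mv vs by (auto simp: divide_le_eq)
qed

end

lemma eventually_s_core: "eventually (\<lambda>n. s \<in> path_core n x) sequentially"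
  by (rule eventually_in_path_core) auto

lemma core_hit_tendsto: "(\<lambda>n. core_hit n u) \<longlonglongrightarrow> hit_lim S s m u"
proof (rule order_tendstoI)
  fix a assume "a < hit_lim S s m u"
  then have "eventually (\<lambda>k. a < hit_approx S s m k u) sequentially"
    by (rule order_tendstoD(1)[OF hit_approx_tendsto])
  then obtain k where k: "a < hit_approx S s m k u" by (auto simp: eventually_sequentially)
  have "eventually (\<lambda>n. \<forall>v\<in>window S k \<inter> range x. v \<in> path_core n x) sequentially"
    using finite_window[OF countable_S] eventually_in_path_core by (intro eventually_ball_finite) auto
  with eventually_s_core show "eventually (\<lambda>n. a < core_hit n u) sequentially"
  proof eventually_elim
    case (elim n)
    then have "window S k \<inter> range x \<subseteq> path_core n x" by blast
    from core_hit_ge[OF elim(1) this, of u] k show ?case by simp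
  qed
next
  fix a assume a: "hit_lim S s m u < a"
  show "eventually (\<lambda>n. core_hit n u < a) sequentially"
    using eventually_s_core
  proof eventually_elim
    case (elim n)
    from core_hit_le[OF elim, of u] a show ?case by simp
  qed
qed

text \<open>
  The cores exhaust the visited states, so the solutions of the Dirichlet problems on the cores tend
  to the hitting probabilities of the infinite graph; the normalising sums are finite sums bounded
  below by 1.
\<close>

theorem core_step_prob_tendsto:
  "(\<lambda>n. core_step_prob (path_trans n x) (path_core n x) s v) \<longlonglongrightarrow> step_prob S s m v"
proof -
  define E where "E n = (\<Sum>w\<in>successors s. real (m s w) * (1 - core_hit n w))" for n
  define E' where "E' = (\<Sum>w\<in>successors s. real (m s w) * (1 - hit_lim S s m w))"
  have E: "E \<longlonglongrightarrow> E'" unfolding E_def E'_def by (intro tendsto_intros core_hit_tendsto)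
  have "eventually (\<lambda>n. 1 \<le> E n) sequentially"
    using eventually_s_core by eventually_elim (auto simp: E_def core_escape)
  then have "1 \<le> E'" using E by (intro tendsto_lowerbound[OF E]) auto
  then have "E' \<noteq> 0" by auto
  define p where "p = (if visits s = 1 then real (m s v)
     else (real (m s v) - real (m s v) * (1 - hit_lim S s m v) / E') / (real (visits s) - 1))"
  have "(\<lambda>n. if visits s = 1 then real (m s v)
     else (real (m s v) - real (m s v) * (1 - core_hit n v) / E n) / (real (visits s) - 1)) \<longlonglongrightarrow> p"
  proof (cases "visits s = 1")
    case False
    then have "real (visits s) - 1 \<noteq> 0" by simp
    then have "(\<lambda>n. (real (m s v) - real (m s v) * (1 - core_hit n v) / E n) / (real (visits s) - 1))
       \<longlonglongrightarrow> (real (m s v) - real (m s v) * (1 - hit_lim S s m v) / E') / (real (visits s) - 1)"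
      using \<open>E' \<noteq> 0\<close> by (intro tendsto_intros core_hit_tendsto E)
    then show ?thesis using False by (simp add: p_def)
  qed (simp add: p_def)
  moreover have ev: "eventually (\<lambda>n. core_step_prob (path_trans n x) (path_core n x) s v =
    (if visits s = 1 then real (m s v)
     else (real (m s v) - real (m s v) * (1 - core_hit n v) / E n) / (real (visits s) - 1))) sequentially"
    using eventually_s_core by eventually_elim (simp add: core_step_prob_eq E_def)
  ultimately have lim: "(\<lambda>n. core_step_prob (path_trans n x) (path_core n x) s v) \<longlonglongrightarrow> p"
    by (subst tendsto_cong[OF ev])
  have "0 \<le> p"
    by (rule tendsto_lowerbound[OF lim]) (use eventually_s_core in \<open>auto elim!: eventually_mono simp: core_step_prob_range\<close>)
  moreover have "p \<le> 3"
    by (rule tendsto_upperbound[OF lim]) (use eventually_s_core in \<open>auto elim!: eventually_mono simp: core_step_prob_range\<close>)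
  moreover have "(\<integral>w. real (m s w) * (1 - hit_lim S s m w) \<partial>count_space S) = E'"
    unfolding E'_def using successors by (intro integral_num_trans) auto
  then have "step_prob S s m v = max 0 (min 3 p)"
    by (simp add: step_prob_def exit_prob_def total_deg_eq p_def)
  ultimately have "step_prob S s m v = p" by simp
  then show ?thesis using lim by simp
qed

end

section \<open>Measurability and the path space\<close>

lemma borel_measurable_integral_count_space:
  fixes f :: "'w \<Rightarrow> 'a \<Rightarrow> real"
  assumes "countable S" "\<And>v. v \<in> S \<Longrightarrow> (\<lambda>w. f w v) \<in> borel_measurable N"
  shows "(\<lambda>w. \<integral>v. f w v \<partial>count_space S) \<in> borel_measurable N"
proof -
  interpret sigma_finite_measure "count_space S"
    by (rule sigma_finite_measure_count_space_countable[OF assms(1)])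
  have "(\<lambda>(v, w). f w v) \<in> borel_measurable (count_space S \<Otimes>\<^sub>M N)"
    by (rule measurable_pair_measure_countable1) (use assms in auto)
  from measurable_pair_swap[OF this] have "case_prod f \<in> borel_measurable (N \<Otimes>\<^sub>M count_space S)"
    by (simp add: case_prod_unfold)
  then show ?thesis by (rule borel_measurable_lebesgue_integral)
qed

context
  fixes S :: "'a set" and m :: "'w \<Rightarrow> 'a \<Rightarrow> 'a \<Rightarrow> nat" and N :: "'w measure"
  assumes cS: "countable S"
    and m_meas: "\<And>u v. u \<in> S \<Longrightarrow> v \<in> S \<Longrightarrow> (\<lambda>w. real (m w u v)) \<in> borel_measurable N"
begin

lemma measurable_total_deg: "u \<in> S \<Longrightarrow> (\<lambda>w. total_deg S (m w) u) \<in> borel_measurable N"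
  unfolding total_deg_def by (intro borel_measurable_integral_count_space cS m_meas)

lemma measurable_hit_approx: "(\<lambda>w. hit_approx S s (m w) k u) \<in> borel_measurable N"
proof (induction k arbitrary: u)
  case (Suc k)
  show ?case
  proof (cases "u \<in> window S (Suc k) \<and> u \<noteq> s")
    case True
    then have u: "u \<in> S" by (simp add: window_def)
    have "(\<lambda>w. \<Sum>v\<in>window S k. real (m w u v) / total_deg S (m w) u * hit_approx S s (m w) k v) \<in> borel_measurable N"
      by (intro borel_measurable_sum borel_measurable_times borel_measurable_divide Suc m_meas measurable_total_deg u)
         (simp add: window_def)
    then show ?thesis using True by simp
  next
    case False
    then have "hit_approx S s (m w) (Suc k) u = (if u \<in> window S (Suc k) then 1 else 0)" for w
      by auto
    then show ?thesis by (simp del: hit_approx.simps)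
  qed
qed simp

lemma measurable_hit_lim: "(\<lambda>w. hit_lim S s (m w) u) \<in> borel_measurable N"
  unfolding hit_lim_def by (intro borel_measurable_lim_metric measurable_hit_approx)

lemma measurable_step_prob:
  assumes "s \<in> S" "v \<in> S"
  shows "(\<lambda>w. step_prob S s (m w) v) \<in> borel_measurable N"
proof -
  have [measurable]: "(\<lambda>w. total_deg S (m w) s) \<in> borel_measurable N"
    using assms by (intro measurable_total_deg)
  have [measurable]: "(\<lambda>w. real (m w s v)) \<in> borel_measurable N"
    using assms by (intro m_meas)
  have [measurable]: "(\<lambda>w. exit_prob S s (m w) v) \<in> borel_measurable N"
    unfolding exit_prob_def
    by (intro borel_measurable_divide borel_measurable_times borel_measurable_diff borel_measurable_const
        measurable_hit_lim m_meas borel_measurable_integral_count_space cS assms)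
  show ?thesis unfolding step_prob_def by measurable
qed

end

definition path_space :: "'a set \<Rightarrow> (nat \<Rightarrow> 'a) measure" where
  "path_space S = PiM UNIV (\<lambda>_. count_space S)"

definition shift :: "nat \<Rightarrow> (nat \<Rightarrow> 'a) \<Rightarrow> nat \<Rightarrow> 'a" where
  "shift n x i = x (i + n)"

definition cylinder :: "'a set \<Rightarrow> 'a list \<Rightarrow> (nat \<Rightarrow> 'a) set" where
  "cylinder S zs = {x \<in> space (path_space S). map x [0..<length zs] = zs}"

lemma space_path_space: "space (path_space S) = {x. \<forall>i. x i \<in> S}"
  by (auto simp: path_space_def space_PiM PiE_def Pi_def)

lemma measurable_coord: "(\<lambda>x. x i) \<in> measurable (path_space S) (count_space S)"
  unfolding path_space_def by (rule measurable_component_singleton) simp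

lemma pred_coord: "Measurable.pred (path_space S) (\<lambda>x. x i = a)"
proof -
  have "{x \<in> space (path_space S). x i = a} = (\<lambda>x. x i) -` ({a} \<inter> S) \<inter> space (path_space S)"
    by (auto simp: space_path_space)
  also have "\<dots> \<in> sets (path_space S)"
    by (rule measurable_sets[OF measurable_coord]) auto
  finally show ?thesis by (simp add: pred_def)
qed

lemma measurable_shift [measurable]: "shift n \<in> measurable (path_space S) (path_space S)"
  unfolding path_space_def shift_def
  by (rule measurable_PiM_single') (auto simp: space_PiM PiE_def Pi_def)

lemma prefix_eq_iff: "map x [0..<length zs] = zs \<longleftrightarrow> (\<forall>i<length zs. x i = zs ! i)"
proof -
  have "map x [0..<length zs] = zs \<longleftrightarrow> (\<forall>i<length zs. map x [0..<length zs] ! i = zs ! i)"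
    by (subst list_eq_iff_nth_eq) (simp only: length_map length_upt minus_nat.diff_0 simp_thms)
  then show ?thesis by simp
qed

lemma pred_prefix: "Measurable.pred (path_space S) (\<lambda>x. map x [0..<length zs] = zs)"
  unfolding prefix_eq_iff by (intro pred_intros_countable pred_intros_logic pred_coord) simp

lemma cylinder_sets: "cylinder S zs \<in> sets (path_space S)"
  using pred_prefix unfolding cylinder_def pred_def by auto

lemma sets_path_space_eq:
  assumes "countable S"
  shows "sets (path_space S) = sigma_sets (space (path_space S)) (insert {} (range (cylinder S)))"
    (is "_ = sigma_sets ?\<Omega> ?E")
proof
  interpret E: sigma_algebra ?\<Omega> "sigma_sets ?\<Omega> ?E"
    by (rule sigma_algebra_sigma_sets) (auto simp: cylinder_def)
  have "sets (path_space S) = sigma_sets ?\<Omega> {{f\<in>?\<Omega>. f i \<in> A} |i A. i \<in> UNIV \<and> A \<in> sets (count_space S)}"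
    unfolding path_space_def sets_PiM_single space_PiM ..
  also have "\<dots> \<subseteq> sigma_sets ?\<Omega> ?E"
  proof (rule E.sigma_sets_subset, safe)
    fix i A assume "A \<in> sets (count_space S)"
    have "{f\<in>?\<Omega>. f i \<in> A} = (\<Union>zs\<in>{zs\<in>lists S. length zs = Suc i \<and> zs ! i \<in> A}. cylinder S zs)"
    proof (safe)
      fix f assume "f \<in> ?\<Omega>" "f i \<in> A"
      then show "f \<in> (\<Union>zs\<in>{zs\<in>lists S. length zs = Suc i \<and> zs ! i \<in> A}. cylinder S zs)"
        by (intro UN_I[of "map f [0..<Suc i]"]) (auto simp: cylinder_def space_path_space nth_append)
    next
      fix f zs assume *: "f \<in> cylinder S zs" "length zs = Suc i" "zs ! i \<in> A"
      then show "f \<in> ?\<Omega>" by (simp add: cylinder_def)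
      have "map f [0..<length zs] ! i = f i" using *(2) by (simp del: upt_Suc)
      then show "f i \<in> A" using * by (simp add: cylinder_def)
    qed
    also have "\<dots> \<in> sigma_sets ?\<Omega> ?E"
      using assms by (intro E.countable_UN'') (auto intro: countable_subset[OF _ countable_lists[OF assms]])
    finally show "{f\<in>?\<Omega>. f i \<in> A} \<in> sigma_sets ?\<Omega> ?E" .
  qed
  finally show "sets (path_space S) \<subseteq> sigma_sets ?\<Omega> ?E" .
  show "sigma_sets ?\<Omega> ?E \<subseteq> sets (path_space S)"
    by (rule sets.sigma_sets_subset) (auto simp: cylinder_sets)
qed

lemma cylinder_Int: "cylinder S ys \<inter> cylinder S zs \<in> insert {} (range (cylinder S))"
proof -
  have *: "cylinder S ys \<inter> cylinder S zs \<in> {{}, cylinder S zs}" if "length ys \<le> length zs" for ys zs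
  proof (cases "take (length ys) zs = ys")
    case True
    have "map x [0..<length ys] = ys" if "map x [0..<length zs] = zs" for x
    proof -
      have "take (length ys) (map x [0..<length zs]) = map x [0..<length ys]"
        using \<open>length ys \<le> length zs\<close> by (simp add: take_map)
      then show ?thesis using that True by simp
    qed
    then show ?thesis by (auto simp: cylinder_def)
  next
    case False
    have "take (length ys) zs = ys" if "map x [0..<length zs] = zs" "map x [0..<length ys] = ys" for x
    proof -
      have "take (length ys) (map x [0..<length zs]) = map x [0..<length ys]"
        using \<open>length ys \<le> length zs\<close> by (simp add: take_map)
      then show ?thesis using that by simp
    qed
    then show ?thesis using False by (auto simp: cylinder_def)
  qed
  show ?thesis using *[of ys zs] *[of zs ys] by (cases "length ys \<le> length zs") (auto simp: Int_commute)
qed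

text \<open>
  Cylinders of prefixes are closed under intersection up to the empty set, since two of them are nested
  or disjoint.
\<close>

lemma path_measure_eqI:
  assumes "countable S" "sets M = sets (path_space S)" "sets N = sets (path_space S)"
    and "finite_measure M" and eq: "\<And>zs. emeasure M (cylinder S zs) = emeasure N (cylinder S zs)"
  shows "M = N"
proof (rule measure_eqI_generator_eq[where E = "insert {} (range (cylinder S))" and \<Omega> = "space (path_space S)"
      and A = "\<lambda>_. cylinder S []"])
  show "Int_stable (insert {} (range (cylinder S)))"
    using cylinder_Int by (intro Int_stableI) blast
  interpret finite_measure M by fact
  show "emeasure M (cylinder S []) \<noteq> \<infinity>" by simp
  show "(\<Union>i. cylinder S []) = space (path_space S)" by (auto simp: cylinder_def)
  show "insert {} (range (cylinder S)) \<subseteq> Pow (space (path_space S))" by (auto simp: cylinder_def)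
  show "emeasure M X = emeasure N X" if "X \<in> insert {} (range (cylinder S))" for X
    using that eq by auto
qed (use assms in \<open>auto simp: sets_path_space_eq\<close>)

lemma shift_0 [simp]: "shift 0 x = x"
  by (simp add: shift_def fun_eq_iff)

lemma shift_shift: "shift n (shift k x) = shift (n + k) x"
  by (simp add: shift_def fun_eq_iff add.assoc)

lemma word_eq_iff: "word n x = ys \<longleftrightarrow> length ys = n \<and> (\<forall>i<n. x (Suc i) = ys ! i)"
  by (auto simp: word_def list_eq_iff_nth_eq simp del: upt_Suc)

lemma pred_word: "Measurable.pred (path_space S) (\<lambda>x. word n x = ys)"
  unfolding word_eq_iff by (intro pred_intros_countable pred_intros_logic pred_coord) simp_all

lemma word_sets: "{x \<in> space (path_space S). word n x = ys} \<in> sets (path_space S)"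
  using pred_word[of n ys S] unfolding pred_def .

text \<open>
  Equal transitions force equal end points: the end point is the vertex where in- and out-degrees are
  out of balance.
\<close>

lemma trans_mset_eq_last:
  assumes "trans_mset s ys = trans_mset s ys'"
  shows "last (s # ys) = last (s # ys')"
proof -
  have 1: "balanced (trans_mset s ys) s (last (s # ys))" by (rule balanced_trans_mset)
  have 2: "balanced (trans_mset s ys) s (last (s # ys'))"
    unfolding assms by (rule balanced_trans_mset)
  have "(if u = last (s # ys) then 1 else 0) = (if u = last (s # ys') then 1 else (0::nat))" for u
    using 1[unfolded balanced_def, THEN spec, of u] 2[unfolded balanced_def, THEN spec, of u]
    by (rule add_left_imp_eq[OF trans[OF _ sym]])
  from this[of "last (s # ys)"] show ?thesis by (simp only: simp_thms if_True if_False split: if_splits)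
qed

lemma trans_mset_eq_length: "trans_mset s ys = trans_mset s ys' \<Longrightarrow> length ys = length ys'"
  by (metis size_trans_mset)

lemma trans_mset_eq_set: "trans_mset s ys = trans_mset s ys' \<Longrightarrow> set ys = set ys'"
  by (metis snd_trans_mset)

lemma integral_eq_0_by_countable_partition:
  fixes f :: "'w \<Rightarrow> real"
  assumes I: "countable I" and K: "\<And>x. x \<in> space M \<Longrightarrow> K x \<in> I"
    and K_sets: "\<And>i. i \<in> I \<Longrightarrow> {x \<in> space M. K x = i} \<in> sets M"
    and f: "integrable M f"
    and zero: "\<And>i. i \<in> I \<Longrightarrow> (\<integral>x. indicator {x \<in> space M. K x = i} x * f x \<partial>M) = 0"
  shows "(\<integral>x. f x \<partial>M) = 0"
proof -
  define A where "A j = {x \<in> space M. to_nat_on I (K x) = j}" for j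
  have A: "A j \<in> sets M \<and> (\<integral>x. indicator (A j) x * f x \<partial>M) = 0" for j
  proof (cases "j \<in> to_nat_on I ` I")
    case True
    then obtain i where i: "i \<in> I" "j = to_nat_on I i" by auto
    have "to_nat_on I k = j \<longleftrightarrow> k = i" if "k \<in> I" for k
      using inj_on_to_nat_on[OF I] that i by (auto dest: inj_onD)
    then have "A j = {x \<in> space M. K x = i}" using K by (auto simp: A_def)
    then show ?thesis using K_sets zero i by simp
  next
    case False
    then have "A j = {}" using K by (auto simp: A_def)
    then show ?thesis by simp
  qed
  have UA: "(\<Union>j. A j) = space M" by (auto simp: A_def)
  have "(\<integral>x. f x \<partial>M) = (LINT x:(\<Union>j. A j)|M. f x)"
    unfolding UA by (simp add: set_integral_space f)
  also have "\<dots> = (\<Sum>j. (LINT x:(A j)|M. f x))"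
  proof (rule lebesgue_integral_countable_add)
    show "set_integrable M (\<Union>j. A j) f" unfolding UA
      using integrable_mult_indicator[OF sets.top f] by (simp add: set_integrable_def)
  qed (use A in \<open>auto simp: A_def\<close>)
  also have "\<dots> = 0" using A by (simp add: set_lebesgue_integral_def)
  finally show ?thesis .
qed

section \<open>The law of the first step\<close>

text \<open>
  The deviation of the first step of the trail \<open>ys\<close> from the law predicted by its core, where \<open>B\<close> is
  the set of dead states. It is set to 0 when \<open>s\<close> is not in the core.
\<close>

definition trail_defect :: "'a \<Rightarrow> 'a \<Rightarrow> 'a list \<Rightarrow> 'a set \<Rightarrow> real" where
  "trail_defect s v ys B =
    (let T = trans_mset s ys; z = last (s # ys);
         D = core (tree_vertices T z) B (last_exit_tree T s z ys)
     in of_bool (s \<in> D) * (of_bool (ys \<noteq> [] \<and> hd ys = v) - core_step_prob T D s v))"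

text \<open>
  If \<open>s\<close> is left only once, the transitions determine the first step and each summand vanishes;
  otherwise \<open>sum_trails_first_step\<close> applies.
\<close>

lemma sum_trail_defect:
  assumes B: "B \<subseteq> tree_vertices T z"
  shows "(\<Sum>ys\<in>trails T s z. trail_defect s v ys B) = 0"
proof -
  define d where "d = out_degree T s"
  define D where "D ys = core (tree_vertices T z) B (last_exit_tree T s z ys)" for ys
  have td: "trail_defect s v ys B = of_bool (s \<in> D ys) * (of_bool (ys \<noteq> [] \<and> hd ys = v) - core_step_prob T (D ys) s v)"
    if "ys \<in> trails T s z" for ys
    using that by (auto simp: trail_defect_def D_def trails_def Let_def simp del: last.simps)
  show ?thesis
  proof (cases "d = 1")
    case True
    have "trail_defect s v ys B = 0" if ys: "ys \<in> trails T s z" for ys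
    proof (cases "s \<in> D ys")
      case sD: True
      then have "s \<in> sources T" using B core_subset[of "tree_vertices T z" B] by (auto simp: D_def tree_vertices_def)
      then have "ys \<noteq> []" using ys by (auto simp: trails_def sources_def)
      then obtain w ws where w: "ys = w # ws" by (cases ys) auto
      have T: "T = add_mset (s, w) (trans_mset w ws)" using ys by (auto simp: trails_def w)
      have "out_degree (trans_mset w ws) s = 0" using True by (simp add: d_def T out_degree_def)
      then have "s \<notin> sources (trans_mset w ws)" using out_degree_pos[of "trans_mset w ws" s] by simp
      then have "count (trans_mset w ws) (s, v) = 0" by (force simp: sources_def count_eq_zero_iff)
      then have "count T (s, v) = of_bool (w = v)" by (auto simp: T)
      then show ?thesis using True unfolding td[OF ys] by (simp add: core_step_prob_def d_def w)
    qed (simp add: td[OF ys])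
    then show ?thesis by simp
  next
    case False
    have "(\<Sum>ys\<in>trails T s z. trail_defect s v ys B) = (\<Sum>ys\<in>trails T s z. of_bool (s \<in> D ys) *
      ((real d - 1) * of_bool (ys \<noteq> [] \<and> hd ys = v) - (real (count T (s, v))
          - exit_law (\<lambda>u v. real (count T (u, v))) (D ys) (snd ` set_mset T) s v))) / (real d - 1)"
      unfolding sum_divide_distrib using False
      by (intro sum.cong refl) (simp add: td core_step_prob_def d_def diff_divide_distrib)
    also have "\<dots> = 0"
      using sum_trails_first_step[OF B, of s v] by (simp add: D_def d_def)
    finally show ?thesis .
  qed
qed

lemma trail_defect_path:
  fixes x :: "nat \<Rightarrow> 'a"
  assumes "x 0 = s" "0 < n"
  shows "trail_defect s v (word n x) (dead n x) =
     of_bool (s \<in> path_core n x) * (of_bool (x 1 = v) - core_step_prob (path_trans n x) (path_core n x) s v)"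
proof -
  have "last (s # word n x) = x n" using last_word[of x n] assms by simp
  moreover have "word n x \<noteq> [] \<and> hd (word n x) = x 1"
    using assms(2) by (cases n) (auto simp: word_Suc_left)
  ultimately show ?thesis
    unfolding trail_defect_def Let_def path_trans_def path_core_def assms(1)[symmetric] by simp
qed

text \<open>
  Laws of transient partially exchangeable paths from \<open>s\<close>. Exchangeability is formulated as an
  equality of integrals over the future given the initial word: this form passes directly to
  densities and to the path without its first step. The mass is finite rather than 1, to include
  restrictions to events.
\<close>

locale exch_measure = finite_measure Q for Q :: "(nat \<Rightarrow> 'a) measure" +
  fixes S :: "'a set" and s :: 'a
  assumes countable_S: "countable S"
    and s_in_S: "s \<in> S"
    and sets_Q: "sets Q = sets (path_space S)"
    and start: "AE x in Q. x 0 = s"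
    and transient: "AE x in Q. \<forall>u\<in>S. finite {i. x i = u}"
    and exch: "\<And>ys ys' h. trans_mset s ys = trans_mset s ys' \<Longrightarrow> set ys \<subseteq> S \<Longrightarrow>
      h \<in> borel_measurable (path_space S) \<Longrightarrow>
      (\<integral>\<^sup>+x. indicator {x. word (length ys) x = ys} x * h (shift (length ys) x) \<partial>Q) =
      (\<integral>\<^sup>+x. indicator {x. word (length ys') x = ys'} x * h (shift (length ys') x) \<partial>Q)"
begin

lemma space_Q: "space Q = {x. \<forall>i. x i \<in> S}"
  using sets_eq_imp_space_eq[OF sets_Q] by (simp add: space_path_space)

lemma measurable_Q: "measurable Q N = measurable (path_space S) N"
  by (rule measurable_cong_sets[OF sets_Q refl])

lemma AE_transient_path: "AE x in Q. transient_path S x \<and> x 0 = s"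
  using start transient AE_space
proof eventually_elim
  case (elim x)
  then have "finite {i. x i = u}" for u
    by (cases "u \<in> S") (auto simp: space_Q intro: finite_subset[of _ "{}"])
  then show ?case using elim countable_S by (auto simp: transient_path_def space_Q)
qed

text \<open>
  The dead states in terms of the initial word and the future alone. For trails with the same
  transitions it is the same function of the future, so exchangeability applies to it.
\<close>

definition silent :: "nat \<Rightarrow> 'a list \<Rightarrow> (nat \<Rightarrow> 'a) \<Rightarrow> 'a set" where
  "silent n ys x = {u \<in> sources (trans_mset s ys). \<forall>k. shift n x k \<noteq> u}"

lemma silent_word:
  assumes "x 0 = s"
  shows "silent n (word n x) x = dead n x"
proof -
  have "(\<forall>k\<ge>n. x k \<noteq> u) \<longleftrightarrow> (\<forall>k. x (k + n) \<noteq> u)" for u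
    by (metis le_add2 le_add_diff_inverse2)
  then show ?thesis
    unfolding silent_def dead_def sources_path_trans[of n x, symmetric] path_trans_def assms shift_def by simp
qed

lemma pred_silent: "Measurable.pred (path_space S) (\<lambda>x. silent n ys x = B)"
proof -
  have *: "silent n ys x = B \<longleftrightarrow> B \<subseteq> sources (trans_mset s ys) \<and>
     (\<forall>u\<in>sources (trans_mset s ys). (u \<in> B) = (\<forall>k. x (k + n) \<noteq> u))" for x
    unfolding silent_def shift_def by blast
  show ?thesis unfolding *
    by (intro pred_intros_finite pred_intros_countable pred_intros_logic pred_coord) simp_all
qed

text \<open>
  All that the defect at time \<open>n\<close> depends on. There are countably many values, so integrals can be
  evaluated by splitting the path space according to them.
\<close>

definition key :: "nat \<Rightarrow> (nat \<Rightarrow> 'a) \<Rightarrow> 'a list \<times> 'a set" where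
  "key n x = (word n x, silent n (word n x) x)"

lemma key_space: "x \<in> space Q \<Longrightarrow> key n x \<in> lists S \<times> Fpow (insert s S)"
  unfolding key_def silent_def sources_trans_mset Fpow_def
  by (auto simp: space_Q word_def dest!: in_set_butlastD)

lemma countable_key: "countable (lists S \<times> Fpow (insert s S))"
  using countable_S by (intro countable_SIGMA countable_lists countable_Fpow) auto

lemma key_eq_sets: "{x \<in> space Q. key n x = (ys, B)} \<in> sets Q"
proof -
  have "{x \<in> space Q. key n x = (ys, B)} = {x \<in> space (path_space S). word n x = ys \<and> silent n ys x = B}"
    using sets_eq_imp_space_eq[OF sets_Q] by (auto simp: key_def)
  also have "\<dots> \<in> sets (path_space S)"
    using pred_intros_logic(3)[OF pred_word pred_silent] by (simp add: pred_def)
  finally show ?thesis by (simp add: sets_Q)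
qed

lemma measurable_key: "key n \<in> measurable Q (count_space (lists S \<times> Fpow (insert s S)))"
  unfolding measurable_count_space_eq_countable[OF countable_key]
proof (intro conjI ballI Pi_I key_space)
  fix a :: "'a list \<times> 'a set"
  obtain ys B where "a = (ys, B)" by (cases a)
  then have "key n -` {a} \<inter> space Q = {x \<in> space Q. key n x = (ys, B)}" by auto
  then show "key n -` {a} \<inter> space Q \<in> sets Q" using key_eq_sets by simp
qed

lemma measurable_of_key: "(\<lambda>x. f (key n x)) \<in> measurable Q (count_space UNIV)"
  using measurable_compose[OF measurable_key, of f "count_space UNIV"] by simp

lemma emeasure_key_eq:
  assumes "trans_mset s ys = trans_mset s ys'" "length ys = n"
  shows "emeasure Q {x \<in> space Q. key n x = (ys, B)} = emeasure Q {x \<in> space Q. key n x = (ys', B)}"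
proof (cases "set ys \<subseteq> S")
  case True
  define h where "h t = (indicator {t. {u \<in> sources (trans_mset s ys). \<forall>k. t k \<noteq> u} = B} t :: ennreal)" for t :: "nat \<Rightarrow> 'a"
  have "h t = indicator {t. silent 0 ys t = B} t" for t
    by (simp add: h_def silent_def)
  then have h: "h \<in> borel_measurable (path_space S)"
    using borel_measurable_indicator[of "{t \<in> space (path_space S). silent 0 ys t = B}" "path_space S"] pred_silent[of 0 ys B]
    by (subst measurable_cong[where g = "indicator {t \<in> space (path_space S). silent 0 ys t = B}"])
       (auto simp: pred_def indicator_def)
  have len: "length ys' = n" using trans_mset_eq_length[OF assms(1)] assms(2) by simp
  have *: "emeasure Q {x \<in> space Q. key n x = (zs, B)} =
     (\<integral>\<^sup>+x. indicator {x. word n x = zs} x * h (shift n x) \<partial>Q)" if "trans_mset s zs = trans_mset s ys" for zs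
  proof -
    have "emeasure Q {x \<in> space Q. key n x = (zs, B)} = (\<integral>\<^sup>+x. indicator {x \<in> space Q. key n x = (zs, B)} x \<partial>Q)"
      using key_eq_sets by simp
    also have "\<dots> = (\<integral>\<^sup>+x. indicator {x. word n x = zs} x * h (shift n x) \<partial>Q)"
      using that by (intro nn_integral_cong) (auto simp: indicator_def key_def h_def silent_def)
    finally show ?thesis .
  qed
  show ?thesis using exch[OF assms(1) True h] *[of ys] *[of ys'] assms len by simp
next
  case False
  have "key n x \<noteq> (zs, B)" if "x \<in> space Q" "\<not> set zs \<subseteq> S" for zs x
    using key_space[OF that(1), of n] that(2) by auto
  moreover have "\<not> set ys' \<subseteq> S" using False trans_mset_eq_set[OF assms(1)] by simp
  ultimately have "{x \<in> space Q. key n x = (ys, B)} = {}" "{x \<in> space Q. key n x = (ys', B)} = {}"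
    using False by blast+
  then show ?thesis by (simp only: emeasure_empty)
qed

definition defect :: "'a \<Rightarrow> nat \<Rightarrow> (nat \<Rightarrow> 'a) \<Rightarrow> real" where
  "defect v n x = (case key n x of (ys, B) \<Rightarrow> trail_defect s v ys B)"

lemma measurable_defect: "defect v n \<in> borel_measurable Q"
  using measurable_compose[OF measurable_of_key[of "\<lambda>(ys, B). trail_defect s v ys B" n], of "\<lambda>x. x" borel]
  by (simp add: defect_def[abs_def])

lemma AE_defect:
  assumes "0 < n"
  shows "AE x in Q. transient_path S x \<and> x 0 = s \<and>
    defect v n x = of_bool (s \<in> path_core n x) *
      (of_bool (x 1 = v) - core_step_prob (path_trans n x) (path_core n x) s v)"
  using AE_transient_path
proof eventually_elim
  case (elim x)
  then show ?case
    using trail_defect_path[of x s n v] silent_word[of x n] assms by (simp add: defect_def key_def)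
qed

lemma AE_defect_bound:
  assumes "0 < n"
  shows "AE x in Q. norm (defect v n x) \<le> 4"
  using AE_defect[OF assms, of v]
proof eventually_elim
  case (elim x)
  interpret transient_path S x using elim by simp
  have "0 \<le> core_step_prob (path_trans n x) (path_core n x) s v \<and>
    core_step_prob (path_trans n x) (path_core n x) s v \<le> 3" if "s \<in> path_core n x"
    using core_step_prob_range[of n v] that elim by auto
  then show ?case using elim by (auto simp: of_bool_def)
qed

lemma integrable_defect:
  assumes "0 < n"
  shows "integrable Q (defect v n)"
  by (rule integrable_const_bound[OF AE_defect_bound[OF assms] measurable_defect])

text \<open>
  Split according to the transitions before time \<open>n\<close>, the end point and the set of dead states. On
  each piece all trails with these transitions are equally likely, and their defects sum to 0.
\<close>

lemma integral_defect:
  assumes n: "0 < n"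
  shows "(\<integral>x. defect v n x \<partial>Q) = 0"
proof (rule integral_eq_0_by_countable_partition)
  define g where "g = (\<lambda>(ys, B :: 'a set). (trans_mset s ys, last (s # ys), B))"
  let ?I = "g ` (lists S \<times> Fpow (insert s S))"
  show "countable ?I" by (intro countable_image countable_key)
  show "g (key n x) \<in> ?I" if "x \<in> space Q" for x using key_space[OF that] by (rule imageI)
  show sets: "{x \<in> space Q. g (key n x) = i} \<in> sets Q" for i
    using measurable_sets[OF measurable_of_key[of g n], of "{i}"]
    by (simp add: vimage_def Int_def conj_commute)
  show "integrable Q (defect v n)" by (rule integrable_defect[OF n])
  fix i assume "i \<in> ?I"
  obtain T z B where i: "i = (T, z, B)" by (cases i)
  show "(\<integral>x. indicator {x \<in> space Q. g (key n x) = i} x * defect v n x \<partial>Q) = 0"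
  proof (cases "size T = n \<and> B \<subseteq> tree_vertices T z")
    case False
    have "AE x in Q. indicator {x \<in> space Q. g (key n x) = i} x * defect v n x = 0"
      using AE_transient_path
    proof eventually_elim
      case (elim x)
      have "g (key n x) \<noteq> i"
      proof
        assume "g (key n x) = i"
        then have T: "path_trans n x = T" "x n = z" "dead n x = B"
          using elim last_word[of x n] silent_word[of x n] by (auto simp: g_def key_def i path_trans_def simp del: last.simps)
        then have "size T = n" by (auto simp: path_trans_def)
        moreover have "B \<subseteq> tree_vertices T z" using dead_subset[of n x] T by simp
        ultimately show False using False by simp
      qed
      then show ?case by simp
    qed
    then show ?thesis by (rule integral_eq_zero_AE)
  next
    case True
    define E where "E ys = {x \<in> space Q. key n x = (ys, B)}" for ys
    have Es: "E ys \<in> sets Q" for ys by (simp add: E_def key_eq_sets)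
    \<comment> \<open>On this piece the word is one of the trails with transitions T and end point z.\<close>
    have eq: "indicator {x \<in> space Q. g (key n x) = i} x * defect v n x =
        (\<Sum>ys\<in>trails T s z. indicator (E ys) x * trail_defect s v ys B)" if x: "x \<in> space Q" for x
    proof (cases "g (key n x) = i")
      case g: True
      then have "word n x \<in> trails T s z" "silent n (word n x) x = B"
        by (auto simp: g_def key_def i trails_def)
      have "(\<Sum>ys\<in>trails T s z. indicator (E ys) x * trail_defect s v ys B) =
         (\<Sum>ys\<in>trails T s z. if ys = word n x then trail_defect s v (word n x) B else 0)"
        using x \<open>silent n (word n x) x = B\<close> by (intro sum.cong) (auto simp: E_def key_def indicator_def)
      also have "\<dots> = trail_defect s v (word n x) B"
        using \<open>word n x \<in> trails T s z\<close> by (simp add: finite_trails)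
      finally show ?thesis using g x \<open>silent n (word n x) x = B\<close> by (simp add: defect_def key_def)
    next
      case g: False
      have "x \<notin> E ys" if "ys \<in> trails T s z" for ys
        using g that by (auto simp: E_def g_def i trails_def)
      then show ?thesis using g by simp
    qed
    have "(\<integral>x. indicator {x \<in> space Q. g (key n x) = i} x * defect v n x \<partial>Q) =
      (\<integral>x. (\<Sum>ys\<in>trails T s z. indicator (E ys) x * trail_defect s v ys B) \<partial>Q)"
      by (rule Bochner_Integration.integral_cong[OF refl eq])
    also have "\<dots> = (\<Sum>ys\<in>trails T s z. measure Q (E ys) * trail_defect s v ys B)"
      using Es by (subst Bochner_Integration.integral_sum) (auto simp: emeasure_eq_measure)
    also have "\<dots> = 0"
    proof (cases "trails T s z = {}")
      case False
      then obtain y0 where y0: "y0 \<in> trails T s z" by auto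
      have "measure Q (E ys) = measure Q (E y0)" if "ys \<in> trails T s z" for ys
        using emeasure_key_eq[of ys y0 n B] that y0 True by (auto simp: E_def trails_def measure_def)
      then have "(\<Sum>ys\<in>trails T s z. measure Q (E ys) * trail_defect s v ys B) =
         measure Q (E y0) * (\<Sum>ys\<in>trails T s z. trail_defect s v ys B)"
        by (simp add: sum_distrib_left)
      then show ?thesis using sum_trail_defect[of B T z s v] True by simp
    qed simp
    finally show ?thesis .
  qed
qed

end

lemma measurable_num_trans: "(\<lambda>x. real (num_trans x u v)) \<in> borel_measurable (path_space S)"
proof -
  have "(\<lambda>x. num_trans x u v) \<in> measurable (path_space S) (count_space UNIV)"
    unfolding num_trans_def
  proof (rule measurable_card)
    fix i
    have "Measurable.pred (path_space S) (\<lambda>x. x i = u \<and> x (Suc i) = v)"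
      by (intro pred_intros_logic pred_coord)
    then show "{x \<in> space (path_space S). i \<in> {i. x i = u \<and> x (Suc i) = v}} \<in> sets (path_space S)"
      by (simp add: pred_def)
  qed
  then show ?thesis by (rule measurable_compose) simp
qed

context exch_measure
begin

text \<open>
  The defects have mean 0, are bounded, and converge along almost every path to the difference of the
  indicator of the first step and \<open>step_prob\<close>.
\<close>

theorem one_step:
  assumes v: "v \<in> S"
  shows "emeasure Q {x \<in> space Q. x 1 = v} = (\<integral>\<^sup>+x. ennreal (step_prob S s (num_trans x) v) \<partial>Q)"
proof -
  define q where "q x = step_prob S s (num_trans x) v" for x :: "nat \<Rightarrow> 'a"
  have q_range: "0 \<le> q x" "q x \<le> 3" for x by (auto simp: q_def step_prob_def)
  have q_meas: "q \<in> borel_measurable Q"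
    unfolding q_def measurable_Q using v s_in_S
    by (intro measurable_step_prob countable_S measurable_num_trans)
  have ind_sets: "{x \<in> space Q. x 1 = v} \<in> sets Q"
    using pred_coord[of 1 v S] sets_eq_imp_space_eq[OF sets_Q] by (simp add: pred_def sets_Q)
  have ind_meas: "(\<lambda>x. of_bool (x 1 = v) :: real) \<in> borel_measurable Q"
    using ind_sets by (subst measurable_cong[where g = "indicator {x \<in> space Q. x 1 = v}"])
      (auto simp: indicator_def)
  have lim: "(\<lambda>n. \<integral>x. defect v (Suc n) x \<partial>Q) \<longlonglongrightarrow> (\<integral>x. of_bool (x 1 = v) - q x \<partial>Q)"
  proof (rule integral_dominated_convergence[where w = "\<lambda>_. 4"])
    show "(\<lambda>x. of_bool (x 1 = v) - q x) \<in> borel_measurable Q"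
      using ind_meas q_meas by (rule borel_measurable_diff)
    show "AE x in Q. norm (defect v (Suc n) x) \<le> 4" for n by (rule AE_defect_bound) simp
    have "AE x in Q. \<forall>n. transient_path S x \<and> x 0 = s \<and>
      defect v (Suc n) x = of_bool (s \<in> path_core (Suc n) x) *
        (of_bool (x 1 = v) - core_step_prob (path_trans (Suc n) x) (path_core (Suc n) x) s v)"
      unfolding AE_all_countable by (intro allI AE_defect) simp
    then show "AE x in Q. (\<lambda>n. defect v (Suc n) x) \<longlonglongrightarrow> of_bool (x 1 = v) - q x"
    proof eventually_elim
      case (elim x)
      interpret transient_path S x using elim by simp
      have x0: "x 0 = s" using elim by simp
      have "(\<lambda>n. of_bool (x 1 = v) - core_step_prob (path_trans (Suc n) x) (path_core (Suc n) x) s v)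
          \<longlonglongrightarrow> of_bool (x 1 = v) - q x"
        unfolding q_def using LIMSEQ_Suc[OF core_step_prob_tendsto[of v]] x0
        by (intro tendsto_intros) simp
      moreover have ev: "eventually (\<lambda>n. defect v (Suc n) x =
          of_bool (x 1 = v) - core_step_prob (path_trans (Suc n) x) (path_core (Suc n) x) s v) sequentially"
        using eventually_s_core[folded eventually_sequentially_Suc[of "\<lambda>n. x 0 \<in> path_core n x"]]
        by eventually_elim (use elim in auto)
      ultimately show ?case by (subst tendsto_cong[OF ev])
    qed
  qed (auto simp: measurable_defect)
  have int: "integrable Q q"
    by (rule integrable_const_bound[where B = 3]) (auto simp: q_range q_meas)
  have "(\<integral>x. of_bool (x 1 = v) - q x \<partial>Q) = 0"
    using lim by (simp add: integral_defect LIMSEQ_const_iff)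
  moreover have "integrable Q (\<lambda>x. of_bool (x 1 = v) :: real)"
    by (rule integrable_const_bound[where B = 1, OF _ ind_meas]) auto
  ultimately have "(\<integral>x. of_bool (x 1 = v) \<partial>Q) = (\<integral>x. q x \<partial>Q)"
    using int by (simp add: Bochner_Integration.integral_diff)
  moreover have "(\<integral>x. of_bool (x 1 = v) \<partial>Q) = measure Q {x \<in> space Q. x 1 = v}"
  proof -
    have "(\<integral>x. of_bool (x 1 = v) \<partial>Q) = (\<integral>x. indicator {x \<in> space Q. x 1 = v} x \<partial>Q :: real)"
      by (rule Bochner_Integration.integral_cong) (auto simp: indicator_def)
    then show ?thesis using ind_sets by simp
  qed
  ultimately have "emeasure Q {x \<in> space Q. x 1 = v} = ennreal (\<integral>x. q x \<partial>Q)"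
    by (simp add: emeasure_eq_measure)
  also have "\<dots> = (\<integral>\<^sup>+x. ennreal (q x) \<partial>Q)"
    by (rule nn_integral_eq_integral[symmetric]) (auto simp: int q_range)
  finally show ?thesis by (simp add: q_def)
qed

end

section \<open>The law of the initial word\<close>

lemma measurable_indicator_pred:
  assumes "Measurable.pred M P"
  shows "(\<lambda>x. indicator {x. P x} x :: ennreal) \<in> borel_measurable M"
  using assms
  by (subst measurable_cong[where g = "indicator {x \<in> space M. P x}"]) (auto simp: pred_def indicator_def)

text \<open>
  The path that starts at \<open>s\<close>, follows \<open>ys\<close> and continues with \<open>t\<close>, whose initial state is the end
  of \<open>ys\<close>.
\<close>

definition splice_path :: "'a \<Rightarrow> 'a list \<Rightarrow> (nat \<Rightarrow> 'a) \<Rightarrow> nat \<Rightarrow> 'a" where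
  "splice_path s ys t i = (if i < length ys then (s # ys) ! i else t (i - length ys))"

lemma splice_path_word:
  assumes "x 0 = s"
  shows "splice_path s (word n x) (shift n x) = x"
proof
  fix i
  have "(s # word n x) ! i = x i" if "i < n"
    using that unfolding assms[symmetric] Cons_word by (subst nth_map_upt) auto
  then show "splice_path s (word n x) (shift n x) i = x i" by (simp add: splice_path_def shift_def)
qed

lemma splice_path_0:
  assumes "t 0 = last (s # ys)"
  shows "splice_path s ys t 0 = s"
  using assms by (cases ys) (auto simp: splice_path_def)

lemma word_splice_path:
  assumes "t 0 = last (s # ys)"
  shows "word (length ys) (splice_path s ys t) = ys"
  unfolding word_eq_iff
proof (intro conjI allI impI refl)
  fix i assume i: "i < length ys"
  show "splice_path s ys t (Suc i) = ys ! i"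
  proof (cases "Suc i < length ys")
    case False
    then have "Suc i = length ys" using i by simp
    then have "splice_path s ys t (Suc i) = last (s # ys)" using assms by (simp add: splice_path_def)
    also have "\<dots> = ys ! (length ys - 1)" using i by (cases "ys = []") (auto simp: last_conv_nth)
    finally show ?thesis by (simp flip: \<open>Suc i = length ys\<close>)
  qed (simp add: splice_path_def)
qed

lemma splice_path_equiv:
  assumes eq: "trans_mset s ys = trans_mset s ys'" and t: "t 0 = last (s # ys)"
  shows "inf_equiv S (splice_path s ys t) (splice_path s ys' t)"
proof -
  have len: "length ys' = length ys" using trans_mset_eq_length[OF eq] by simp
  have t': "t 0 = last (s # ys')" using t trans_mset_eq_last[OF eq] by simp
  have pt: "path_trans (length ys) (splice_path s ys t) = path_trans (length ys) (splice_path s ys' t)"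
    using word_splice_path[of t s ys, OF t] word_splice_path[of t s ys', OF t'] len eq
    by (simp add: path_trans_def splice_path_0[of t s ys, OF t] splice_path_0[of t s ys', OF t'])
  have "card {i. i < length ys \<and> (splice_path s ys t i, splice_path s ys t (Suc i)) = (u, v)} =
     card {i. i < length ys \<and> (splice_path s ys' t i, splice_path s ys' t (Suc i)) = (u, v)}" for u v
    using arg_cong[OF pt, of "\<lambda>T. count T (u, v)"] by (simp add: count_path_trans)
  moreover have "splice_path s ys t n = splice_path s ys' t n" if "n \<ge> length ys" for n
    using that len by (simp add: splice_path_def)
  ultimately show ?thesis
    unfolding inf_equiv_def fin_equiv_def
    by (intro exI[of _ "length ys"]) (simp add: splice_path_0[of t s ys, OF t] splice_path_0[of t s ys', OF t'])
qed

lemma measurable_splice_path: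
  assumes "s \<in> S" "set ys \<subseteq> S"
  shows "splice_path s ys \<in> measurable (path_space S) (path_space S)"
proof -
  have nth: "(s # ys) ! i \<in> S" if "i < length ys" for i
  proof -
    have "(s # ys) ! i \<in> set (s # ys)" using that by (intro nth_mem) simp
    then show ?thesis using assms by auto
  qed
  have "(\<lambda>t. splice_path s ys t i) \<in> measurable (path_space S) (count_space S)" for i
    by (cases "i < length ys") (simp_all add: splice_path_def measurable_coord nth)
  then have "(\<lambda>t. splice_path s ys t) \<in> measurable (path_space S) (PiM UNIV (\<lambda>_. count_space S))"
    by (rule measurable_PiM_single') (auto simp: space_path_space splice_path_def nth)
  then show ?thesis by (simp add: path_space_def)
qed

definition exch_invariant :: "'a set \<Rightarrow> ((nat \<Rightarrow> 'a) \<Rightarrow> 'b) \<Rightarrow> bool" where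
  "exch_invariant S f \<longleftrightarrow>
    (\<forall>x\<in>space (path_space S). \<forall>x'\<in>space (path_space S). inf_equiv S x x' \<longrightarrow> f x = f x')"

text \<open>
  An invariant density does not distinguish initial words with the same transitions followed by the
  same future, so it can be absorbed into the function of the future.
\<close>

lemma (in exch_measure) exch_measure_density:
  fixes g :: "(nat \<Rightarrow> 'a) \<Rightarrow> ennreal"
  assumes g: "g \<in> borel_measurable (path_space S)" and fin: "(\<integral>\<^sup>+x. g x \<partial>Q) < \<infinity>"
    and inv: "exch_invariant S g"
  shows "exch_measure (density Q g) S s"
proof -
  have gQ: "g \<in> borel_measurable Q" using g by (simp add: measurable_Q)
  have ind: "(\<lambda>x. indicator {x. word n x = ys} x :: ennreal) \<in> borel_measurable Q" for n ys
    unfolding measurable_Q by (intro measurable_indicator_pred pred_word)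
  have "finite_measure (density Q g)"
    by (rule finite_measureI) (use fin gQ in \<open>simp add: emeasure_density\<close>)
  then show ?thesis
  proof (rule exch_measure.intro[OF _ exch_measure_axioms.intro])
    show "sets (density Q g) = sets (path_space S)" by (simp add: sets_Q)
    show "AE x in density Q g. x 0 = s"
      using start by (subst AE_density[OF gQ]) auto
    show "AE x in density Q g. \<forall>u\<in>S. finite {i. x i = u}"
      using transient by (subst AE_density[OF gQ]) auto
    fix ys ys' and h :: "(nat \<Rightarrow> 'a) \<Rightarrow> ennreal"
    assume eq: "trans_mset s ys = trans_mset s ys'" and ys: "set ys \<subseteq> S"
      and h: "h \<in> borel_measurable (path_space S)"
    have hQ: "(\<lambda>x. h (shift n x)) \<in> borel_measurable Q" for n
      unfolding measurable_Q by (rule measurable_compose[OF measurable_shift h])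
    have ys': "set ys' \<subseteq> S" using ys trans_mset_eq_set[OF eq] by simp
    have main: "(\<integral>\<^sup>+x. indicator {x. word (length zs) x = zs} x * h (shift (length zs) x) \<partial>density Q g) =
        (\<integral>\<^sup>+x. indicator {x. word (length zs) x = zs} x * (\<lambda>t. g (splice_path s ys t) * h t) (shift (length zs) x) \<partial>Q)"
      if zs: "trans_mset s zs = trans_mset s ys" "set zs \<subseteq> S" for zs
    proof -
      have "(\<integral>\<^sup>+x. indicator {x. word (length zs) x = zs} x * h (shift (length zs) x) \<partial>density Q g) =
        (\<integral>\<^sup>+x. g x * (indicator {x. word (length zs) x = zs} x * h (shift (length zs) x)) \<partial>Q)"
        by (intro nn_integral_density gQ borel_measurable_times_ennreal ind hQ)
      also have "\<dots> = (\<integral>\<^sup>+x. indicator {x. word (length zs) x = zs} x * (g (splice_path s ys (shift (length zs) x)) * h (shift (length zs) x)) \<partial>Q)"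
      proof (rule nn_integral_cong_AE)
        show "AE x in Q. g x * (indicator {x. word (length zs) x = zs} x * h (shift (length zs) x)) =
          indicator {x. word (length zs) x = zs} x * (g (splice_path s ys (shift (length zs) x)) * h (shift (length zs) x))"
          using start AE_space
        proof eventually_elim
          case (elim x)
          have "g x = g (splice_path s ys (shift (length zs) x))" if w: "word (length zs) x = zs"
          proof -
            define t where "t = shift (length zs) x"
            have tS: "t \<in> space (path_space S)" using elim by (auto simp: t_def space_Q space_path_space shift_def)
            have t0: "t 0 = last (s # zs)" using last_word[of x "length zs"] w elim by (simp add: t_def shift_def)
            have x: "x = splice_path s zs t" using splice_path_word[of x s "length zs"] w elim by (simp add: t_def)
            have "g x = g (splice_path s zs t)" by (rule arg_cong[OF x])
            also have "\<dots> = g (splice_path s ys t)"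
              using inv splice_path_equiv[of s zs ys t, OF zs(1) t0, of S]
                measurable_space[OF measurable_splice_path[OF s_in_S zs(2)] tS]
                measurable_space[OF measurable_splice_path[OF s_in_S ys] tS]
              unfolding exch_invariant_def by blast
            finally show ?thesis by (simp only: t_def)
          qed
          then show ?case by (simp add: indicator_def)
        qed
      qed
      finally show ?thesis by simp
    qed
    have hh: "(\<lambda>t. g (splice_path s ys t) * h t) \<in> borel_measurable (path_space S)"
      by (intro borel_measurable_times_ennreal h measurable_compose[OF measurable_splice_path[OF s_in_S ys] g])
    show "(\<integral>\<^sup>+x. indicator {x. word (length ys) x = ys} x * h (shift (length ys) x) \<partial>density Q g) =
      (\<integral>\<^sup>+x. indicator {x. word (length ys') x = ys'} x * h (shift (length ys') x) \<partial>density Q g)"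
      unfolding main[OF refl ys] main[OF eq[symmetric] ys'] by (rule exch[OF eq ys hh])
  qed (fact countable_S s_in_S)+
qed

lemma pred_finite_Collect:
  assumes "\<And>i::nat. Measurable.pred M (\<lambda>x. P i x)"
  shows "Measurable.pred M (\<lambda>x. finite {i. P i x})"
proof -
  have "finite {i. P i x} \<longleftrightarrow> (\<exists>k. \<forall>i. P i x \<longrightarrow> i \<le> k)" for x
    unfolding finite_nat_set_iff_bounded_le by simp
  then show ?thesis by (simp only:) (intro pred_intros_countable pred_intros_logic assms; simp)
qed

lemma transient_paths_sets:
  assumes "countable S"
  shows "{x \<in> space (path_space S). \<forall>u\<in>S. finite {i. x i = u}} \<in> sets (path_space S)"
proof (cases "S = {}")
  case False
  have "{x \<in> space (path_space S). finite {i. x i = u}} \<in> sets (path_space S)" for u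
    using pred_finite_Collect[where P = "\<lambda>i x. x i = u" and M = "path_space S", OF pred_coord] unfolding pred_def .
  then have "(\<Inter>u\<in>S. {x \<in> space (path_space S). finite {i. x i = u}}) \<in> sets (path_space S)"
    by (intro sets.countable_INT'[OF assms False]) blast
  moreover have "(\<Inter>u\<in>S. {x \<in> space (path_space S). finite {i. x i = u}}) =
      {x \<in> space (path_space S). \<forall>u\<in>S. finite {i. x i = u}}"
    using False by blast
  ultimately show ?thesis by (simp only:)
qed (simp add: space_path_space)

text \<open>
  Words with equal transitions still have equal transitions after prefixing the same first step.
\<close>

lemma (in exch_measure) exch_measure_shift:
  assumes v: "v \<in> S"
  shows "exch_measure (distr (density Q (\<lambda>x. indicator {x. x 1 = v} x)) (path_space S) (shift 1)) S v"
    (is "exch_measure ?R S v")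
proof -
  let ?i = "\<lambda>x. indicator {x. x 1 = v} x :: ennreal"
  let ?D = "density Q ?i"
  have i: "?i \<in> borel_measurable Q"
    unfolding measurable_Q by (intro measurable_indicator_pred pred_coord)
  have sh: "shift 1 \<in> measurable ?D (path_space S)"
    using measurable_shift[of 1 S] by (simp add: measurable_Q)
  have ind: "(\<lambda>x. indicator {x. word n x = ys} x :: ennreal) \<in> borel_measurable (path_space S)" for n ys
    by (intro measurable_indicator_pred pred_word)
  have finD: "finite_measure ?D"
  proof
    have "emeasure ?D (space ?D) = (\<integral>\<^sup>+x. ?i x \<partial>Q)"
      by (subst space_density, subst emeasure_density[OF i sets.top])
         (intro nn_integral_cong, simp add: indicator_def)
    also have "\<dots> \<le> (\<integral>\<^sup>+x. 1 \<partial>Q)" by (intro nn_integral_mono) (auto simp: indicator_def)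
    also have "\<dots> < \<infinity>" by (simp add: less_top[symmetric])
    finally show "emeasure ?D (space ?D) \<noteq> \<infinity>" by simp
  qed
  have "finite_measure ?R"
    by (rule finite_measure.finite_measure_distr[OF finD sh])
  then show ?thesis
  proof (rule exch_measure.intro[OF _ exch_measure_axioms.intro])
    show "sets ?R = sets (path_space S)" by simp
    have "AE x in ?D. shift 1 x 0 = v"
      by (subst AE_density[OF i]) (auto simp: shift_def indicator_def)
    then show "AE x in ?R. x 0 = v"
      by (subst AE_distr_iff[OF sh]) (use pred_coord[of 0 v S] in \<open>auto simp: pred_def\<close>)
    have "AE x in ?D. \<forall>u\<in>S. finite {i. shift 1 x i = u}"
    proof (subst AE_density[OF i], use transient in eventually_elim, safe)
      fix x :: "nat \<Rightarrow> 'a" and u assume "\<forall>u\<in>S. finite {i. x i = u}" "u \<in> S"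
      then have "finite (Suc -` {i. x i = u})" by (intro finite_vimageI) auto
      then show "finite {i. shift 1 x i = u}" by (simp add: shift_def vimage_def)
    qed
    then show "AE x in ?R. \<forall>u\<in>S. finite {i. x i = u}"
      by (simp only: AE_distr_iff[OF sh transient_paths_sets[OF countable_S]])
    fix ys ys' and h :: "(nat \<Rightarrow> 'a) \<Rightarrow> ennreal"
    assume eq: "trans_mset v ys = trans_mset v ys'" and ys: "set ys \<subseteq> S"
      and h: "h \<in> borel_measurable (path_space S)"
    have main: "(\<integral>\<^sup>+x. indicator {x. word (length zs) x = zs} x * h (shift (length zs) x) \<partial>?R) =
      (\<integral>\<^sup>+x. indicator {x. word (length (v # zs)) x = v # zs} x * h (shift (length (v # zs)) x) \<partial>Q)" for zs
    proof -
      have m: "(\<lambda>x. indicator {x. word (length zs) x = zs} x * h (shift (length zs) x)) \<in> borel_measurable (path_space S)"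
        by (intro borel_measurable_times_ennreal ind measurable_compose[OF measurable_shift h])
      have "(\<integral>\<^sup>+x. indicator {x. word (length zs) x = zs} x * h (shift (length zs) x) \<partial>?R) =
        (\<integral>\<^sup>+x. indicator {x. word (length zs) x = zs} (shift 1 x) * h (shift (length zs) (shift 1 x)) \<partial>?D)"
        using m by (intro nn_integral_distr[OF sh]) (simp only: measurable_distr_eq1)
      also have "\<dots> = (\<integral>\<^sup>+x. ?i x * (indicator {x. word (length zs) x = zs} (shift 1 x) * h (shift (length zs) (shift 1 x))) \<partial>Q)"
        by (rule nn_integral_density[OF i]) (unfold measurable_Q, rule measurable_compose[OF measurable_shift m])
      also have "\<dots> = (\<integral>\<^sup>+x. indicator {x. word (length (v # zs)) x = v # zs} x * h (shift (length (v # zs)) x) \<partial>Q)"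
      proof (rule nn_integral_cong)
        fix x :: "nat \<Rightarrow> 'a"
        have "(\<lambda>i. x (Suc i)) = shift 1 x" by (simp add: shift_def fun_eq_iff)
        then have iff: "word (length (v # zs)) x = v # zs \<longleftrightarrow> x 1 = v \<and> word (length zs) (shift 1 x) = zs"
          by (simp add: word_Suc_left)
        then show "?i x * (indicator {x. word (length zs) x = zs} (shift 1 x) * h (shift (length zs) (shift 1 x))) =
          indicator {x. word (length (v # zs)) x = v # zs} x * h (shift (length (v # zs)) x)"
          unfolding indicator_def mem_Collect_eq iff shift_shift by auto
      qed
      finally show ?thesis .
    qed
    show "(\<integral>\<^sup>+x. indicator {x. word (length ys) x = ys} x * h (shift (length ys) x) \<partial>?R) =
      (\<integral>\<^sup>+x. indicator {x. word (length ys') x = ys'} x * h (shift (length ys') x) \<partial>?R)"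
      unfolding main using eq ys v by (intro exch h) auto
  qed (fact countable_S v)+
qed

definition drop_trans :: "'a \<Rightarrow> 'a \<Rightarrow> ('a \<Rightarrow> 'a \<Rightarrow> nat) \<Rightarrow> 'a \<Rightarrow> 'a \<Rightarrow> nat" where
  "drop_trans s v m a b = (if a = s \<and> b = v then m a b - 1 else m a b)"

text \<open>
  The conditional probability of an initial word given the transition numbers, by the chain rule: after
  a step the remaining path has that transition removed from its transition numbers.
\<close>

primrec word_prob :: "'a set \<Rightarrow> 'a list \<Rightarrow> 'a \<Rightarrow> ('a \<Rightarrow> 'a \<Rightarrow> nat) \<Rightarrow> real" where
  "word_prob S [] s m = 1"
| "word_prob S (v # ys) s m = step_prob S s m v * word_prob S ys v (drop_trans s v m)"

lemma word_prob_range: "0 \<le> word_prob S ys s m" "word_prob S ys s m \<le> 3 ^ length ys"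
proof -
  have r: "0 \<le> step_prob S s m v" "step_prob S s m v \<le> 3" for s m v
    by (auto simp: step_prob_def)
  show nn: "0 \<le> word_prob S ys s m" for ys s m
    by (induction ys arbitrary: s m) (auto simp: r)
  show "word_prob S ys s m \<le> 3 ^ length ys"
    by (induction ys arbitrary: s m) (auto intro!: mult_mono r nn)
qed

lemma measurable_drop_trans:
  assumes "(\<lambda>w. real (m w a b)) \<in> borel_measurable N"
  shows "(\<lambda>w. real (drop_trans s v (m w) a b)) \<in> borel_measurable N"
proof -
  have "real (k - 1) = max 0 (real k - 1)" for k by (cases k) auto
  then have "(\<lambda>w. real (m w a b - 1)) \<in> borel_measurable N" using assms by simp
  then show ?thesis
    using assms by (cases "a = s"; cases "b = v") (simp_all add: drop_trans_def)
qed

lemma measurable_word_prob: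
  assumes "countable S" "s \<in> S" "set ys \<subseteq> S"
    and "\<And>u v. u \<in> S \<Longrightarrow> v \<in> S \<Longrightarrow> (\<lambda>w. real (m w u v)) \<in> borel_measurable N"
  shows "(\<lambda>w. word_prob S ys s (m w)) \<in> borel_measurable N"
  using assms(2-)
proof (induction ys arbitrary: s m)
  case (Cons v ys)
  have "(\<lambda>w. word_prob S ys v (drop_trans s v (m w))) \<in> borel_measurable N"
    using Cons.prems by (intro Cons.IH measurable_drop_trans) auto
  moreover have "(\<lambda>w. step_prob S s (m w) v) \<in> borel_measurable N"
    using Cons.prems by (intro measurable_step_prob assms(1)) auto
  ultimately show ?case by simp
qed simp

lemma drop_trans_num_trans: "drop_trans (x 0) (x 1) (num_trans x) = num_trans (shift 1 x)"
proof (intro ext)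
  fix a b
  let ?B = "{i. shift 1 x i = a \<and> shift 1 x (Suc i) = b}"
  have "{i. x i = a \<and> x (Suc i) = b} = (if a = x 0 \<and> b = x 1 then insert 0 (Suc ` ?B) else Suc ` ?B)"
  proof (rule set_eqI)
    fix i show "i \<in> {i. x i = a \<and> x (Suc i) = b} \<longleftrightarrow> i \<in> (if a = x 0 \<and> b = x 1 then insert 0 (Suc ` ?B) else Suc ` ?B)"
      by (cases i) (auto simp: shift_def)
  qed
  moreover have "card (insert 0 (Suc ` ?B)) - 1 = card ?B"
    by (cases "finite ?B") (auto simp: card_image finite_image_iff)
  ultimately show "drop_trans (x 0) (x 1) (num_trans x) a b = num_trans (shift 1 x) a b"
    by (auto simp: drop_trans_def num_trans_def card_image)
qed

lemma card_Un_swap: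
  assumes "finite A" "finite A'" "card A = card A'" "A \<inter> C = {}" "A' \<inter> C = {}"
  shows "card (A \<union> C) = card (A' \<union> C)" "finite (A \<union> C) \<longleftrightarrow> finite (A' \<union> C)"
  using assms by (cases "finite C"; simp add: card_Un_disjoint)+

lemma inf_equiv_transitions:
  assumes "inf_equiv S x x'" "u \<in> S" "v \<in> S"
  shows "card {i. x i = u \<and> x (Suc i) = v} = card {i. x' i = u \<and> x' (Suc i) = v}"
    "finite {i. x i = u \<and> x (Suc i) = v} \<longleftrightarrow> finite {i. x' i = u \<and> x' (Suc i) = v}"
proof -
  obtain N where N: "\<And>n. n \<ge> N \<Longrightarrow> x n = x' n" and e: "fin_equiv S N x x'"
    using assms(1) by (auto simp: inf_equiv_def)
  define C where "C = {i. N \<le> i \<and> x i = u \<and> x (Suc i) = v}"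
  let ?A = "{i. i < N \<and> x i = u \<and> x (Suc i) = v}" and ?A' = "{i. i < N \<and> x' i = u \<and> x' (Suc i) = v}"
  have 1: "{i. x i = u \<and> x (Suc i) = v} = ?A \<union> C" by (auto simp: C_def)
  have "N \<le> i \<Longrightarrow> x i = x' i \<and> x (Suc i) = x' (Suc i)" for i using N[of i] N[of "Suc i"] by simp
  then have 2: "{i. x' i = u \<and> x' (Suc i) = v} = ?A' \<union> C"
    by (auto simp: C_def not_le)
  have 3: "card ?A = card ?A'" using e assms by (simp add: fin_equiv_def)
  show "card {i. x i = u \<and> x (Suc i) = v} = card {i. x' i = u \<and> x' (Suc i) = v}"
    "finite {i. x i = u \<and> x (Suc i) = v} \<longleftrightarrow> finite {i. x' i = u \<and> x' (Suc i) = v}"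
    unfolding 1 2 by (rule card_Un_swap; use 3 in \<open>auto simp: C_def\<close>)+
qed

lemma num_trans_invariant: "exch_invariant S num_trans"
  unfolding exch_invariant_def
proof (intro ballI impI ext)
  fix x x' u v assume x: "x \<in> space (path_space S)" "x' \<in> space (path_space S)" "inf_equiv S x x'"
  show "num_trans x u v = num_trans x' u v"
  proof (cases "u \<in> S \<and> v \<in> S")
    case False
    then have "{i. x i = u \<and> x (Suc i) = v} = {}" "{i. x' i = u \<and> x' (Suc i) = v} = {}"
      using x by (auto simp: space_path_space)
    then show ?thesis unfolding num_trans_def by (simp only: card.empty)
  qed (use inf_equiv_transitions(1)[OF x(3)] in \<open>simp add: num_trans_def\<close>)
qed

text \<open>
  By induction the formula holds for the path after its first step. Its transition numbers are those of
  the whole path minus the first transition, so the resulting factor is an invariant function of the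
  whole path; taken as a density it reduces the claim to \<open>one_step\<close>.
\<close>

theorem emeasure_word:
  assumes "exch_measure Q S s" "set ys \<subseteq> S"
  shows "emeasure Q {x \<in> space Q. word (length ys) x = ys} = (\<integral>\<^sup>+x. ennreal (word_prob S ys s (num_trans x)) \<partial>Q)"
  using assms
proof (induction ys arbitrary: Q s)
  case Nil
  then show ?case by simp
next
  case (Cons v ys)
  interpret exch_measure Q S s by fact
  have v: "v \<in> S" and ys: "set ys \<subseteq> S" using Cons.prems by auto
  let ?i = "\<lambda>x. indicator {x. x 1 = v} x :: ennreal"
  let ?D = "density Q ?i"
  let ?R = "distr ?D (path_space S) (shift 1)"
  have i: "?i \<in> borel_measurable Q"
    unfolding measurable_Q by (intro measurable_indicator_pred pred_coord)
  have sh: "shift 1 \<in> measurable ?D (path_space S)"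
    using measurable_shift[of 1 S] by (simp add: measurable_Q)
  have shQ: "shift 1 \<in> measurable Q (path_space S)"
    using measurable_shift[of 1 S] by (simp add: measurable_Q)
  define g where "g x = ennreal (word_prob S ys v (drop_trans s v (num_trans x)))" for x :: "nat \<Rightarrow> 'a"
  have wp: "(\<lambda>x. ennreal (word_prob S ys v (num_trans x))) \<in> borel_measurable (path_space S)"
    using v ys by (intro measurable_compose[OF measurable_word_prob measurable_ennreal] countable_S measurable_num_trans)
  have g: "g \<in> borel_measurable (path_space S)"
  proof -
    have "(\<lambda>x. word_prob S ys v (drop_trans s v (num_trans x))) \<in> borel_measurable (path_space S)"
      by (intro measurable_word_prob countable_S v ys measurable_drop_trans measurable_num_trans)
    then show ?thesis unfolding g_def by measurable
  qed
  have gfin: "(\<integral>\<^sup>+x. g x \<partial>Q) < \<infinity>"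
  proof -
    have "(\<integral>\<^sup>+x. g x \<partial>Q) \<le> (\<integral>\<^sup>+x. ennreal (3 ^ length ys) \<partial>Q)"
      unfolding g_def by (intro nn_integral_mono ennreal_leI word_prob_range)
    also have "\<dots> = ennreal (3 ^ length ys * measure Q (space Q))"
      by (simp add: emeasure_eq_measure ennreal_mult)
    also have "\<dots> < \<infinity>" by simp
    finally show ?thesis .
  qed
  have ginv: "exch_invariant S g"
    using num_trans_invariant[of S] by (auto simp: exch_invariant_def g_def)
  interpret G: exch_measure "density Q g" S s
    by (rule exch_measure_density[OF g gfin ginv])
  have iff: "word (length (v # ys)) x = v # ys \<longleftrightarrow> x 1 = v \<and> word (length ys) (shift 1 x) = ys" for x
  proof -
    have "(\<lambda>i. x (Suc i)) = shift 1 x" by (simp add: shift_def fun_eq_iff)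
    then show ?thesis by (simp add: word_Suc_left)
  qed
  note ws = word_sets[of S "length ys" ys]
  have "emeasure Q {x \<in> space Q. word (length (v # ys)) x = v # ys} =
      (\<integral>\<^sup>+x. indicator {x. word (length (v # ys)) x = v # ys} x \<partial>Q)"
  proof -
    have "{x \<in> space Q. word (length (v # ys)) x = v # ys} \<in> sets Q"
      using pred_word[of "length (v # ys)" "v # ys" S] sets_eq_imp_space_eq[OF sets_Q]
      by (simp add: pred_def sets_Q)
    then have "emeasure Q {x \<in> space Q. word (length (v # ys)) x = v # ys} =
      (\<integral>\<^sup>+x. indicator {x \<in> space Q. word (length (v # ys)) x = v # ys} x \<partial>Q)" by simp
    also have "\<dots> = (\<integral>\<^sup>+x. indicator {x. word (length (v # ys)) x = v # ys} x \<partial>Q)"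
      by (intro nn_integral_cong) (simp add: indicator_def)
    finally show ?thesis .
  qed
  also have "\<dots> = (\<integral>\<^sup>+x. ?i x * indicator {x \<in> space (path_space S). word (length ys) x = ys} (shift 1 x) \<partial>Q)"
    using measurable_space[OF shQ] unfolding iff by (intro nn_integral_cong) (simp add: indicator_def)
  also have "\<dots> = (\<integral>\<^sup>+x. indicator {x \<in> space (path_space S). word (length ys) x = ys} (shift 1 x) \<partial>?D)"
    by (intro nn_integral_density[symmetric] i measurable_compose[OF shQ] borel_measurable_indicator ws)
  also have "\<dots> = (\<integral>\<^sup>+x. indicator {x \<in> space (path_space S). word (length ys) x = ys} x \<partial>?R)"
    by (intro nn_integral_distr[symmetric] sh borel_measurable_indicator) (simp only: sets_distr ws)
  also have "\<dots> = emeasure ?R {x \<in> space ?R. word (length ys) x = ys}"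
    using ws by simp
  also have "\<dots> = (\<integral>\<^sup>+x. ennreal (word_prob S ys v (num_trans x)) \<partial>?R)"
    by (rule Cons.IH[OF exch_measure_shift[OF v] ys])
  also have "\<dots> = (\<integral>\<^sup>+x. ennreal (word_prob S ys v (num_trans (shift 1 x))) \<partial>?D)"
    using wp by (intro nn_integral_distr[OF sh]) (simp only: measurable_distr_eq1)
  also have "\<dots> = (\<integral>\<^sup>+x. ?i x * ennreal (word_prob S ys v (num_trans (shift 1 x))) \<partial>Q)"
    by (rule nn_integral_density[OF i measurable_compose[OF shQ wp]])
  also have "\<dots> = (\<integral>\<^sup>+x. g x * indicator {x \<in> space Q. x 1 = v} x \<partial>Q)"
  proof (rule nn_integral_cong_AE)
    show "AE x in Q. ?i x * ennreal (word_prob S ys v (num_trans (shift 1 x))) = g x * indicator {x \<in> space Q. x 1 = v} x"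
      using start AE_space
    proof eventually_elim
      case (elim x)
      show ?case
      proof (cases "x 1 = v")
        case True
        then have "num_trans (shift 1 x) = drop_trans s v (num_trans x)"
          using drop_trans_num_trans[of x] elim by simp
        then show ?thesis using True elim by (simp add: g_def)
      qed simp
    qed
  qed
  also have "\<dots> = emeasure (density Q g) {x \<in> space Q. x 1 = v}"
  proof -
    have "{x \<in> space Q. x 1 = v} \<in> sets Q"
      using pred_coord[of 1 v S] sets_eq_imp_space_eq[OF sets_Q] by (simp add: pred_def sets_Q)
    then show ?thesis using g by (simp add: emeasure_density measurable_Q)
  qed
  also have "\<dots> = (\<integral>\<^sup>+x. ennreal (step_prob S s (num_trans x) v) \<partial>density Q g)"
    using G.one_step[OF v] by simp
  also have "\<dots> = (\<integral>\<^sup>+x. g x * ennreal (step_prob S s (num_trans x) v) \<partial>Q)"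
    using g v s_in_S
    by (intro nn_integral_density measurable_compose[OF measurable_step_prob measurable_ennreal] countable_S)
       (auto simp: measurable_Q measurable_num_trans)
  also have "\<dots> = (\<integral>\<^sup>+x. ennreal (word_prob S (v # ys) s (num_trans x)) \<partial>Q)"
    by (intro nn_integral_cong) (simp add: g_def ennreal_mult'' word_prob_range mult.commute)
  finally show ?case .
qed

section \<open>Exchangeability from cylinder probabilities\<close>

lemma word_add: "word (n + k) x = word n x @ word k (shift n x)"
  by (induction k) (simp_all add: word_Suc_right shift_def add.commute)

lemma map_upt_Cons_iff: "map t [0..<length (z # zs)] = z # zs \<longleftrightarrow> t 0 = z \<and> word (length zs) t = zs"
proof -
  have "map t [0..<length (z # zs)] = t 0 # word (length zs) t" by (simp only: Cons_word list.size) simp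
  then show ?thesis by simp
qed

lemma path_measure_eqI_words:
  assumes "countable S" and sets: "sets M = sets (path_space S)" "sets N = sets (path_space S)"
    and "finite_measure M" and start: "AE x in M. x 0 = s" "AE x in N. x 0 = s"
    and eq: "\<And>ys. set ys \<subseteq> S \<Longrightarrow> emeasure M {x \<in> space (path_space S). word (length ys) x = ys} =
       emeasure N {x \<in> space (path_space S). word (length ys) x = ys}"
  shows "M = N"
proof (rule path_measure_eqI[OF assms(1-4)])
  fix zs
  have spM: "space M = space (path_space S)" and spN: "space N = space (path_space S)"
    by (rule sets_eq_imp_space_eq[OF sets(1)], rule sets_eq_imp_space_eq[OF sets(2)])
  show "emeasure M (cylinder S zs) = emeasure N (cylinder S zs)"
  proof (cases zs)
    case Nil
    have "cylinder S zs = {x \<in> space (path_space S). word (length []) x = []}"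
      using Nil by (simp add: cylinder_def)
    then show ?thesis using eq[of "[]"] by simp
  next
    case (Cons z ys)
    have cyl: "cylinder S zs = {x \<in> space (path_space S). x 0 = z \<and> word (length ys) x = ys}"
      unfolding cylinder_def Cons map_upt_Cons_iff ..
    show ?thesis
    proof (cases "set ys \<subseteq> S \<and> z = s")
      case True
      let ?W = "{x \<in> space (path_space S). word (length ys) x = ys}"
      have "emeasure M (cylinder S zs) = emeasure M ?W"
      proof (rule emeasure_eq_AE)
        show "AE x in M. x \<in> cylinder S zs \<longleftrightarrow> x \<in> ?W"
          using start(1) unfolding cyl by eventually_elim (simp add: True)
      qed (simp_all only: sets cylinder_sets word_sets)
      moreover have "emeasure N (cylinder S zs) = emeasure N ?W"
      proof (rule emeasure_eq_AE)
        show "AE x in N. x \<in> cylinder S zs \<longleftrightarrow> x \<in> ?W"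
          using start(2) unfolding cyl by eventually_elim (simp add: True)
      qed (simp_all only: sets cylinder_sets word_sets)
      ultimately show ?thesis using eq[of ys] True by simp
    next
      case False
      have "emeasure K (cylinder S zs) = 0" if "AE x in K. x 0 = s" "sets K = sets (path_space S)" for K
      proof -
        have spK: "space K = space (path_space S)" by (rule sets_eq_imp_space_eq[OF that(2)])
        have "AE x in K. \<not> x \<in> cylinder S zs"
          using that(1) AE_space
        proof eventually_elim
          case (elim x)
          then have "x i \<in> S" for i by (simp add: spK space_path_space)
          then have "set (word (length ys) x) \<subseteq> S" by (auto simp: word_def)
          moreover have "x 0 = z \<and> word (length ys) x = ys" if "x \<in> cylinder S zs"
            using that unfolding cyl by simp
          ultimately show ?case using False elim(1) by metis
        qed
        moreover have "{x \<in> space K. x \<in> cylinder S zs} = cylinder S zs"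
          unfolding spK cyl by blast
        ultimately show ?thesis using emeasure_eq_0_AE[of "\<lambda>x. x \<in> cylinder S zs" K] by metis
      qed
      then show ?thesis using start sets by (simp only:)
    qed
  qed
qed

text \<open>
  Equality of cylinder probabilities extends to the future: for initial words with the same
  transitions, the laws of the future agree on cylinders, because appending the same continuation to
  both words keeps their transitions equal.
\<close>

lemma exch_measureI:
  assumes "finite_measure Q" "countable S" "s \<in> S" and sets_Q: "sets Q = sets (path_space S)"
    and start: "AE x in Q. x 0 = s" and trans: "AE x in Q. \<forall>u\<in>S. finite {i. x i = u}"
    and exch: "\<And>ys ys'. trans_mset s ys = trans_mset s ys' \<Longrightarrow> set ys \<subseteq> S \<Longrightarrow>
      emeasure Q {x \<in> space Q. word (length ys) x = ys} = emeasure Q {x \<in> space Q. word (length ys') x = ys'}"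
  shows "exch_measure Q S s"
proof (rule exch_measure.intro[OF assms(1) exch_measure_axioms.intro])
  interpret finite_measure Q by fact
  have measurable_Q: "measurable Q N = measurable (path_space S) N" for N :: "'b measure"
    by (rule measurable_cong_sets[OF sets_Q refl])
  have spQ: "space Q = space (path_space S)" by (rule sets_eq_imp_space_eq[OF sets_Q])
  define ind where "ind ys x = (indicator {x. word (length ys) x = ys} x :: ennreal)" for ys and x :: "nat \<Rightarrow> 'a"
  have ind: "ind ys \<in> borel_measurable Q" for ys
    unfolding ind_def measurable_cong_sets[OF sets_Q refl] by (intro measurable_indicator_pred pred_word)
  define K where "K ys = distr (density Q (ind ys)) (path_space S) (shift (length ys))" for ys
  have sh: "shift n \<in> measurable (density Q (ind ys)) (path_space S)" for n ys
    using measurable_shift[of n S] by (simp add: measurable_cong_sets[OF sets_Q refl])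
  have K_word: "emeasure (K ys) {x \<in> space (path_space S). word (length zs) x = zs} =
    emeasure Q {x \<in> space Q. word (length (ys @ zs)) x = ys @ zs}" for ys zs
  proof -
    let ?W = "{x \<in> space (path_space S). word (length zs) x = zs}"
    have W: "shift (length ys) -` ?W \<inter> space Q \<in> sets Q"
      using measurable_sets[OF measurable_shift[of "length ys" S] word_sets] by (simp add: spQ sets_Q)
    have "emeasure (K ys) ?W = emeasure (density Q (ind ys)) (shift (length ys) -` ?W \<inter> space Q)"
      unfolding K_def by (subst emeasure_distr[OF sh word_sets]) simp
    also have "\<dots> = (\<integral>\<^sup>+x. ind ys x * indicator (shift (length ys) -` ?W \<inter> space Q) x \<partial>Q)"
      by (rule emeasure_density[OF ind W])
    also have "\<dots> = (\<integral>\<^sup>+x. indicator {x \<in> space Q. word (length (ys @ zs)) x = ys @ zs} x \<partial>Q)"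
    proof (rule nn_integral_cong)
      fix x assume x: "x \<in> space Q"
      have "shift (length ys) x \<in> space (path_space S)"
        using x by (simp add: spQ space_path_space shift_def)
      moreover have "word (length (ys @ zs)) x = ys @ zs \<longleftrightarrow> word (length ys) x = ys \<and> word (length zs) (shift (length ys) x) = zs"
        by (simp add: word_add)
      ultimately show "ind ys x * indicator (shift (length ys) -` ?W \<inter> space Q) x =
          indicator {x \<in> space Q. word (length (ys @ zs)) x = ys @ zs} x"
        using x by (auto simp: ind_def indicator_def)
    qed
    also have "\<dots> = emeasure Q {x \<in> space Q. word (length (ys @ zs)) x = ys @ zs}"
      using word_sets[of S "length (ys @ zs)" "ys @ zs"] by (simp add: spQ sets_Q)
    finally show ?thesis .
  qed
  have K_start: "AE x in K ys. x 0 = last (s # ys)" for ys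
  proof -
    have "AE x in density Q (ind ys). shift (length ys) x 0 = last (s # ys)"
    proof (subst AE_density[OF ind], use start in eventually_elim, rule impI)
      fix x assume x: "x 0 = s" "0 < ind ys x"
      then have "word (length ys) x = ys" by (cases "word (length ys) x = ys") (auto simp: ind_def)
      then show "shift (length ys) x 0 = last (s # ys)"
        using last_word[of x "length ys"] x by (simp add: shift_def)
    qed
    then show ?thesis unfolding K_def
      using pred_coord[of 0 "last (s # ys)" S] unfolding pred_def by (subst AE_distr_iff[OF sh])
  qed
  fix ys ys' and h :: "(nat \<Rightarrow> 'a) \<Rightarrow> ennreal"
  assume eq: "trans_mset s ys = trans_mset s ys'" and ys: "set ys \<subseteq> S"
    and h: "h \<in> borel_measurable (path_space S)"
  have KK: "K ys = K ys'"
  proof (rule path_measure_eqI_words[OF assms(2)])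
    show "sets (K ys) = sets (path_space S)" "sets (K ys') = sets (path_space S)" by (simp_all add: K_def)
    have "finite_measure (density Q (ind ys))"
    proof (rule finite_measureI)
      have "emeasure (density Q (ind ys)) (space Q) = (\<integral>\<^sup>+x. ind ys x * indicator (space Q) x \<partial>Q)"
        by (rule emeasure_density[OF ind sets.top])
      also have "\<dots> \<le> (\<integral>\<^sup>+x. 1 \<partial>Q)" by (intro nn_integral_mono) (auto simp: ind_def indicator_def)
      also have "\<dots> < \<infinity>" by (simp add: less_top[symmetric])
      finally show "emeasure (density Q (ind ys)) (space (density Q (ind ys))) \<noteq> \<infinity>" by simp
    qed
    then show "finite_measure (K ys)"
      unfolding K_def by (rule finite_measure.finite_measure_distr[OF _ sh])
    show "AE x in K ys. x 0 = last (s # ys)" "AE x in K ys'. x 0 = last (s # ys)"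
      using K_start[of ys] K_start[of ys'] trans_mset_eq_last[OF eq] by simp_all
    fix zs assume "set zs \<subseteq> S"
    then show "emeasure (K ys) {x \<in> space (path_space S). word (length zs) x = zs} =
        emeasure (K ys') {x \<in> space (path_space S). word (length zs) x = zs}"
      unfolding K_word using eq ys trans_mset_eq_last[OF eq]
      by (intro exch) (simp_all add: trans_mset_append)
  qed
  have main: "(\<integral>\<^sup>+x. indicator {x. word (length zs) x = zs} x * h (shift (length zs) x) \<partial>Q) = (\<integral>\<^sup>+x. h x \<partial>K zs)" for zs
  proof -
    have "(\<integral>\<^sup>+x. h x \<partial>K zs) = (\<integral>\<^sup>+x. h (shift (length zs) x) \<partial>density Q (ind zs))"
      unfolding K_def using h by (intro nn_integral_distr[OF sh]) (simp only: measurable_distr_eq1)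
    also have "\<dots> = (\<integral>\<^sup>+x. ind zs x * h (shift (length zs) x) \<partial>Q)"
      by (rule nn_integral_density[OF ind])
         (unfold measurable_cong_sets[OF sets_Q refl], rule measurable_compose[OF measurable_shift h])
    finally show ?thesis by (simp add: ind_def)
  qed
  show "(\<integral>\<^sup>+x. indicator {x. word (length ys) x = ys} x * h (shift (length ys) x) \<partial>Q) =
      (\<integral>\<^sup>+x. indicator {x. word (length ys') x = ys'} x * h (shift (length ys') x) \<partial>Q)"
    unfolding main KK ..
qed (fact assms)+

section \<open>Invariant sets and the transition numbers\<close>

definition transition_numbers :: "'a set \<Rightarrow> (nat \<Rightarrow> 'a) \<Rightarrow> 'a \<times> 'a \<Rightarrow> enat" where
  "transition_numbers S x = (\<lambda>(u, v)\<in>S \<times> S. enat_card {i. (x i, x (Suc i)) = (u, v)})"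

definition transition_algebra :: "'a set \<Rightarrow> (nat \<Rightarrow> 'a) measure" where
  "transition_algebra S = vimage_algebra (space (path_space S)) (transition_numbers S)
     (\<Pi>\<^sub>M uv\<in>S \<times> S. count_space UNIV)"

lemma measurable_transition_numbers:
  "transition_numbers S \<in> measurable (path_space S) (\<Pi>\<^sub>M uv\<in>S \<times> S. count_space UNIV)"
proof -
  have "(\<lambda>x. enat_card {i. (x i, x (Suc i)) = (u, v)}) \<in> measurable (path_space S) (count_space UNIV)" for u v
  proof -
    have P: "Measurable.pred (path_space S) (\<lambda>x. (x i, x (Suc i)) = (u, v))" for i
      unfolding prod.inject by (intro pred_intros_logic pred_coord)
    have c: "(\<lambda>x. card {i. (x i, x (Suc i)) = (u, v)}) \<in> measurable (path_space S) (count_space UNIV)"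
      by (rule measurable_card) (use P in \<open>simp only: pred_def mem_Collect_eq\<close>)
    have "(\<lambda>x. enat (card {i. (x i, x (Suc i)) = (u, v)})) \<in> measurable (path_space S) (count_space UNIV)"
      by (rule measurable_compose[OF c]) simp
    then show ?thesis unfolding enat_card_def
      by (rule measurable_If[OF _ measurable_const])
         (use pred_finite_Collect[OF P] in \<open>simp_all only: pred_def space_count_space UNIV_I\<close>)
  qed
  then show ?thesis unfolding transition_numbers_def
    by (intro measurable_restrict) auto
qed

lemma space_transition_algebra: "space (transition_algebra S) = space (path_space S)"
  by (simp add: transition_algebra_def)

lemma sets_transition_algebra:
  "sets (transition_algebra S) =
    {transition_numbers S -` B \<inter> space (path_space S) | B. B \<in> sets (\<Pi>\<^sub>M uv\<in>S \<times> S. count_space UNIV)}"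
  unfolding transition_algebra_def
  by (rule sets_vimage_algebra2) (use measurable_space[OF measurable_transition_numbers] in blast)

lemma transition_algebra_subset: "sets (transition_algebra S) \<subseteq> sets (path_space S)"
  unfolding sets_transition_algebra using measurable_sets[OF measurable_transition_numbers] by blast

lemma measurable_num_trans_transition_algebra:
  assumes "u \<in> S" "v \<in> S"
  shows "(\<lambda>x. real (num_trans x u v)) \<in> borel_measurable (transition_algebra S)"
proof -
  have "transition_numbers S \<in> measurable (transition_algebra S) (\<Pi>\<^sub>M uv\<in>S \<times> S. count_space UNIV)"
    unfolding transition_algebra_def
    by (rule measurable_vimage_algebra1) (use measurable_space[OF measurable_transition_numbers] in blast)
  moreover have "(\<lambda>f. f (u, v)) \<in> measurable (\<Pi>\<^sub>M uv\<in>S \<times> S. count_space (UNIV :: enat set)) (count_space UNIV)"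
    using assms by (intro measurable_component_singleton) simp
  ultimately have "(\<lambda>x. transition_numbers S x (u, v)) \<in> measurable (transition_algebra S) (count_space UNIV)"
    by (rule measurable_compose)
  then have "(\<lambda>x. case transition_numbers S x (u, v) of enat k \<Rightarrow> real k | \<infinity> \<Rightarrow> 0) \<in> borel_measurable (transition_algebra S)"
    by (rule measurable_compose) simp
  moreover have "(case transition_numbers S x (u, v) of enat k \<Rightarrow> real k | \<infinity> \<Rightarrow> 0) = real (num_trans x u v)" for x
    using assms by (simp add: transition_numbers_def enat_card_def num_trans_def)
  ultimately show ?thesis by simp
qed

lemma transition_numbers_invariant: "exch_invariant S (transition_numbers S)"
  unfolding exch_invariant_def
proof (intro ballI impI)
  fix x x' assume "inf_equiv S x x'"
  note * = inf_equiv_transitions[OF this]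
  show "transition_numbers S x = transition_numbers S x'"
    unfolding transition_numbers_def enat_card_def prod.inject
    by (rule restrict_ext) (use * in auto)
qed

text \<open>
  A function that is measurable with respect to the transition numbers is a function of them, and these
  are invariant.
\<close>

lemma measurable_transition_algebra_invariant:
  fixes f :: "(nat \<Rightarrow> 'a) \<Rightarrow> ennreal"
  assumes f: "f \<in> borel_measurable (transition_algebra S)"
  shows "exch_invariant S f"
  unfolding exch_invariant_def
proof (intro ballI impI)
  fix x x' assume x: "x \<in> space (path_space S)" "x' \<in> space (path_space S)" "inf_equiv S x x'"
  have "f -` {f x} \<inter> space (transition_algebra S) \<in> sets (transition_algebra S)"
    by (rule measurable_sets[OF f]) simp
  then obtain B where B: "f -` {f x} \<inter> space (path_space S) = transition_numbers S -` B \<inter> space (path_space S)"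
    unfolding sets_transition_algebra space_transition_algebra by blast
  have "x \<in> f -` {f x} \<inter> space (path_space S)" using x by simp
  then have "transition_numbers S x \<in> B" unfolding B by simp
  moreover have "transition_numbers S x = transition_numbers S x'"
    using transition_numbers_invariant[of S] x unfolding exch_invariant_def by blast
  ultimately have "x' \<in> f -` {f x} \<inter> space (path_space S)" unfolding B using x by simp
  then show "f x = f x'" by simp
qed

text \<open>
  Let \<open>g\<close> be the conditional probability of \<open>A\<close> given the transition numbers. Word probabilities under
  the densities \<open>g\<close> and \<open>indicator A\<close> are integrals of the same function of the transition numbers, so
  they agree by the defining property of \<open>g\<close>. Hence both densities coincide almost everywhere.
\<close>

theorem (in exch_measure) invariant_set_AE_transition_algebra:
  assumes A: "A \<in> sets (path_space S)" and inv: "exch_invariant S (\<lambda>x. x \<in> A)"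
  shows "\<exists>G\<in>sets (transition_algebra S). AE x in Q. x \<in> A \<longleftrightarrow> x \<in> G"
proof -
  let ?F = "transition_algebra S"
  have sub: "subalgebra Q ?F"
    unfolding subalgebra_def using transition_algebra_subset[of S] sets_eq_imp_space_eq[OF sets_Q]
    by (simp add: sets_Q space_transition_algebra)
  interpret finite_measure_subalgebra Q ?F
    by (intro finite_measure_subalgebra.intro finite_measure_axioms finite_measure_subalgebra_axioms.intro sub)
  define a where "a = (indicator A :: (nat \<Rightarrow> 'a) \<Rightarrow> ennreal)"
  have aQ: "a \<in> borel_measurable Q" unfolding a_def by (rule borel_measurable_indicator) (simp add: A sets_Q)
  have aP: "a \<in> borel_measurable (path_space S)" using aQ by (simp add: measurable_Q)
  define g where "g = nn_cond_exp Q ?F a"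
  have gF: "g \<in> borel_measurable ?F" by (simp add: g_def)
  have gQ: "g \<in> borel_measurable Q" by (rule measurable_from_subalg[OF sub gF])
  have gP: "g \<in> borel_measurable (path_space S)" using gQ by (simp add: measurable_Q)
  have cond: "(\<integral>\<^sup>+x. f x * g x \<partial>Q) = (\<integral>\<^sup>+x. f x * a x \<partial>Q)" if "f \<in> borel_measurable ?F" for f
    unfolding g_def by (rule nn_cond_exp_intg[OF that aQ])
  have afin: "(\<integral>\<^sup>+x. a x \<partial>Q) < \<infinity>"
  proof -
    have "(\<integral>\<^sup>+x. a x \<partial>Q) = emeasure Q A" using A by (simp add: a_def sets_Q)
    then show ?thesis by (simp add: less_top[symmetric])
  qed
  have gfin: "(\<integral>\<^sup>+x. g x \<partial>Q) < \<infinity>"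
    using cond[of "\<lambda>_. 1"] afin by simp
  interpret a: exch_measure "density Q a" S s
    using inv by (intro exch_measure_density aP afin) (auto simp: exch_invariant_def a_def indicator_def)
  interpret g: exch_measure "density Q g" S s
    by (intro exch_measure_density gP gfin measurable_transition_algebra_invariant gF)
  have spQ: "space Q = space (path_space S)" by (rule sets_eq_imp_space_eq[OF sets_Q])
  have "density Q g = density Q a"
  proof (rule path_measure_eqI_words[OF countable_S g.sets_Q a.sets_Q g.finite_measure_axioms g.start a.start])
    fix ys assume ys: "set ys \<subseteq> S"
    define w where "w x = ennreal (word_prob S ys s (num_trans x))" for x
    have wF: "w \<in> borel_measurable ?F"
      unfolding w_def
      by (intro measurable_compose[OF measurable_word_prob measurable_ennreal] countable_S s_in_S ys
          measurable_num_trans_transition_algebra)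
    have wQ: "w \<in> borel_measurable Q" by (rule measurable_from_subalg[OF sub wF])
    have "emeasure (density Q g) {x \<in> space (path_space S). word (length ys) x = ys} = (\<integral>\<^sup>+x. w x \<partial>density Q g)"
      using emeasure_word[OF g.exch_measure_axioms ys] by (simp add: w_def spQ)
    also have "\<dots> = (\<integral>\<^sup>+x. g x * w x \<partial>Q)" by (rule nn_integral_density[OF gQ wQ])
    also have "\<dots> = (\<integral>\<^sup>+x. a x * w x \<partial>Q)" using cond[OF wF] by (simp add: mult.commute)
    also have "\<dots> = (\<integral>\<^sup>+x. w x \<partial>density Q a)" by (rule nn_integral_density[OF aQ wQ, symmetric])
    also have "\<dots> = emeasure (density Q a) {x \<in> space (path_space S). word (length ys) x = ys}"
      using emeasure_word[OF a.exch_measure_axioms ys] by (simp add: w_def spQ)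
    finally show "emeasure (density Q g) {x \<in> space (path_space S). word (length ys) x = ys} =
        emeasure (density Q a) {x \<in> space (path_space S). word (length ys) x = ys}" .
  qed
  then have ae: "AE x in Q. g x = a x"
    using density_unique_iff[OF gQ aQ] by simp
  define G where "G = g -` {1} \<inter> space ?F"
  have "G \<in> sets ?F" unfolding G_def by (rule measurable_sets[OF gF]) simp
  moreover have "AE x in Q. x \<in> A \<longleftrightarrow> x \<in> G"
    using ae AE_space
    by eventually_elim (auto simp: G_def a_def indicator_def spQ space_transition_algebra split: if_splits)
  ultimately show ?thesis by blast
qed

section \<open>Back to the process\<close>

text \<open>
  An open set is the union of the cylinders contained in it, and there are only countably many
  cylinders.
\<close>

lemma borel_path_sets_eq:
  assumes "countable S"
  shows "borel_path_sets S = sets (path_space S)"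
proof -
  let ?\<Omega> = "space (path_space S)" and ?O = "{U. openin (path_topology S) U}"
  have top: "topspace (path_topology S) = ?\<Omega>"
    by (auto simp: path_topology_def space_path_space PiE_def Pi_def)
  have open_cyl: "openin (path_topology S) (cylinder S zs)" for zs
  proof -
    have "cylinder S zs = (\<Inter>i\<in>{..<length zs}. {x \<in> ?\<Omega>. x i = zs ! i}) \<inter> ?\<Omega>"
      unfolding cylinder_def prefix_eq_iff by blast
    moreover have "openin (path_topology S) {x \<in> ?\<Omega>. x i = a}" for i a
    proof -
      have "continuous_map (path_topology S) (discrete_topology S) (\<lambda>x. x i)"
        unfolding path_topology_def by (rule continuous_map_product_projection) simp
      then have "openin (path_topology S) {x \<in> topspace (path_topology S). x i \<in> {a} \<inter> S}"
        by (rule openin_continuous_map_preimage) simp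
      moreover have "{x \<in> topspace (path_topology S). x i \<in> {a} \<inter> S} = {x \<in> ?\<Omega>. x i = a}"
        unfolding top by (auto simp: space_path_space)
      ultimately show ?thesis by simp
    qed
    moreover have "openin (path_topology S) ?\<Omega>" unfolding top[symmetric] by simp
    ultimately show ?thesis
      by (cases "zs = []") (auto intro!: openin_Int openin_INT2)
  qed
  have "?O \<subseteq> sets (path_space S)"
  proof safe
    fix U assume U: "openin (path_topology S) U"
    have U_eq: "U = (\<Union>zs\<in>{zs\<in>lists S. cylinder S zs \<subseteq> U}. cylinder S zs)"
    proof (intro equalityI subsetI)
      fix x assume x: "x \<in> U"
      obtain V where V: "finite {i. V i \<noteq> S}" "x \<in> PiE UNIV V" "PiE UNIV V \<subseteq> U"
        using U x unfolding path_topology_def openin_product_topology_alt by auto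
      obtain n where n: "\<And>i. V i \<noteq> S \<Longrightarrow> i < n"
        using V(1) finite_nat_set_iff_bounded[of "{i. V i \<noteq> S}"] by auto
      have xS: "x \<in> ?\<Omega>" using openin_subset[OF U] x top by auto
      define zs where "zs = map x [0..<n]"
      have "cylinder S zs \<subseteq> PiE UNIV V"
      proof
        fix y assume y: "y \<in> cylinder S zs"
        then have "map y [0..<n] = map x [0..<n]" by (simp add: cylinder_def zs_def)
        then have "y i = x i" if "i < n" for i using that by simp
        then show "y \<in> PiE UNIV V"
          using V(2) n y by (auto simp: cylinder_def space_path_space PiE_def Pi_def) metis
      qed
      moreover have "x \<in> cylinder S zs" using xS by (simp add: cylinder_def zs_def)
      moreover have "zs \<in> lists S" using xS by (auto simp: zs_def space_path_space)
      ultimately show "x \<in> (\<Union>zs\<in>{zs\<in>lists S. cylinder S zs \<subseteq> U}. cylinder S zs)"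
        using order_trans[OF _ V(3)] by (intro UN_I[of zs]) simp_all
    qed blast
    have U_sets: "(\<Union>zs\<in>{zs\<in>lists S. cylinder S zs \<subseteq> U}. cylinder S zs) \<in> sets (path_space S)"
      by (intro sets.countable_UN'' countable_subset[OF _ countable_lists[OF assms]] cylinder_sets) auto
    show "U \<in> sets (path_space S)" by (rule ssubst[OF U_eq, of "\<lambda>W. W \<in> sets (path_space S)"]) (rule U_sets)
  qed
  then have "sigma_sets ?\<Omega> ?O \<subseteq> sets (path_space S)" by (rule sets.sigma_sets_subset)
  moreover have "sets (path_space S) \<subseteq> sigma_sets ?\<Omega> ?O"
    unfolding sets_path_space_eq[OF assms] using open_cyl by (intro sigma_sets_subseteq) auto
  ultimately show ?thesis unfolding borel_path_sets_def top by blast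
qed

lemma inf_equiv_sym:
  assumes "inf_equiv S x y"
  shows "inf_equiv S y x"
proof -
  obtain N where N: "\<forall>n\<ge>N. x n = y n" and e: "fin_equiv S N x y"
    using assms unfolding inf_equiv_def by blast
  have "fin_equiv S N y x" using e by (simp add: fin_equiv_def)
  moreover have "\<forall>n\<ge>N. y n = x n" using N by simp
  ultimately show ?thesis unfolding inf_equiv_def by blast
qed

lemma partially_exchangeable_path_sets_eq:
  assumes "countable S"
  shows "partially_exchangeable_path_sets S = {A \<in> sets (path_space S). exch_invariant S (\<lambda>x. x \<in> A)}"
proof -
  have iff: "partially_exchangeable_set S A \<longleftrightarrow> exch_invariant S (\<lambda>x. x \<in> A)"
    if "A \<in> sets (path_space S)" for A
  proof
    have sp: "space (path_space S) = UNIV \<rightarrow> S" by (auto simp: space_path_space)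
    have AS: "A \<subseteq> UNIV \<rightarrow> S" using sets.sets_into_space[OF that] unfolding sp .
    show "exch_invariant S (\<lambda>x. x \<in> A)" if pe: "partially_exchangeable_set S A"
      unfolding exch_invariant_def
    proof (intro ballI impI iffI)
      fix x x' assume x: "x \<in> space (path_space S)" "x' \<in> space (path_space S)" "inf_equiv S x x'"
      have closed: "\<forall>x\<in>A. \<forall>x'\<in>UNIV \<rightarrow> S. inf_equiv S x x' \<longrightarrow> x' \<in> A"
        using pe unfolding partially_exchangeable_set_def by (rule conjunct2)
      show "x' \<in> A" if "x \<in> A" by (rule closed[rule_format, OF that x(2)[unfolded sp] x(3)])
      show "x \<in> A" if "x' \<in> A" by (rule closed[rule_format, OF that x(1)[unfolded sp] inf_equiv_sym[OF x(3)]])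
    qed
    show "partially_exchangeable_set S A" if inv: "exch_invariant S (\<lambda>x. x \<in> A)"
      unfolding partially_exchangeable_set_def
    proof (intro conjI ballI impI AS)
      fix x x' assume x: "x \<in> A" "x' \<in> UNIV \<rightarrow> S" "inf_equiv S x x'"
      have "(x \<in> A) = (x' \<in> A)"
        by (rule inv[unfolded exch_invariant_def sp, rule_format, OF subsetD[OF AS x(1)] x(2,3)])
      then show "x' \<in> A" using x(1) by (rule iffD1)
    qed
  qed
  show ?thesis
    unfolding partially_exchangeable_path_sets_def borel_path_sets_eq[OF assms]
    by (intro Collect_cong conj_cong refl iff)
qed

lemma nth_Cons_word:
  assumes "word n x = ys" "x 0 = s" "i \<le> n"
  shows "(s # ys) ! i = x i"
  using assms Cons_word[of x n] by (cases i) (auto simp: word_eq_iff)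

lemma fin_equiv_words:
  assumes eq: "trans_mset s ys = trans_mset s ys'"
  shows "fin_equiv S (length ys) (\<lambda>i. (s # ys) ! i) (\<lambda>i. (s # ys') ! i)"
proof -
  have w: "word (length zs) (\<lambda>i. (s # zs) ! i) = zs" for zs
    by (simp add: word_eq_iff)
  have pt: "path_trans (length zs) (\<lambda>i. (s # zs) ! i) = trans_mset s zs" for zs
    unfolding path_trans_def w by simp
  have len: "length ys' = length ys" using trans_mset_eq_length[OF eq] by simp
  have "card {i. i < length ys \<and> ((s # ys) ! i, (s # ys) ! Suc i) = (u, v)} =
     card {i. i < length ys \<and> ((s # ys') ! i, (s # ys') ! Suc i) = (u, v)}" for u v
    using count_path_trans[of "length ys" "\<lambda>i. (s # ys) ! i" u v]
      count_path_trans[of "length ys" "\<lambda>i. (s # ys') ! i" u v] pt[of ys] pt[of ys'] len eq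
    unfolding prod.inject by metis
  then show ?thesis unfolding fin_equiv_def by simp
qed

lemma completed_by_null_setsI:
  assumes "E \<in> G" "D \<in> sets P" "E \<in> sets P" and ae: "AE w in P. w \<in> D \<longleftrightarrow> w \<in> E"
    and G: "G \<subseteq> Pow (space P)"
  shows "D \<in> completed_by_null_sets P G"
proof -
  let ?\<Sigma> = "sigma_sets (space P) (G \<union> null_sets (completion P))"
  interpret sigma_algebra "space P" ?\<Sigma>
    using G sets.sets_into_space[of _ "completion P"]
    by (intro sigma_algebra_sigma_sets) (auto simp: null_sets_def)
  have "D - E \<in> null_sets P" "E - D \<in> null_sets P"
    using assms(2,3) ae by (auto intro!: AE_iff_null_sets[THEN iffD2] elim!: eventually_mono)
  then have 1: "D - E \<in> ?\<Sigma>" "E - D \<in> ?\<Sigma>"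
    using null_sets_completionI by (blast intro: sigma_sets.Basic)+
  have 2: "E \<in> ?\<Sigma>" using assms(1) by (blast intro: sigma_sets.Basic)
  have "D = (E - (E - D)) \<union> (D - E)" by blast
  moreover have "(E - (E - D)) \<union> (D - E) \<in> ?\<Sigma>" by (rule Un[OF Diff[OF 2 1(2)] 1(1)])
  ultimately show ?thesis unfolding completed_by_null_sets_def by (rule ssubst)
qed

theorem theorem1p2:
  fixes P :: "'w measure" and S :: "'a set" and X :: "nat \<Rightarrow> 'w \<Rightarrow> 'a"
  assumes "prob_space P"
    and "countable S"
    and "\<And>i. X i \<in> measurable P (count_space S)"
    and "partially_exchangeable_process P S X"
    and "transient_process P S X"
    and "\<exists>s\<in>S. AE w in P. X 0 w = s"
  shows "completed_by_null_sets P (partially_exchangeable_events P S X)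
       = completed_by_null_sets P (transition_events P S X)"
proof -
  interpret P: prob_space P by fact
  obtain s where s: "s \<in> S" and start: "AE w in P. X 0 w = s" using assms(6) by blast
  define Y where "Y w = (\<lambda>i. X i w)" for w
  have XS: "X i w \<in> S" if "w \<in> space P" for i w
    using measurable_space[OF assms(3) that] by simp
  have Y: "Y \<in> measurable P (path_space S)"
    unfolding path_space_def Y_def using XS by (intro measurable_PiM_single' assms(3)) auto
  define Q where "Q = distr P (path_space S) Y"
  have sets_Q: "sets Q = sets (path_space S)" and space_Q: "space Q = space (path_space S)"
    by (simp_all add: Q_def)
  have start_Q: "AE x in Q. x 0 = s"
  proof -
    have 0: "{x \<in> space (path_space S). x 0 = s} \<in> sets (path_space S)"
      using pred_coord[of 0 s S] unfolding pred_def .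
    show ?thesis unfolding Q_def AE_distr_iff[OF Y 0] using start by (simp add: Y_def)
  qed
  have trans_Q: "AE x in Q. \<forall>u\<in>S. finite {i. x i = u}"
    unfolding Q_def AE_distr_iff[OF Y transient_paths_sets[OF assms(2)]]
    using assms(5) by (simp add: transient_process_def Y_def)
  have Q: "exch_measure Q S s"
  proof (rule exch_measureI[OF _ assms(2) s sets_Q start_Q trans_Q])
    show "finite_measure Q" unfolding Q_def by (rule P.finite_measure_distr[OF Y])
    have word_P: "emeasure Q {x \<in> space Q. word (length ys) x = ys} =
        emeasure P {w \<in> space P. \<forall>i\<le>length ys. X i w = (s # ys) ! i}" for ys
    proof -
      note ws = word_sets[of S "length ys" ys]
      have ys_sets: "{w \<in> space P. \<forall>i\<le>length ys. X i w = (s # ys) ! i} \<in> sets P"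
      proof -
        have "{w \<in> space P. X i w = a} \<in> sets P" for i a
        proof -
          have "{w \<in> space P. X i w = a} = X i -` ({a} \<inter> S) \<inter> space P" using XS by auto
          also have "\<dots> \<in> sets P" by (rule measurable_sets[OF assms(3)]) auto
          finally show ?thesis .
        qed
        then show ?thesis by (intro sets.sets_Collect_countable_All sets.sets_Collect_imp) simp_all
      qed
      have "emeasure Q {x \<in> space Q. word (length ys) x = ys} =
          emeasure P (Y -` {x \<in> space (path_space S). word (length ys) x = ys} \<inter> space P)"
        unfolding space_Q unfolding Q_def by (rule emeasure_distr[OF Y ws])
      also have "\<dots> = emeasure P {w \<in> space P. \<forall>i\<le>length ys. X i w = (s # ys) ! i}"
      proof (rule emeasure_eq_AE)
        show "AE w in P. w \<in> Y -` {x \<in> space (path_space S). word (length ys) x = ys} \<inter> space P \<longleftrightarrow>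
          w \<in> {w \<in> space P. \<forall>i\<le>length ys. X i w = (s # ys) ! i}"
          using start AE_space
        proof eventually_elim
          case (elim w)
          have "word (length ys) (Y w) = ys \<longleftrightarrow> (\<forall>i\<le>length ys. X i w = (s # ys) ! i)"
          proof
            assume "word (length ys) (Y w) = ys"
            then show "\<forall>i\<le>length ys. X i w = (s # ys) ! i"
              using nth_Cons_word[of "length ys" "Y w" ys s] elim(1) by (simp add: Y_def)
          next
            assume *: "\<forall>i\<le>length ys. X i w = (s # ys) ! i"
            have "Y w (Suc i) = ys ! i" if "i < length ys" for i
              using *[rule_format, of "Suc i"] that by (simp add: Y_def)
            then show "word (length ys) (Y w) = ys" by (simp add: word_eq_iff)
          qed
          then show ?case using elim(2) measurable_space[OF Y elim(2)] by simp
        qed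
        show "Y -` {x \<in> space (path_space S). word (length ys) x = ys} \<inter> space P \<in> sets P"
          by (rule measurable_sets[OF Y ws])
      qed (rule ys_sets)
      finally show ?thesis .
    qed
    fix ys ys' assume eq: "trans_mset s ys = trans_mset s ys'" and ys: "set ys \<subseteq> S"
    have len: "length ys' = length ys" using trans_mset_eq_length[OF eq] by simp
    have nthS: "(s # zs) ! i \<in> S" if "set zs \<subseteq> S" "i \<le> length zs" for zs i
    proof -
      have "(s # zs) ! i \<in> set (s # zs)" using that(2) by (intro nth_mem) simp
      then show ?thesis using that(1) s by auto
    qed
    have ys': "set ys' \<subseteq> S" using ys trans_mset_eq_set[OF eq] by simp
    have "measure P {w \<in> space P. \<forall>i\<le>length ys. X i w = (s # ys) ! i} =
        measure P {w \<in> space P. \<forall>i\<le>length ys. X i w = (s # ys') ! i}"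
      using assms(4)[unfolded partially_exchangeable_process_def, rule_format, of "length ys" "\<lambda>i. (s # ys) ! i" "\<lambda>i. (s # ys') ! i"]
        nthS[OF ys] nthS[OF ys'] fin_equiv_words[OF eq, of S] len by simp
    then show "emeasure Q {x \<in> space Q. word (length ys) x = ys} = emeasure Q {x \<in> space Q. word (length ys') x = ys'}"
      unfolding word_P by (simp only: len P.emeasure_eq_measure)
  qed
  have events: "partially_exchangeable_events P S X =
      {Y -` A \<inter> space P | A. A \<in> sets (path_space S) \<and> exch_invariant S (\<lambda>x. x \<in> A)}"
    unfolding partially_exchangeable_events_def partially_exchangeable_path_sets_eq[OF assms(2)]
    by (auto simp: Y_def vimage_def Int_def conj_commute)
  let ?N = "\<Pi>\<^sub>M uv\<in>S \<times> S. count_space (UNIV :: enat set)"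
  have TY: "(\<lambda>w. \<lambda>(u, v)\<in>S \<times> S. transition_number X w u v) = (\<lambda>w. transition_numbers S (Y w))"
    by (simp add: transition_numbers_def transition_number_def Y_def)
  have trans_events: "transition_events P S X = {(\<lambda>w. transition_numbers S (Y w)) -` B \<inter> space P | B. B \<in> sets ?N}"
    unfolding transition_events_def TY
    by (rule sets_vimage_algebra2)
       (use measurable_space[OF measurable_compose[OF Y measurable_transition_numbers]] in blast)
  have pull: "Y -` (transition_numbers S -` B \<inter> space (path_space S)) \<inter> space P =
      (\<lambda>w. transition_numbers S (Y w)) -` B \<inter> space P" for B
    using measurable_space[OF Y] by auto
  have sub: "transition_events P S X \<subseteq> partially_exchangeable_events P S X"
  proof
    fix E assume "E \<in> transition_events P S X"
    then obtain B where B: "B \<in> sets ?N" "E = (\<lambda>w. transition_numbers S (Y w)) -` B \<inter> space P"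
      unfolding trans_events by blast
    let ?A = "transition_numbers S -` B \<inter> space (path_space S)"
    have "?A \<in> sets (path_space S)" by (rule measurable_sets[OF measurable_transition_numbers B(1)])
    moreover have "exch_invariant S (\<lambda>x. x \<in> ?A)"
      using transition_numbers_invariant[of S] unfolding exch_invariant_def by (auto simp del: split_paired_All)
    ultimately show "E \<in> partially_exchangeable_events P S X"
      unfolding events B(2) pull[symmetric] by blast
  qed
  have tr_space: "transition_events P S X \<subseteq> Pow (space P)" unfolding trans_events by blast
  have null_space: "null_sets (completion P) \<subseteq> Pow (space P)"
    using sets.sets_into_space[of _ "completion P"] by (auto simp: null_sets_def)
  have "partially_exchangeable_events P S X \<subseteq> completed_by_null_sets P (transition_events P S X)"
  proof
    fix D assume "D \<in> partially_exchangeable_events P S X"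
    then obtain A where A: "A \<in> sets (path_space S)" "exch_invariant S (\<lambda>x. x \<in> A)" and D: "D = Y -` A \<inter> space P"
      unfolding events by blast
    obtain G where G: "G \<in> sets (transition_algebra S)" and ae: "AE x in Q. x \<in> A \<longleftrightarrow> x \<in> G"
      using exch_measure.invariant_set_AE_transition_algebra[OF Q A] by blast
    have GS: "G \<in> sets (path_space S)" using G transition_algebra_subset by blast
    obtain B where B: "B \<in> sets ?N" "G = transition_numbers S -` B \<inter> space (path_space S)"
      using G unfolding sets_transition_algebra by blast
    show "D \<in> completed_by_null_sets P (transition_events P S X)"
    proof (rule completed_by_null_setsI[OF _ _ _ _ tr_space])
      show "Y -` G \<inter> space P \<in> transition_events P S X"
        unfolding trans_events B(2) pull using B(1) by blast
      show "D \<in> sets P" unfolding D by (rule measurable_sets[OF Y A(1)])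
      show "Y -` G \<inter> space P \<in> sets P" by (rule measurable_sets[OF Y GS])
      have "AE w in P. Y w \<in> A \<longleftrightarrow> Y w \<in> G"
        by (rule AE_distrD[OF Y ae[unfolded Q_def]])
      then show "AE w in P. w \<in> D \<longleftrightarrow> w \<in> Y -` G \<inter> space P"
        unfolding D by eventually_elim simp
    qed
  qed
  then have "completed_by_null_sets P (partially_exchangeable_events P S X) \<subseteq>
      completed_by_null_sets P (transition_events P S X)"
    unfolding completed_by_null_sets_def
    using sigma_algebra.sigma_sets_subset[OF sigma_algebra_sigma_sets, of "transition_events P S X \<union> null_sets (completion P)" "space P"]
      tr_space null_space by (auto intro!: sigma_sets_mono)
  moreover have "completed_by_null_sets P (transition_events P S X) \<subseteq>
      completed_by_null_sets P (partially_exchangeable_events P S X)"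
    unfolding completed_by_null_sets_def using sub by (intro sigma_sets_subseteq) auto
  ultimately show ?thesis by (rule antisym)
qed

end
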